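(* Let $V$ be a complex vector space of dimension $4$, let $\Lambda : \mathrm{GL}(V) \to \mathrm{GL}(\wedge^2 V)$, $g \mapsto \wedge^2 g$, let $j$ be a primitive cube root of unity in $\mathbb{C}$, let $E_6 \subset \mathrm{O}(\wedge^2 V)$ be a Weyl group of type $E_6$ realized as a finite subgroup generated by reflections, and let $$W = \Lambda^{-1}\bigl(\langle \mathrm{D}(E_6),\, j\,\mathrm{Id}_{\wedge^2 V}\rangle\bigr) \subset \mathrm{GL}(V).$$ Then the group $W$: (a) has order $155\,520$; (b) is generated by reflections of order $3$; (c) is irreducible and primitive (as a subgroup of $\mathrm{GL}(V)$); (d) admits $12$, $18$, $24$, $30$ as list of degrees.
   Context: Fix a generator $\varepsilon$ of the one-dimensional space $\wedge^4 V$, which identifies $\wedge^4 V$ with $\mathbb{C}$. The form $\beta_\wedge : \wedge^2 V \times \wedge^2 V \to \mathbb{C}$, $(x,y) \mapsto x\wedge y$, is a non-degenerate symmetric bilinear form on the $6$-dimensional space $\wedge^2 V$, and $\mathrm{O}(\wedge^2 V) = \mathrm{O}(\wedge^2 V,\beta_\wedge)$ denotes its orthogonal group. $E_6$ denotes the Weyl group of type $E_6$ (of order $51\,840$), viewed through its (complexified) $6$-dimensional reflection representation as a finite subgroup of $\mathrm{O}(\wedge^2 V)$ generated by reflections. $\mathrm{D}(G)$ denotes the derived subgroup of a group $G$. A reflection of $V$ is an element $s \in \mathrm{GL}(V)$ of finite order whose fixed space $\ker(s-\mathrm{Id}_V)$ has codimension $1$. A subgroup of $\mathrm{GL}(V)$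 is primitive if it is irreducible and does not permute the summands of any decomposition of $V$ as a direct sum of at least two non-zero subspaces. The degrees of a finite group $W\subset\mathrm{GL}(V)$ generated by reflections are the degrees of a family of homogeneous algebraically independent generators of the invariant algebra $\mathbb{C}[V]^W$. *)

theory Defs
  imports Complex_Main "HOL-Algebra.Generated_Groups" "HOL-Algebra.Multiplicative_Group"
begin

text \<open>
  Complex vector spaces are types \<open>'v::ab_group_add\<close> with an explicit scalar multiplication
  \<open>s :: complex \<Rightarrow> 'v \<Rightarrow> 'v\<close> satisfying \<^locale>\<open>vector_space\<close>.  The notions of span, independence and
  dimension are those of that locale.
\<close>

section \<open>Exterior powers\<close>

text \<open>
  A family of \<open>k\<close> vectors is a list of length \<open>k\<close>; the values on lists of other lengths are
  irrelevant.
\<close>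

definition alternating_multilinear ::
  "nat \<Rightarrow> (complex \<Rightarrow> 'v::ab_group_add \<Rightarrow> 'v) \<Rightarrow> (complex \<Rightarrow> 'w::ab_group_add \<Rightarrow> 'w)
    \<Rightarrow> ('v list \<Rightarrow> 'w) \<Rightarrow> bool" where
  "alternating_multilinear k sV sW f \<longleftrightarrow>
     (\<forall>xs i. length xs = k \<and> i < k \<longrightarrow> Vector_Spaces.linear sV sW (\<lambda>v. f (xs[i := v]))) \<and>
     (\<forall>xs i i'. length xs = k \<and> i < i' \<and> i' < k \<and> xs ! i = xs ! i' \<longrightarrow> f xs = 0)"

text \<open>
  \<open>(L, w)\<close> is a \<open>k\<close>-th exterior power of \<open>V\<close>, with \<open>w [v\<^sub>1, \<dots>, v\<^sub>k]\<close> standing for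
  \<open>v\<^sub>1 \<and> \<dots> \<and> v\<^sub>k\<close>.  The universal property is only required for scalar valued maps, because
  a formula cannot quantify over target types; lemma \<open>exterior_power_universal\<close> derives it for
  maps into arbitrary vector spaces.
\<close>

definition exterior_power ::
  "nat \<Rightarrow> (complex \<Rightarrow> 'v::ab_group_add \<Rightarrow> 'v) \<Rightarrow> (complex \<Rightarrow> 'l::ab_group_add \<Rightarrow> 'l)
    \<Rightarrow> ('v list \<Rightarrow> 'l) \<Rightarrow> bool" where
  "exterior_power k sV sL w \<longleftrightarrow>
     vector_space sL \<and> alternating_multilinear k sV sL w \<and>
     (\<forall>f. alternating_multilinear k sV (*) f \<longrightarrow>
        (\<exists>!\<phi>. Vector_Spaces.linear sL (*) \<phi> \<and> (\<forall>xs. length xs = k \<longrightarrow> \<phi> (w xs) = f xs)))"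

text \<open>The map \<open>g \<mapsto> \<and>\<^sup>2 g\<close>.\<close>

definition ext_square_map ::
  "(complex \<Rightarrow> 'l::ab_group_add \<Rightarrow> 'l) \<Rightarrow> ('v list \<Rightarrow> 'l) \<Rightarrow> ('v \<Rightarrow> 'v) \<Rightarrow> 'l \<Rightarrow> 'l" where
  "ext_square_map sL w g =
     (THE h. Vector_Spaces.linear sL sL h \<and> (\<forall>a b. h (w [a, b]) = w [g a, g b]))"

definition bilinear_form :: "(complex \<Rightarrow> 'l::ab_group_add \<Rightarrow> 'l) \<Rightarrow> ('l \<Rightarrow> 'l \<Rightarrow> complex) \<Rightarrow> bool" where
  "bilinear_form s \<beta> \<longleftrightarrow>
     (\<forall>x. Vector_Spaces.linear s (*) (\<beta> x)) \<and> (\<forall>y. Vector_Spaces.linear s (*) (\<lambda>x. \<beta> x y))"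

text \<open>
  The form \<open>(x, y) \<mapsto> x \<and> y\<close> on the exterior square \<open>(L, w2)\<close>, where the line \<open>(M, w4)\<close>, the
  fourth exterior power, is identified with the scalars by its generator \<open>\<epsilon>\<close>.
\<close>

definition wedge_form ::
  "('v list \<Rightarrow> 'l::ab_group_add) \<Rightarrow> (complex \<Rightarrow> 'l \<Rightarrow> 'l) \<Rightarrow> ('v list \<Rightarrow> 'm::ab_group_add)
    \<Rightarrow> (complex \<Rightarrow> 'm \<Rightarrow> 'm) \<Rightarrow> 'm \<Rightarrow> 'l \<Rightarrow> 'l \<Rightarrow> complex" where
  "wedge_form w2 sL w4 sM \<epsilon> =
     (THE \<beta>. bilinear_form sL \<beta> \<and>
        (\<forall>a b c d. sM (\<beta> (w2 [a, b]) (w2 [c, d])) \<epsilon> = w4 [a, b, c, d]))"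


section \<open>Linear groups\<close>

definition GL :: "(complex \<Rightarrow> 'v::ab_group_add \<Rightarrow> 'v) \<Rightarrow> ('v \<Rightarrow> 'v) monoid" where
  "GL s = \<lparr>carrier = {g. Vector_Spaces.linear s s g \<and> bij g}, mult = (\<circ>), one = id\<rparr>"

definition orthogonal_group ::
  "(complex \<Rightarrow> 'l::ab_group_add \<Rightarrow> 'l) \<Rightarrow> ('l \<Rightarrow> 'l \<Rightarrow> complex) \<Rightarrow> ('l \<Rightarrow> 'l) set" where
  "orthogonal_group s \<beta> = {g \<in> carrier (GL s). \<forall>x y. \<beta> (g x) (g y) = \<beta> x y}"

definition is_reflection :: "(complex \<Rightarrow> 'v::ab_group_add \<Rightarrow> 'v) \<Rightarrow> ('v \<Rightarrow> 'v) \<Rightarrow> bool" where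
  "is_reflection s g \<longleftrightarrow>
     g \<in> carrier (GL s) \<and> (\<exists>n>0. g ^^ n = id) \<and>
     vector_space.dim s {v. g v = v} + 1 = vector_space.dim s UNIV"

definition is_irreducible :: "(complex \<Rightarrow> 'v::ab_group_add \<Rightarrow> 'v) \<Rightarrow> ('v \<Rightarrow> 'v) set \<Rightarrow> bool" where
  "is_irreducible s W \<longleftrightarrow>
     (UNIV :: 'v set) \<noteq> {0} \<and>
     (\<forall>U. module.subspace s U \<and> (\<forall>g\<in>W. g ` U \<subseteq> U) \<longrightarrow> U = {0} \<or> U = UNIV)"

text \<open>
  A decomposition of the whole space as the direct sum of the members of a set of non-zero
  subspaces; finiteness of this set is no restriction in finite dimension.
\<close>

definition direct_decomposition :: "(complex \<Rightarrow> 'v::ab_group_add \<Rightarrow> 'v) \<Rightarrow> 'v set set \<Rightarrow> bool" where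
  "direct_decomposition s D \<longleftrightarrow>
     finite D \<and> (\<forall>U\<in>D. module.subspace s U \<and> U \<noteq> {0}) \<and>
     (\<forall>v. \<exists>!f. f \<in> (\<Pi>\<^sub>E U\<in>D. U) \<and> v = (\<Sum>U\<in>D. f U))"

definition is_primitive :: "(complex \<Rightarrow> 'v::ab_group_add \<Rightarrow> 'v) \<Rightarrow> ('v \<Rightarrow> 'v) set \<Rightarrow> bool" where
  "is_primitive s W \<longleftrightarrow>
     is_irreducible s W \<and>
     \<not> (\<exists>D. direct_decomposition s D \<and> card D \<ge> 2 \<and> (\<forall>g\<in>W. \<forall>U\<in>D. g ` U \<in> D))"


section \<open>Weyl groups in their reflection representation\<close>

text \<open>
  \<open>H\<close> acts on the complex vector space as the Weyl group with Cartan matrix \<open>C\<close> (indexed by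
  \<open>I\<close>) acts on its complexified reflection representation: for a suitable basis of simple
  roots \<open>\<alpha> i\<close>, the group \<open>H\<close> is generated by the simple reflections \<open>r i\<close>.
\<close>

definition is_weyl_group ::
  "'i set \<Rightarrow> ('i \<Rightarrow> 'i \<Rightarrow> int) \<Rightarrow> (complex \<Rightarrow> 'l::ab_group_add \<Rightarrow> 'l) \<Rightarrow> ('l \<Rightarrow> 'l) set \<Rightarrow> bool" where
  "is_weyl_group I C s H \<longleftrightarrow>
     (\<exists>\<alpha> r. inj_on \<alpha> I \<and> \<not> module.dependent s (\<alpha> ` I) \<and> module.span s (\<alpha> ` I) = UNIV \<and>
        (\<forall>i\<in>I. r i \<in> carrier (GL s) \<and>
           (\<forall>i'\<in>I. r i (\<alpha> i') = \<alpha> i' - s (of_int (C i i')) (\<alpha> i))) \<and>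
        H = generate (GL s) (r ` I))"

text \<open>
  The Dynkin diagram has the chain 1 - 3 - 4 - 5 - 6, with the node 2 attached to 4.
\<close>

definition cartan_E6 :: "nat \<Rightarrow> nat \<Rightarrow> int" where
  "cartan_E6 i i' =
     (if i = i' then 2
      else if {i, i'} \<in> {{1, 3}, {3, 4}, {4, 5}, {5, 6}, {2, 4}} then - 1
      else 0)"

abbreviation is_weyl_group_E6 ::
  "(complex \<Rightarrow> 'l::ab_group_add \<Rightarrow> 'l) \<Rightarrow> ('l \<Rightarrow> 'l) set \<Rightarrow> bool" where
  "is_weyl_group_E6 \<equiv> is_weyl_group {1..6} cartan_E6"


section \<open>Invariants and degrees\<close>

text \<open>The algebra of functions generated by \<open>S\<close>.\<close>

inductive_set generated_algebra :: "('v \<Rightarrow> complex) set \<Rightarrow> ('v \<Rightarrow> complex) set" for S where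
  const: "(\<lambda>v. c) \<in> generated_algebra S"
| incl: "f \<in> S \<Longrightarrow> f \<in> generated_algebra S"
| add: "f \<in> generated_algebra S \<Longrightarrow> g \<in> generated_algebra S \<Longrightarrow> (\<lambda>v. f v + g v) \<in> generated_algebra S"
| mult: "f \<in> generated_algebra S \<Longrightarrow> g \<in> generated_algebra S \<Longrightarrow> (\<lambda>v. f v * g v) \<in> generated_algebra S"

text \<open>
  The coordinate algebra of the space, as an algebra of functions: it is generated by the linear
  functionals.
\<close>

definition polynomial_functions :: "(complex \<Rightarrow> 'v::ab_group_add \<Rightarrow> 'v) \<Rightarrow> ('v \<Rightarrow> complex) set" where
  "polynomial_functions s = generated_algebra {\<phi>. Vector_Spaces.linear s (*) \<phi>}"

definition homogeneous ::
  "(complex \<Rightarrow> 'v::ab_group_add \<Rightarrow> 'v) \<Rightarrow> nat \<Rightarrow> ('v \<Rightarrow> complex) \<Rightarrow> bool" where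
  "homogeneous s d f \<longleftrightarrow> f \<in> polynomial_functions s \<and> (\<forall>c v. f (s c v) = c ^ d * f v)"

definition invariant_algebra ::
  "(complex \<Rightarrow> 'v::ab_group_add \<Rightarrow> 'v) \<Rightarrow> ('v \<Rightarrow> 'v) set \<Rightarrow> ('v \<Rightarrow> complex) set" where
  "invariant_algebra s W = {f \<in> polynomial_functions s. \<forall>g\<in>W. \<forall>v. f (g v) = f v}"

text \<open>
  A polynomial in \<open>length fs\<close> indeterminates is given by its coefficients \<open>c e\<close> at the
  exponents \<open>e\<close> ranging over a finite set \<open>E\<close>.
\<close>

definition algebraically_independent :: "('v \<Rightarrow> complex) list \<Rightarrow> bool" where
  "algebraically_independent fs \<longleftrightarrow>
     (\<forall>(E :: nat list set) (c :: nat list \<Rightarrow> complex).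
        finite E \<and> (\<forall>e\<in>E. length e = length fs) \<and>
        (\<forall>v. (\<Sum>e\<in>E. c e * (\<Prod>i<length fs. (fs ! i) v ^ (e ! i))) = 0)
        \<longrightarrow> (\<forall>e\<in>E. c e = 0))"

definition has_degrees ::
  "(complex \<Rightarrow> 'v::ab_group_add \<Rightarrow> 'v) \<Rightarrow> ('v \<Rightarrow> 'v) set \<Rightarrow> nat list \<Rightarrow> bool" where
  "has_degrees s W ds \<longleftrightarrow>
     (\<exists>fs. length fs = length ds \<and> (\<forall>i<length ds. homogeneous s (ds ! i) (fs ! i)) \<and>
        algebraically_independent fs \<and> generated_algebra (set fs) = invariant_algebra s W)"


section \<open>The definitions by universal property are unambiguous\<close>

lemma vector_space_scalars: "vector_space ((*) :: complex \<Rightarrow> complex \<Rightarrow> complex)"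
  by unfold_locales (auto simp: algebra_simps)

lemma functional_separates:
  fixes s :: "complex \<Rightarrow> 'l::ab_group_add \<Rightarrow> 'l"
  assumes "vector_space s" and "x \<notin> module.span s S"
  obtains \<phi> where "Vector_Spaces.linear s (*) \<phi>" "\<phi> x \<noteq> 0" "\<And>y. y \<in> S \<Longrightarrow> \<phi> y = 0"
proof -
  interpret vector_space s by fact
  interpret P: vector_space_pair s "(*) :: complex \<Rightarrow> complex \<Rightarrow> complex"
    using assms(1) vector_space_scalars by (simp add: vector_space_pair_def)
  obtain B where B: "B \<subseteq> S" "independent B" "S \<subseteq> span B"
    using maximal_independent_subset by blast
  have xB: "x \<notin> span B"
    using assms(2) B(1) span_mono by blast
  then have ind: "independent (insert x B)"
    using B(2) independent_insert by auto
  have "x \<notin> B" using xB span_base by blast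
  obtain \<phi> where \<phi>: "Vector_Spaces.linear s (*) \<phi>"
    "\<And>y. y \<in> insert x B \<Longrightarrow> \<phi> y = (if y = x then 1 else 0)"
    using P.linear_independent_extend[OF ind, of "\<lambda>y. if y = x then 1 else 0"] by blast
  have "\<phi> y = 0" if "y \<in> S" for y
  proof -
    have "y \<in> span B" using that B(3) by blast
    moreover have "\<And>z. z \<in> B \<Longrightarrow> \<phi> z = 0" using \<phi>(2) \<open>x \<notin> B\<close> by auto
    ultimately show ?thesis using P.linear_eq_0_on_span[OF \<phi>(1)] by blast
  qed
  moreover have "\<phi> x \<noteq> 0" using \<phi>(2) by auto
  ultimately show ?thesis using \<phi>(1) that by blast
qed

lemma alternating_multilinear_compose:
  assumes "alternating_multilinear k sV sW f" and "Vector_Spaces.linear sW sU h"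
  shows "alternating_multilinear k sV sU (\<lambda>xs. h (f xs))"
proof -
  have "h 0 = 0"
    by (rule module_hom.zero[OF module_hom_linearI[OF assms(2)]])
  then show ?thesis
    using assms(1) Vector_Spaces.linear_compose[OF _ assms(2)]
    unfolding alternating_multilinear_def comp_def by auto
qed

lemma exterior_power_span:
  assumes "exterior_power k sV sL w"
  shows "module.span sL {w xs | xs. length xs = k} = UNIV"
proof (rule ccontr)
  interpret vector_space sL using assms by (simp add: exterior_power_def)
  interpret P: vector_space_pair sL "(*) :: complex \<Rightarrow> complex \<Rightarrow> complex"
    using vector_space_axioms vector_space_scalars by (simp add: vector_space_pair_def)
  assume "span {w xs | xs. length xs = k} \<noteq> UNIV"
  then obtain x where "x \<notin> span {w xs | xs. length xs = k}" by blast
  then obtain \<phi> where \<phi>: "Vector_Spaces.linear sL (*) \<phi>" "\<phi> x \<noteq> 0"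
    "\<And>y. y \<in> {w xs | xs. length xs = k} \<Longrightarrow> \<phi> y = 0"
    using functional_separates[OF vector_space_axioms] by blast
  have zero: "Vector_Spaces.linear sL (*) (\<lambda>x. 0::complex)"
    by (rule P.linear_zero)
  have "alternating_multilinear k sV (*) (\<lambda>xs. (0::complex))"
    using alternating_multilinear_compose[OF _ zero] assms by (auto simp: exterior_power_def)
  then have "\<exists>!\<psi>. Vector_Spaces.linear sL (*) \<psi> \<and> (\<forall>xs. length xs = k \<longrightarrow> \<psi> (w xs) = (0::complex))"
    using assms by (simp add: exterior_power_def)
  moreover have "Vector_Spaces.linear sL (*) \<phi> \<and> (\<forall>xs. length xs = k \<longrightarrow> \<phi> (w xs) = 0)"
    using \<phi> by blast
  ultimately have "\<phi> = (\<lambda>x. 0)" using zero by blast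
  with \<phi>(2) show False by simp
qed

lemma exterior_power_universal:
  assumes ext: "exterior_power k sV sL w" and "vector_space sU"
    and f: "alternating_multilinear k sV sU f"
  shows "\<exists>!\<phi>. Vector_Spaces.linear sL sU \<phi> \<and> (\<forall>xs. length xs = k \<longrightarrow> \<phi> (w xs) = f xs)"
proof -
  interpret vector_space sL using ext by (simp add: exterior_power_def)
  interpret U: vector_space sU by fact
  interpret P: vector_space_pair sL sU
    using vector_space_axioms U.vector_space_axioms by (simp add: vector_space_pair_def)
  interpret Q: vector_space_pair sL "(*) :: complex \<Rightarrow> complex \<Rightarrow> complex"
    using vector_space_axioms vector_space_scalars by (simp add: vector_space_pair_def)
  let ?S = "{w xs | xs. length xs = k}"
  have span_S: "span ?S = UNIV" by (rule exterior_power_span[OF ext])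
  obtain B where B: "B \<subseteq> ?S" "independent B" "?S \<subseteq> span B"
    using maximal_independent_subset by blast
  have span_B: "span B = UNIV"
    using span_S span_minimal[OF B(3) subspace_span] by auto
  have "\<forall>b\<in>B. \<exists>xs. length xs = k \<and> w xs = b" using B(1) by auto
  then obtain l where l: "\<And>b. b \<in> B \<Longrightarrow> length (l b) = k \<and> w (l b) = b"
    unfolding bchoice_iff by blast
  obtain \<phi> where \<phi>: "Vector_Spaces.linear sL sU \<phi>" "\<And>b. b \<in> B \<Longrightarrow> \<phi> b = f (l b)"
    using P.linear_independent_extend[OF B(2), of "\<lambda>b. f (l b)"] by blast
  have \<phi>_w: "\<phi> (w xs) = f xs" if xs: "length xs = k" for xs
  proof (rule ccontr)
    assume "\<phi> (w xs) \<noteq> f xs"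
    then have "\<phi> (w xs) - f xs \<notin> U.span {}" by simp
    then obtain \<psi> where \<psi>: "Vector_Spaces.linear sU (*) \<psi>" "\<psi> (\<phi> (w xs) - f xs) \<noteq> (0::complex)"
      by (rule functional_separates[OF U.vector_space_axioms])
    have "alternating_multilinear k sV (*) (\<lambda>xs. \<psi> (f xs))"
      by (rule alternating_multilinear_compose[OF f \<psi>(1)])
    then obtain \<theta> where \<theta>: "Vector_Spaces.linear sL (*) \<theta>" "\<forall>xs. length xs = k \<longrightarrow> \<theta> (w xs) = \<psi> (f xs)"
      using ext unfolding exterior_power_def by (meson ex1_implies_ex)
    have "\<psi> (\<phi> b) = \<theta> b" if "b \<in> B" for b
      using \<phi>(2)[OF that] l[OF that] \<theta>(2) by (metis (no_types))
    moreover have "Vector_Spaces.linear sL (*) (\<lambda>x. \<psi> (\<phi> x))"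
      using Vector_Spaces.linear_compose[OF \<phi>(1) \<psi>(1)] by (simp add: comp_def)
    ultimately have "\<psi> (\<phi> (w xs)) = \<theta> (w xs)"
      using Q.linear_eq_on[OF _ \<theta>(1), of "\<lambda>x. \<psi> (\<phi> x)" "w xs" B] span_B by auto
    then have "\<psi> (\<phi> (w xs)) = \<psi> (f xs)" using \<theta>(2) xs by simp
    moreover have "\<psi> (\<phi> (w xs) - f xs) = \<psi> (\<phi> (w xs)) - \<psi> (f xs)"
      by (rule module_hom.diff[OF module_hom_linearI[OF \<psi>(1)]])
    ultimately show False using \<psi>(2) by simp
  qed
  show ?thesis
  proof (rule ex1I[of _ \<phi>])
    show "Vector_Spaces.linear sL sU \<phi> \<and> (\<forall>xs. length xs = k \<longrightarrow> \<phi> (w xs) = f xs)"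
      using \<phi>(1) \<phi>_w by blast
  next
    fix \<phi>' assume A: "Vector_Spaces.linear sL sU \<phi>' \<and> (\<forall>xs. length xs = k \<longrightarrow> \<phi>' (w xs) = f xs)"
    show "\<phi>' = \<phi>"
    proof
      fix x
      show "\<phi>' x = \<phi> x"
        by (rule P.linear_eq_on[of \<phi>' \<phi> x ?S]) (use A \<phi>(1) \<phi>_w span_S in auto)
    qed
  qed
qed

lemma all_length_two: "(\<forall>xs. length xs = 2 \<longrightarrow> P xs) \<longleftrightarrow> (\<forall>a b. P [a, b])"
proof
  assume P: "\<forall>a b. P [a, b]"
  show "\<forall>xs. length xs = 2 \<longrightarrow> P xs"
  proof (intro allI impI)
    fix xs :: "'a list"
    assume "length xs = 2"
    then have "xs = [xs ! 0, xs ! 1]"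
      by (intro nth_equalityI) (auto simp: less_2_cases_iff)
    with P show "P xs" by metis
  qed
qed simp

lemma alternating_bilinear_iff:
  "alternating_multilinear 2 sV sW f \<longleftrightarrow>
     (\<forall>b. Vector_Spaces.linear sV sW (\<lambda>v. f [v, b])) \<and>
     (\<forall>a. Vector_Spaces.linear sV sW (\<lambda>v. f [a, v])) \<and> (\<forall>a. f [a, a] = 0)"
proof -
  have lt: "(i < 2) = (i = 0 \<or> i = 1)" "(i < i' \<and> i' < 2) = (i = 0 \<and> i' = 1)" for i i' :: nat
    by auto
  have "alternating_multilinear 2 sV sW f \<longleftrightarrow>
     (\<forall>xs. length xs = 2 \<longrightarrow> Vector_Spaces.linear sV sW (\<lambda>v. f (xs[0 := v])) \<and>
        Vector_Spaces.linear sV sW (\<lambda>v. f (xs[1 := v])) \<and> (xs ! 0 = xs ! 1 \<longrightarrow> f xs = 0))"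
    unfolding alternating_multilinear_def using lt by metis
  then show ?thesis unfolding all_length_two by auto
qed

lemma alternating_quadrilinear:
  assumes "alternating_multilinear 4 sV sW f"
  shows "Vector_Spaces.linear sV sW (\<lambda>v. f [v, b, c, d])"
    "Vector_Spaces.linear sV sW (\<lambda>v. f [a, v, c, d])"
    "Vector_Spaces.linear sV sW (\<lambda>v. f [a, b, v, d])"
    "Vector_Spaces.linear sV sW (\<lambda>v. f [a, b, c, v])"
    "f [a, a, c, d] = 0" "f [a, b, c, c] = 0"
proof -
  have lin: "Vector_Spaces.linear sV sW (\<lambda>v. f (xs[i := v]))" if "length xs = 4" "i < 4" for xs i
    using assms that unfolding alternating_multilinear_def by blast
  have alt: "f xs = 0" if "length xs = 4" "i < i'" "i' < 4" "xs ! i = xs ! i'" for xs i i'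
    using assms that unfolding alternating_multilinear_def by blast
  show "Vector_Spaces.linear sV sW (\<lambda>v. f [v, b, c, d])"
    using lin[of "[b, b, c, d]" 0] by simp
  show "Vector_Spaces.linear sV sW (\<lambda>v. f [a, v, c, d])"
    using lin[of "[a, a, c, d]" 1] by simp
  show "Vector_Spaces.linear sV sW (\<lambda>v. f [a, b, v, d])"
    using lin[of "[a, b, b, d]" 2] by (simp add: numeral_2_eq_2)
  show "Vector_Spaces.linear sV sW (\<lambda>v. f [a, b, c, v])"
    using lin[of "[a, b, c, c]" 3] by (simp add: numeral_3_eq_3)
  show "f [a, a, c, d] = 0"
    using alt[of "[a, a, c, d]" 0 1] by simp
  show "f [a, b, c, c] = 0"
    using alt[of "[a, b, c, c]" 2 3] by (simp add: numeral_2_eq_2 numeral_3_eq_3)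
qed

lemma linear_eq_on_wedges:
  assumes ext: "exterior_power 2 sV sL w" and "Vector_Spaces.linear sL sU \<phi>"
    and "Vector_Spaces.linear sL sU \<psi>" and "\<And>a b. \<phi> (w [a, b]) = \<psi> (w [a, b])"
  shows "\<phi> = \<psi>"
proof
  fix x
  interpret P: vector_space_pair sL sU
    using assms(2) by (simp add: Vector_Spaces.linear_def vector_space_pair_def)
  have "\<forall>xs. length xs = 2 \<longrightarrow> \<phi> (w xs) = \<psi> (w xs)"
    unfolding all_length_two using assms(4) by blast
  then show "\<phi> x = \<psi> x"
    by (intro P.linear_eq_on[OF assms(2,3), of x "{w xs | xs. length xs = 2}"])
      (auto simp: exterior_power_span[OF ext])
qed

lemma ext_square_map:
  assumes ext: "exterior_power 2 sV sL w" and g: "Vector_Spaces.linear sV sV g"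
  shows "Vector_Spaces.linear sL sL (ext_square_map sL w g)"
    and "ext_square_map sL w g (w [a, b]) = w [g a, g b]"
proof -
  have "alternating_multilinear 2 sV sL w" and L: "vector_space sL"
    using ext by (auto simp: exterior_power_def)
  then have "alternating_multilinear 2 sV sL (\<lambda>xs. w (map g xs))"
    unfolding alternating_bilinear_iff
    using Vector_Spaces.linear_compose[OF g, of sL] by (auto simp: comp_def)
  from exterior_power_universal[OF ext L this]
  have "\<exists>!h. Vector_Spaces.linear sL sL h \<and> (\<forall>a b. h (w [a, b]) = w [g a, g b])"
    unfolding all_length_two by simp
  from theI'[OF this] show "Vector_Spaces.linear sL sL (ext_square_map sL w g)"
    "ext_square_map sL w g (w [a, b]) = w [g a, g b]"
    unfolding ext_square_map_def by blast+
qed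

lemma wedge_form:
  assumes ext2: "exterior_power 2 sV sL w2" and ext4: "exterior_power 4 sV sM w4"
    and gen: "module.span sM {\<epsilon>} = UNIV" and "\<epsilon> \<noteq> 0"
  shows "bilinear_form sL (wedge_form w2 sL w4 sM \<epsilon>)"
    and "sM (wedge_form w2 sL w4 sM \<epsilon> (w2 [a, b]) (w2 [c, d])) \<epsilon> = w4 [a, b, c, d]"
proof -
  interpret M: vector_space sM using ext4 by (simp add: exterior_power_def)
  have L: "vector_space sL" using ext2 by (simp add: exterior_power_def)
  interpret Q: vector_space_pair sL "(*) :: complex \<Rightarrow> complex \<Rightarrow> complex"
    using L vector_space_scalars by (simp add: vector_space_pair_def)
  have "\<forall>m. \<exists>c. sM c \<epsilon> = m"
    using gen M.span_singleton[of \<epsilon>] by (metis UNIV_I image_iff)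
  then obtain \<kappa> where \<kappa>: "\<And>m. sM (\<kappa> m) \<epsilon> = m" by metis
  have cancel: "x = y" if "sM x \<epsilon> = sM y \<epsilon>" for x y
    using that \<open>\<epsilon> \<noteq> 0\<close> by simp
  have "Vector_Spaces.linear sM (*) \<kappa>"
    unfolding Vector_Spaces.linear_iff
  proof (intro conjI allI)
    show "\<kappa> (x + y) = \<kappa> x + \<kappa> y" for x y
      by (rule cancel) (simp add: \<kappa> M.scale_left_distrib)
    show "\<kappa> (sM c x) = c * \<kappa> x" for c x
      by (rule cancel) (simp add: \<kappa> M.scale_scale[symmetric] del: M.scale_scale)
  qed (rule M.vector_space_axioms vector_space_scalars)+
  then have "alternating_multilinear 4 sV (*) (\<lambda>xs. \<kappa> (w4 xs))"
    using alternating_multilinear_compose ext4 by (auto simp: exterior_power_def)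
  note vol = alternating_quadrilinear[OF this]

  have "\<exists>\<phi>. Vector_Spaces.linear sL (*) \<phi> \<and> (\<forall>a b. \<phi> (w2 [a, b]) = \<kappa> (w4 [a, b, c, d]))" for c d
  proof -
    have "alternating_multilinear 2 sV (*) (\<lambda>xs. \<kappa> (w4 [xs ! 0, xs ! 1, c, d]))"
      unfolding alternating_bilinear_iff using vol by simp
    from exterior_power_universal[OF ext2 vector_space_scalars this]
    show ?thesis unfolding all_length_two by auto
  qed
  then obtain F where F: "\<And>c d. Vector_Spaces.linear sL (*) (F c d)"
    "\<And>a b c d. F c d (w2 [a, b]) = \<kappa> (w4 [a, b, c, d])"
    by metis
  have F_lin: "Vector_Spaces.linear sV (*) (\<lambda>c. F c d x)" "Vector_Spaces.linear sV (*) (\<lambda>d. F c d x)"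
    "F c c x = 0" for c d x
  proof -
    have V: "vector_space sV" using vol(1) by (simp add: Vector_Spaces.linear_def)
    note iff = Vector_Spaces.linear_iff
    have "F (c + c') d = (\<lambda>x. F c d x + F c' d x)" for c c' d
      by (rule linear_eq_on_wedges[OF ext2 F(1) Q.linear_compose_add[OF F(1) F(1)]])
        (use vol(3) in \<open>simp add: F(2) iff\<close>)
    moreover have "F (sV r c) d = (\<lambda>x. r * F c d x)" for r c d
      by (rule linear_eq_on_wedges[OF ext2 F(1) Q.linear_compose_scale_right[OF F(1)]])
        (use vol(3) in \<open>simp add: F(2) iff\<close>)
    ultimately show "Vector_Spaces.linear sV (*) (\<lambda>c. F c d x)"
      using V vector_space_scalars by (simp add: iff)
    have "F c (d + d') = (\<lambda>x. F c d x + F c d' x)" for c d d'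
      by (rule linear_eq_on_wedges[OF ext2 F(1) Q.linear_compose_add[OF F(1) F(1)]])
        (use vol(4) in \<open>simp add: F(2) iff\<close>)
    moreover have "F c (sV r d) = (\<lambda>x. r * F c d x)" for r c d
      by (rule linear_eq_on_wedges[OF ext2 F(1) Q.linear_compose_scale_right[OF F(1)]])
        (use vol(4) in \<open>simp add: F(2) iff\<close>)
    ultimately show "Vector_Spaces.linear sV (*) (\<lambda>d. F c d x)"
      using V vector_space_scalars by (simp add: iff)
    have "F c c = (\<lambda>x. 0)"
      by (rule linear_eq_on_wedges[OF ext2 F(1) Q.linear_zero]) (simp add: F(2) vol(6))
    then show "F c c x = 0" by simp
  qed
  have "\<exists>\<phi>. Vector_Spaces.linear sL (*) \<phi> \<and> (\<forall>c d. \<phi> (w2 [c, d]) = F c d x)" for x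
  proof -
    have "alternating_multilinear 2 sV (*) (\<lambda>xs. F (xs ! 0) (xs ! 1) x)"
      unfolding alternating_bilinear_iff using F_lin by simp
    from exterior_power_universal[OF ext2 vector_space_scalars this]
    show ?thesis unfolding all_length_two by auto
  qed
  then obtain G where G: "\<And>x. Vector_Spaces.linear sL (*) (G x)"
    "\<And>x c d. G x (w2 [c, d]) = F c d x"
    by metis
  have "G (x + y) = (\<lambda>z. G x z + G y z)" for x y
    by (rule linear_eq_on_wedges[OF ext2 G(1) Q.linear_compose_add[OF G(1) G(1)]])
      (use F(1) in \<open>simp add: G(2) Vector_Spaces.linear_iff\<close>)
  moreover have "G (sL r x) = (\<lambda>z. r * G x z)" for r x
    by (rule linear_eq_on_wedges[OF ext2 G(1) Q.linear_compose_scale_right[OF G(1)]])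
      (use F(1) in \<open>simp add: G(2) Vector_Spaces.linear_iff\<close>)
  ultimately have "bilinear_form sL G"
    using G(1) L vector_space_scalars by (simp add: bilinear_form_def Vector_Spaces.linear_iff)
  moreover have "\<forall>a b c d. sM (G (w2 [a, b]) (w2 [c, d])) \<epsilon> = w4 [a, b, c, d]"
    by (simp add: G(2) F(2) \<kappa>)
  moreover have "\<beta> = G"
    if \<beta>: "bilinear_form sL \<beta>" "\<forall>a b c d. sM (\<beta> (w2 [a, b]) (w2 [c, d])) \<epsilon> = w4 [a, b, c, d]" for \<beta>
  proof -
    have "\<beta> (w2 [a, b]) (w2 [c, d]) = G (w2 [a, b]) (w2 [c, d])" for a b c d
      by (rule cancel) (simp add: \<beta>(2) G(2) F(2) \<kappa>)
    then have "\<beta> (w2 [a, b]) = G (w2 [a, b])" for a b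
      using \<beta>(1) G(1) linear_eq_on_wedges[OF ext2] unfolding bilinear_form_def by blast
    then have "(\<lambda>x. \<beta> x y) = (\<lambda>x. G x y)" for y
      using \<beta>(1) \<open>bilinear_form sL G\<close>
        linear_eq_on_wedges[OF ext2, of "(*)" "\<lambda>x. \<beta> x y" "\<lambda>x. G x y"]
      unfolding bilinear_form_def by simp
    then show ?thesis by (intro ext) (rule fun_cong)
  qed
  ultimately have "\<exists>!\<beta>. bilinear_form sL \<beta> \<and>
      (\<forall>a b c d. sM (\<beta> (w2 [a, b]) (w2 [c, d])) \<epsilon> = w4 [a, b, c, d])"
    by (intro ex1I[of _ G]) blast+
  from theI'[OF this] show "bilinear_form sL (wedge_form w2 sL w4 sM \<epsilon>)"
    "sM (wedge_form w2 sL w4 sM \<epsilon> (w2 [a, b]) (w2 [c, d])) \<epsilon> = w4 [a, b, c, d]"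
    unfolding wedge_form_def by blast+
qed

end

theory Submission
  imports Defs "HOL-Computational_Algebra.Polynomial"
begin

text \<open>
  Since the simple roots of \<open>E\<^sub>6\<close> contain three orthogonal isotropic pairs of combinations, and
  isotropic vectors of \<open>\<and>\<^sup>2V\<close> are decomposable, some basis of \<open>V\<close> puts the roots into a standard form
  over the Eisenstein integers, for \<open>\<omega>\<close> equal to \<open>j\<close> or \<open>j\<^sup>2\<close> (the two choices correspond to the two
  families of maximal isotropic subspaces).  In such a basis \<open>\<Lambda>\<close> maps products of two orthogonal
  reflections of order 3, up to \<open>\<omega>\<close>, to products of two adjacent simple reflections; as its kernel is
  \<open>{1, -1}\<close>, \<open>W\<close> is the symmetry group of the Witting polytope, generated by four explicit reflections.

  Its order is the product \<open>240 \<cdot> 27 \<cdot> 8 \<cdot> 3\<close> of orbit lengths along a stabiliser chain.  A summand of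
  an invariant decomposition is stable under every reflection of order 3, whence primitivity.

  For the degrees, take the power sums of the 240 roots.  Their Jacobian does not vanish and has
  degree 80; it is divisible by the square of each of the 40 reflecting linear forms, so it is
  a constant multiple of the product of these squares.  The same divisibility holds with one of
  the four functions replaced by an arbitrary invariant \<open>p\<close>.  By Cramer's rule \<open>dp\<close> is thus a
  combination of the differentials of the power sums with polynomial coefficients; Euler's
  identity, averaging over \<open>W\<close> and induction on the degree express \<open>p\<close> by the power sums.
\<close>

section \<open>Polynomial functions\<close>

text \<open>The group E6 is given only through abstract simple roots in an abstract exterior square.
  Coordinates are therefore made canonical before anything is computed, and after that all group
  theory is a finite evaluation with integer vectors: for roots of norm 3 over the Eisenstein
  integers each reflection acts integrally, so a test for divisibility by 3 replaces complex
  arithmetic, and the six units let 40 vectors stand for 240 roots.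

  The preimage is compared with the reflection group through generators alone: commutators are even
  words in the simple reflections, even words are products along edges of the diagram, and products
  along edges are commutators.

  The invariant theory rests on 11 + 17 + 23 + 29 = 2 * 40. Every reflecting hyperplane carries two
  reflections of order 3, so a nonzero Jacobian of invariants of these degrees has no room for a
  further factor, and only its value at one point has to be computed. As powers up to the 29th occur
  there, this is done modulo 31, where omega becomes 5.\<close>

locale complex_space = vector_space s for s :: "complex \<Rightarrow> 'v::ab_group_add \<Rightarrow> 'v"
begin

abbreviation "P \<equiv> polynomial_functions s"
abbreviation "functional \<phi> \<equiv> Vector_Spaces.linear s (*) \<phi>"

lemma functional_simps:
  assumes "functional \<phi>"
  shows "\<phi> (x + y) = \<phi> x + \<phi> y" "\<phi> (s c x) = c * \<phi> x" "\<phi> 0 = 0" "\<phi> (x - y) = \<phi> x - \<phi> y"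
    "\<phi> (- x) = - \<phi> x" "\<phi> (sum g A) = (\<Sum>a\<in>A. \<phi> (g a))"
proof -
  interpret l: module_hom s "(*)" \<phi> by (rule module_hom_linearI[OF assms])
  show "\<phi> (x + y) = \<phi> x + \<phi> y" "\<phi> (s c x) = c * \<phi> x" "\<phi> 0 = 0" "\<phi> (x - y) = \<phi> x - \<phi> y"
    "\<phi> (- x) = - \<phi> x" "\<phi> (sum g A) = (\<Sum>a\<in>A. \<phi> (g a))"
    by (rule l.add l.scale l.zero l.diff l.neg l.sum)+
qed

lemma poly_fun_induct [consumes 1, case_names const functional add mult]:
  assumes "f \<in> P" "\<And>c. Q (\<lambda>v. c)" "\<And>\<phi>. functional \<phi> \<Longrightarrow> Q \<phi>"
    "\<And>f g. f \<in> P \<Longrightarrow> g \<in> P \<Longrightarrow> Q f \<Longrightarrow> Q g \<Longrightarrow> Q (\<lambda>v. f v + g v)"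
    "\<And>f g. f \<in> P \<Longrightarrow> g \<in> P \<Longrightarrow> Q f \<Longrightarrow> Q g \<Longrightarrow> Q (\<lambda>v. f v * g v)"
  shows "Q f"
  using assms(1) unfolding polynomial_functions_def
proof (induction rule: generated_algebra.induct)
  case (add f g) then show ?case using assms(4) by (simp add: polynomial_functions_def)
next
  case (mult f g) then show ?case using assms(5) by (simp add: polynomial_functions_def)
qed (use assms(2,3) in auto)

lemma P_const: "(\<lambda>v. c) \<in> P"
  unfolding polynomial_functions_def by (rule generated_algebra.const)
lemma P_functional: "functional \<phi> \<Longrightarrow> \<phi> \<in> P"
  unfolding polynomial_functions_def by (rule generated_algebra.incl) simp
lemma P_add: "f \<in> P \<Longrightarrow> g \<in> P \<Longrightarrow> (\<lambda>v. f v + g v) \<in> P"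
  unfolding polynomial_functions_def by (rule generated_algebra.add)
lemma P_mult: "f \<in> P \<Longrightarrow> g \<in> P \<Longrightarrow> (\<lambda>v. f v * g v) \<in> P"
  unfolding polynomial_functions_def by (rule generated_algebra.mult)
lemma P_uminus: "f \<in> P \<Longrightarrow> (\<lambda>v. - f v) \<in> P"
  using P_mult[OF P_const[of "-1"]] by simp
lemma P_diff: "f \<in> P \<Longrightarrow> g \<in> P \<Longrightarrow> (\<lambda>v. f v - g v) \<in> P"
  using P_add[OF _ P_uminus] by fastforce
lemma P_power: "f \<in> P \<Longrightarrow> (\<lambda>v. f v ^ n) \<in> P"
  by (induction n) (auto intro: P_const P_mult)
lemma P_sum: "(\<And>i. i \<in> I \<Longrightarrow> f i \<in> P) \<Longrightarrow> (\<lambda>v. \<Sum>i\<in>I. f i v) \<in> P"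
  by (induction I rule: infinite_finite_induct) (auto intro: P_const P_add)
lemma P_prod_list: "(\<And>x. x \<in> set xs \<Longrightarrow> f x \<in> P) \<Longrightarrow> (\<lambda>v. \<Prod>x\<leftarrow>xs. f x v) \<in> P"
  by (induction xs) (auto intro: P_const P_mult)

lemmas P_intros = P_const P_functional P_add P_mult P_uminus P_diff P_power

lemma P_linear_comp:
  assumes "f \<in> P" "Vector_Spaces.linear s s h"
  shows "(\<lambda>v. f (h v)) \<in> P"
  using assms(1)
proof (induction rule: poly_fun_induct)
  case (functional \<phi>)
  then have "functional (\<lambda>v. \<phi> (h v))"
    using Vector_Spaces.linear_compose[OF assms(2) functional] by (simp add: comp_def)
  then show ?case by (rule P_functional)
qed (auto intro: P_intros)

text \<open>Polynomial functions live on an abstract space. Facts about zeros and derivatives are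
  taken from one variable: along a line they become univariate polynomials.\<close>

lemma poly_along_line:
  assumes "f \<in> P"
  obtains p where "\<And>t. f (v + s t a) = poly p t"
proof -
  have "\<exists>p. \<forall>t. f (v + s t a) = poly p t"
    using assms
  proof (induction rule: poly_fun_induct)
    case (const c) show ?case by (rule exI[of _ "[:c:]"]) simp
  next
    case (functional \<phi>) show ?case
      by (rule exI[of _ "[:\<phi> v, \<phi> a:]"]) (simp add: functional_simps[OF functional])
  next
    case (add f g)
    then obtain p q where "\<And>t. f (v + s t a) = poly p t" "\<And>t. g (v + s t a) = poly q t" by blast
    then show ?case by (intro exI[of _ "p + q"]) simp
  next
    case (mult f g)
    then obtain p q where "\<And>t. f (v + s t a) = poly p t" "\<And>t. g (v + s t a) = poly q t" by blast
    then show ?case by (intro exI[of _ "p * q"]) simp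
  qed
  then show ?thesis using that by blast
qed

lemma zero_on_line:
  assumes "f \<in> P" "g \<in> P" "\<And>t. f (v + s t a) * g (v + s t a) = 0" "f (v + s t0 a) \<noteq> 0"
  shows "g (v + s t a) = 0"
proof -
  obtain p where p: "\<And>t. f (v + s t a) = poly p t" using poly_along_line[OF assms(1)] by metis
  obtain q where q: "\<And>t. g (v + s t a) = poly q t" using poly_along_line[OF assms(2)] by metis
  have "poly (p * q) = poly 0" using assms(3) p q by auto
  then have "p * q = 0" by (simp only: poly_eq_poly_eq_iff)
  moreover have "p \<noteq> 0" using assms(4) p by auto
  ultimately show ?thesis using q by simp
qed

text \<open>Any two points lie on a common line, so the absence of zero divisors is inherited from
  univariate polynomials.\<close>

lemma P_domain:
  assumes "f \<in> P" "g \<in> P" "\<And>v. f v * g v = 0" "f v \<noteq> 0"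
  shows "g w = 0"
  using zero_on_line[OF assms(1,2,3), where v = v and a = "w - v" and ?t0.0 = 0 and t = 1] assms(4)
  by simp

lemma P_cancel:
  assumes "f \<in> P" "g \<in> P" "h \<in> P" "\<And>v. f v * g v = f v * h v" "f v \<noteq> 0"
  shows "g = h"
proof
  fix w
  show "g w = h w"
    using P_domain[OF assms(1) P_diff[OF assms(2,3)] _ assms(5), of w] assms(4)
    by (simp add: algebra_simps)
qed

subsection \<open>Homogeneous functions\<close>

text \<open>A polynomial in the scalar that agrees with a monomial off 0 agrees with it at 0. The
  restriction to nonzero \<open>c\<close> matters because degrees are later found by dividing by
  powers of \<open>c\<close>.\<close>

lemma homogeneousI:
  assumes "f \<in> P" "\<And>c v. c \<noteq> 0 \<Longrightarrow> f (s c v) = c ^ d * f v"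
  shows "homogeneous s d f"
  unfolding homogeneous_def
proof (intro conjI allI)
  fix c v
  obtain p where p: "\<And>t. f (0 + s t v) = poly p t" using poly_along_line[OF assms(1)] by metis
  have "p - monom (f v) d = 0"
  proof (rule ccontr)
    assume "p - monom (f v) d \<noteq> 0"
    then have "finite {x. poly (p - monom (f v) d) x = 0}" by (rule poly_roots_finite)
    moreover have "- {0} \<subseteq> {x. poly (p - monom (f v) d) x = 0}"
      using assms(2) p by (auto simp: poly_monom mult.commute simp flip: p)
    ultimately have "finite (- {0} :: complex set)" by (rule finite_subset[rotated])
    then show False by (simp add: finite_compl infinite_UNIV_char_0)
  qed
  then have "p = monom (f v) d" by simp
  with p[of c] show "f (s c v) = c ^ d * f v" by (simp add: poly_monom mult.commute)
qed (rule assms(1))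

lemma homogeneous_P: "homogeneous s d f \<Longrightarrow> f \<in> P"
  by (simp add: homogeneous_def)

lemma homogeneous_const: "homogeneous s 0 (\<lambda>v. c)"
  by (simp add: homogeneous_def P_const)
lemma homogeneous_zero: "homogeneous s d (\<lambda>v. 0)"
  by (simp add: homogeneous_def P_const)
lemma homogeneous_functional: "functional \<phi> \<Longrightarrow> homogeneous s 1 \<phi>"
  by (simp add: homogeneous_def P_functional functional_simps)
lemma homogeneous_add:
  "homogeneous s d f \<Longrightarrow> homogeneous s d g \<Longrightarrow> homogeneous s d (\<lambda>v. f v + g v)"
  by (auto simp: homogeneous_def P_add algebra_simps)
lemma homogeneous_diff:
  "homogeneous s d f \<Longrightarrow> homogeneous s d g \<Longrightarrow> homogeneous s d (\<lambda>v. f v - g v)"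
  by (auto simp: homogeneous_def P_diff algebra_simps)
lemma homogeneous_mult:
  "homogeneous s d f \<Longrightarrow> homogeneous s d' g \<Longrightarrow> homogeneous s (d + d') (\<lambda>v. f v * g v)"
  by (auto simp: homogeneous_def P_mult power_add)
lemma homogeneous_power:
  "homogeneous s d f \<Longrightarrow> homogeneous s (n * d) (\<lambda>v. f v ^ n)"
  by (auto simp: homogeneous_def P_power power_mult_distrib mult.commute simp flip: power_mult)
lemma homogeneous_sum:
  "(\<And>i. i \<in> I \<Longrightarrow> homogeneous s d (f i)) \<Longrightarrow> homogeneous s d (\<lambda>v. \<Sum>i\<in>I. f i v)"
  by (induction I rule: infinite_finite_induct) (auto intro: homogeneous_zero homogeneous_add)
lemma homogeneous_prod_list:
  "(\<And>x. x \<in> set xs \<Longrightarrow> homogeneous s d (f x)) \<Longrightarrow>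
    homogeneous s (length xs * d) (\<lambda>v. \<Prod>x\<leftarrow>xs. f x v)"
  by (induction xs) (auto intro: homogeneous_const homogeneous_mult)

text \<open>Cancelling \<open>f\<close> gives \<open>c ^ m * g (s c v) = c ^ n * g v\<close>. For
  \<open>m > n\<close> the left side, as a polynomial in \<open>c\<close>, has no term of degree
  \<open>n\<close>, so \<open>g\<close> vanishes. With equal degrees the quotient is constant; with
  the Jacobian as \<open>f\<close> the lemma gives the degrees of the Cramer coefficients.\<close>

lemma homogeneous_quotient:
  assumes f: "homogeneous s m f" "f v0 \<noteq> 0" and g: "g \<in> P" and h: "homogeneous s n h"
    and eq: "\<And>v. f v * g v = h v"
  shows "(m \<le> n \<and> homogeneous s (n - m) g) \<or> g = (\<lambda>v. 0)"
proof -
  have lin: "Vector_Spaces.linear s s (s c)" for c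
    by (simp add: Vector_Spaces.linear_iff vector_space_axioms scale_right_distrib scale_left_commute)
  have step: "c ^ m * g (s c v) = c ^ n * g v" for c v
  proof -
    have "(\<lambda>v. c ^ m * g (s c v)) = (\<lambda>v. c ^ n * g v)"
    proof (rule P_cancel[OF homogeneous_P[OF f(1)] _ _ _ f(2)])
      fix v
      have "f v * (c ^ m * g (s c v)) = f (s c v) * g (s c v)"
        using f(1) by (simp add: homogeneous_def)
      also have "\<dots> = c ^ n * h v" using eq h by (simp add: homogeneous_def)
      finally show "f v * (c ^ m * g (s c v)) = f v * (c ^ n * g v)" by (simp add: eq[symmetric])
    qed (rule P_mult[OF P_const P_linear_comp[OF g lin]] P_mult[OF P_const g])+
    then show ?thesis by meson
  qed
  show ?thesis
  proof (cases "m \<le> n")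
    case True
    have "homogeneous s (n - m) g"
    proof (rule homogeneousI[OF g])
      fix c :: complex and v assume "c \<noteq> 0"
      with step[of c v] True show "g (s c v) = c ^ (n - m) * g v"
        by (simp add: power_diff field_simps)
    qed
    with True show ?thesis by simp
  next
    case False
    have "g v = 0" for v
    proof -
      have "\<exists>p. \<forall>t. g (s t v) = poly p t"
        using poly_along_line[OF g, of 0 v] by (metis add_0)
      then obtain p where p: "\<And>t. g (s t v) = poly p t" by blast
      have "monom 1 m * p = monom (g v) n"
        by (rule poly_ext) (use step in \<open>simp add: poly_monom mult.commute flip: p\<close>)
      then have "coeff (monom 1 m * p) n = g v" by simp
      then show ?thesis using False by (simp add: coeff_monom_mult)
    qed
    then show ?thesis by auto
  qed
qed

text \<open>Records only that a function is a finite sum of homogeneous ones, which is what the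
  reduction of an invariant to homogeneous invariants uses.\<close>

inductive homogeneous_sums :: "('v \<Rightarrow> complex) \<Rightarrow> bool" where
  homog: "homogeneous s d f \<Longrightarrow> homogeneous_sums f"
| add: "homogeneous_sums f \<Longrightarrow> homogeneous_sums g \<Longrightarrow> homogeneous_sums (\<lambda>v. f v + g v)"

lemma homogeneous_sums_mult:
  assumes "homogeneous_sums f" "homogeneous_sums g"
  shows "homogeneous_sums (\<lambda>v. f v * g v)"
  using assms(1)
proof induction
  case (homog d f)
  show ?case using assms(2)
  proof induction
    case (homog d' g)
    with \<open>homogeneous s d f\<close> show ?case by (blast intro: homogeneous_sums.homog homogeneous_mult)
  next
    case (add g h)
    then show ?case using homogeneous_sums.add[OF add.IH] by (simp add: distrib_left)
  qed
next
  case (add f h)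
  then show ?case using homogeneous_sums.add[OF add.IH] by (simp add: distrib_right)
qed

lemma P_homogeneous_sums: "f \<in> P \<Longrightarrow> homogeneous_sums f"
  by (induction rule: poly_fun_induct)
    (blast intro: homogeneous_sums.intros homogeneous_sums_mult homogeneous_const homogeneous_functional)+

subsection \<open>Directional derivatives\<close>

text \<open>The derivative is taken in the complex parameter of the line, so that \<open>'v\<close>
  needs no topology.\<close>

definition dird :: "'v \<Rightarrow> ('v \<Rightarrow> complex) \<Rightarrow> 'v \<Rightarrow> complex" where
  "dird a f v = (THE d. ((\<lambda>t. f (v + s t a)) has_field_derivative d) (at 0))"

lemma dird_eqI: "((\<lambda>t. f (v + s t a)) has_field_derivative d) (at 0) \<Longrightarrow> dird a f v = d"
  unfolding dird_def by (rule the_equality) (auto intro: DERIV_unique)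

lemma has_dird:
  assumes "f \<in> P"
  shows "((\<lambda>t. f (v + s t a)) has_field_derivative dird a f v) (at 0)"
proof -
  obtain p where p: "\<And>t. f (v + s t a) = poly p t" using poly_along_line[OF assms] by metis
  have "((\<lambda>t. f (v + s t a)) has_field_derivative poly (pderiv p) 0) (at 0)"
    unfolding p by (rule poly_DERIV)
  with dird_eqI[OF this] show ?thesis by simp
qed

lemma dird_const: "dird a (\<lambda>v. c) v = 0"
  by (rule dird_eqI) simp

lemma dird_functional: "functional \<phi> \<Longrightarrow> dird a \<phi> v = \<phi> a"
  by (rule dird_eqI) (auto simp: functional_simps intro!: derivative_eq_intros)

lemma dird_add: "f \<in> P \<Longrightarrow> g \<in> P \<Longrightarrow> dird a (\<lambda>v. f v + g v) v = dird a f v + dird a g v"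
  by (rule dird_eqI) (intro DERIV_add has_dird)

lemma dird_mult:
  "f \<in> P \<Longrightarrow> g \<in> P \<Longrightarrow> dird a (\<lambda>v. f v * g v) v = dird a f v * g v + f v * dird a g v"
  by (rule dird_eqI) (use DERIV_mult[OF has_dird has_dird] in \<open>force simp: mult.commute add.commute\<close>)

lemma dird_power:
  "f \<in> P \<Longrightarrow> dird a (\<lambda>v. f v ^ n) v = of_nat n * f v ^ (n - 1) * dird a f v"
  by (rule dird_eqI) (use DERIV_power[OF has_dird, of f v a n] in \<open>simp add: mult_ac\<close>)

lemma dird_sum:
  "(\<And>i. i \<in> I \<Longrightarrow> f i \<in> P) \<Longrightarrow> dird a (\<lambda>v. \<Sum>i\<in>I. f i v) v = (\<Sum>i\<in>I. dird a (f i) v)"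
  by (rule dird_eqI) (intro DERIV_sum has_dird)

lemma dird_P: "f \<in> P \<Longrightarrow> dird a f \<in> P"
proof (induction rule: poly_fun_induct)
  case (const c) then show ?case using P_const[of 0] by (simp add: dird_const[abs_def])
next
  case (functional \<phi>)
  have "dird a \<phi> = (\<lambda>v. \<phi> a)" by (rule ext) (rule dird_functional[OF functional])
  then show ?case using P_const by simp
next
  case (add f g)
  have "dird a (\<lambda>v. f v + g v) = (\<lambda>v. dird a f v + dird a g v)"
    by (rule ext) (rule dird_add[OF add(1,2)])
  then show ?case using P_add[OF add(3,4)] by simp
next
  case (mult f g)
  have "dird a (\<lambda>v. f v * g v) = (\<lambda>v. dird a f v * g v + f v * dird a g v)"
    by (rule ext) (rule dird_mult[OF mult(1,2)])
  then show ?case using P_add[OF P_mult[OF mult(3,2)] P_mult[OF mult(1,4)]] by simp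
qed

text \<open>Linearity turns the line through \<open>v\<close> in direction \<open>a\<close> into the
  line through \<open>h v\<close> in direction \<open>h a\<close>; both descriptions then define the
  same number, for any \<open>f\<close>.\<close>

lemma dird_linear_comp:
  assumes "Vector_Spaces.linear s s h"
  shows "dird a (\<lambda>v. f (h v)) v = dird (h a) f (h v)"
proof -
  interpret h: module_hom s s h by (rule module_hom_linearI[OF assms])
  show ?thesis unfolding dird_def by (simp add: h.add h.scale)
qed

lemma dird_direction:
  assumes "f \<in> P"
  shows "dird (s c a + b) f v = c * dird a f v + dird b f v"
  using assms
  by (induction rule: poly_fun_induct)
    (simp_all add: dird_const dird_functional dird_add dird_mult functional_simps algebra_simps)

lemma dird_scale: "f \<in> P \<Longrightarrow> dird (s c a) f v = c * dird a f v"
  using dird_direction[of f 1 0 0 v] dird_direction[of f c a 0 v] by simp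

lemma euler:
  assumes "homogeneous s d f"
  shows "dird v f v = of_nat d * f v"
proof (rule dird_eqI)
  have "f (v + s t v) = (1 + t) ^ d * f v" for t
    using assms by (simp add: homogeneous_def scale_left_distrib flip: scale_one)
       (metis scale_left_distrib scale_one)
  moreover have "((\<lambda>t. (1 + t) ^ d * f v) has_field_derivative of_nat d * f v) (at 0)"
    by (auto intro!: derivative_eq_intros)
  ultimately show "((\<lambda>t. f (v + s t v)) has_field_derivative of_nat d * f v) (at 0)" by simp
qed

text \<open>For \<open>d = 0\<close> the truncated degree \<open>d - 1\<close> is harmless: the
  derivative of a constant is zero, which is homogeneous of every degree.\<close>

lemma dird_homogeneous:
  assumes "homogeneous s d f"
  shows "homogeneous s (d - 1) (dird a f)"
proof (cases "d = 0")
  case True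
  have "f = (\<lambda>v. f 0)"
  proof
    fix v show "f v = f 0" using assms True by (simp add: homogeneous_def) (metis scale_zero_left)
  qed
  then have "dird a f = (\<lambda>v. 0)" using dird_const by metis
  then show ?thesis by (simp add: homogeneous_zero)
next
  case False
  have f: "f \<in> P" using assms by (rule homogeneous_P)
  have lin: "Vector_Spaces.linear s s (s c)" for c
    by (simp add: Vector_Spaces.linear_iff vector_space_axioms scale_right_distrib scale_left_commute)
  show ?thesis
  proof (rule homogeneousI[OF dird_P[OF f]])
    fix c :: complex and v assume c: "c \<noteq> 0"
    have "c * dird a f (s c v) = dird a (\<lambda>v. f (s c v)) v"
      by (simp add: dird_linear_comp[OF lin] dird_scale[OF f])
    also have "\<dots> = dird a (\<lambda>v. c ^ d * f v) v" using assms by (simp add: homogeneous_def)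
    also have "\<dots> = c ^ d * dird a f v" by (simp add: dird_mult[OF P_const f] dird_const)
    finally show "dird a f (s c v) = c ^ (d - 1) * dird a f v"
      using c False by (cases d) auto
  qed
qed

subsection \<open>Divisibility by linear forms\<close>

text \<open>With \<open>?p\<close> the projection along \<open>a\<close> onto the hyperplane,
  \<open>f v - f (?p v)\<close> is divisible by \<open>l\<close> for every polynomial function, by
  induction with the product rule for differences; the subtracted term vanishes by
  \<open>z\<close>.\<close>

lemma zero_on_hyperplane_imp_divisible:
  assumes f: "f \<in> P" and l: "functional l" "l a = 1" and z: "\<And>v. l v = 0 \<Longrightarrow> f v = 0"
  obtains g where "g \<in> P" "\<And>v. f v = l v * g v"
proof -
  let ?p = "\<lambda>v. v - s (l v) a"
  have lin: "Vector_Spaces.linear s s ?p"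
    using vector_space_axioms
    by (simp add: Vector_Spaces.linear_iff functional_simps[OF l(1)] algebra_simps)
  have "\<exists>g\<in>P. \<forall>v. f v - f (?p v) = l v * g v"
    using f
  proof (induction rule: poly_fun_induct)
    case (const c) show ?case by (rule bexI[of _ "\<lambda>v. 0"]) (auto intro: P_const)
  next
    case (functional \<phi>)
    show ?case by (rule bexI[of _ "\<lambda>v. \<phi> a"]) (auto intro: P_const simp: functional_simps[OF functional])
  next
    case (add f g)
    then obtain f' g' where fg: "f' \<in> P" "g' \<in> P" "\<And>v. f v - f (?p v) = l v * f' v"
      "\<And>v. g v - g (?p v) = l v * g' v" by blast
    show ?case
    proof (rule bexI[of _ "\<lambda>v. f' v + g' v"], rule allI)
      fix v
      show "f v + g v - (f (?p v) + g (?p v)) = l v * (f' v + g' v)"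
        using fg(3,4)[of v] by (simp add: algebra_simps)
    qed (auto intro: P_intros fg)
  next
    case (mult f g)
    then obtain f' g' where fg: "f' \<in> P" "g' \<in> P" "\<And>v. f v - f (?p v) = l v * f' v"
      "\<And>v. g v - g (?p v) = l v * g' v" by blast
    show ?case
    proof (rule bexI[of _ "\<lambda>v. f' v * g v + f (?p v) * g' v"], rule allI)
      fix v
      have "f v * g v - f (?p v) * g (?p v) = (f v - f (?p v)) * g v + f (?p v) * (g v - g (?p v))"
        by (simp add: algebra_simps)
      then show "f v * g v - f (?p v) * g (?p v) = l v * (f' v * g v + f (?p v) * g' v)"
        unfolding fg(3,4) by (simp add: algebra_simps)
    qed (intro P_add P_mult fg mult P_linear_comp[OF _ lin, of f])
  qed
  moreover have "f (?p v) = 0" for v by (rule z) (simp add: functional_simps[OF l(1)] l(2))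
  ultimately show ?thesis using that by auto
qed

text \<open>The kernel of \<open>l\<close> contains the line through any two of its points, so
  functions restricted to it have no zero divisors; that is, \<open>l\<close> is prime.\<close>

lemma functional_prime:
  assumes f: "f \<in> P" and g: "g \<in> P" and l: "functional l" "l a = 1"
    and z: "\<And>v. l v = 0 \<Longrightarrow> f v * g v = 0"
  shows "(\<forall>v. l v = 0 \<longrightarrow> f v = 0) \<or> (\<exists>h\<in>P. \<forall>v. g v = l v * h v)"
proof (cases "\<forall>v. l v = 0 \<longrightarrow> f v = 0")
  case False
  then obtain w where w: "l w = 0" "f w \<noteq> 0" by blast
  have "g v = 0" if v: "l v = 0" for v
    using zero_on_line[OF f g, where v = w and a = "v - w" and ?t0.0 = 0 and t = 1] w z v
    by (simp add: functional_simps[OF l(1)])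
  then show ?thesis
    using zero_on_hyperplane_imp_divisible[OF g l] by metis
qed simp

lemma hyperplane_avoiding:
  assumes m: "functional m"
    and l: "\<And>y. y \<in> set ys \<Longrightarrow> functional (l y)"
    and np: "\<And>y. y \<in> set ys \<Longrightarrow> \<exists>v. m v = 0 \<and> l y v \<noteq> 0"
  shows "\<exists>v. m v = 0 \<and> (\<Prod>y\<leftarrow>ys. (l y v)\<^sup>2) \<noteq> 0"
  using l np
proof (induction ys)
  case Nil show ?case using functional_simps(3)[OF m] by auto
next
  case (Cons y ys)
  then obtain v where v: "m v = 0" "(\<Prod>y\<leftarrow>ys. (l y v)\<^sup>2) \<noteq> 0" by auto
  obtain w where w: "m w = 0" "l y w \<noteq> 0" using Cons.prems(2)[of y] by auto
  let ?r = "\<lambda>v. \<Prod>y\<leftarrow>ys. (l y v)\<^sup>2"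
  have ly: "functional (l y)" using Cons.prems(1) by simp
  have r: "?r \<in> P" by (rule P_prod_list) (use Cons.prems(1) in \<open>auto intro: P_power P_functional\<close>)
  show ?case
  proof (rule ccontr)
    assume "\<not> ?case"
    then have *: "(l y u)\<^sup>2 * ?r u = 0" if "m u = 0" for u using that by auto
    have "?r (w + s 1 (v - w)) = 0"
      by (rule zero_on_line[OF P_power[OF P_functional[OF ly], of 2] r, where ?t0.0 = 0])
        (use * v w in \<open>auto simp: functional_simps[OF m]\<close>)
    with v show False by simp
  qed
qed

text \<open>Takes the place of unique factorisation. The product \<open>?q\<close> of the remaining
  squares does not vanish identically on the kernel of \<open>l x\<close>, so primality splits
  \<open>l x\<close> off the cofactor \<open>g\<close>, and after one cancellation a second
  time.\<close>

lemma divisible_by_prod_squares: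
  assumes f: "f \<in> P"
    and l: "\<And>x. x \<in> set xs \<Longrightarrow> functional (l x) \<and> (\<exists>a. l x a = 1)"
    and dv: "\<And>x. x \<in> set xs \<Longrightarrow> \<exists>g\<in>P. \<forall>v. f v = (l x v)\<^sup>2 * g v"
    and np: "\<And>x y. x \<in> set xs \<Longrightarrow> y \<in> set xs \<Longrightarrow> x \<noteq> y \<Longrightarrow> \<exists>v. l x v = 0 \<and> l y v \<noteq> 0"
    and "distinct xs"
  shows "\<exists>g\<in>P. \<forall>v. f v = (\<Prod>x\<leftarrow>xs. (l x v)\<^sup>2) * g v"
  using l dv np \<open>distinct xs\<close>
proof (induction xs)
  case Nil then show ?case using f by auto
next
  case (Cons x xs)
  then obtain g where g: "g \<in> P" "\<And>v. f v = (\<Prod>x\<leftarrow>xs. (l x v)\<^sup>2) * g v"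
    by (auto simp: Ball_def)
  obtain h where h: "h \<in> P" "\<And>v. f v = (l x v)\<^sup>2 * h v" using Cons.prems(2)[of x] by auto
  obtain a where a: "functional (l x)" "l x a = 1" using Cons.prems(1)[of x] by auto
  let ?q = "\<lambda>v. \<Prod>x\<leftarrow>xs. (l x v)\<^sup>2"
  have q: "?q \<in> P" by (rule P_prod_list) (use Cons.prems(1) in \<open>auto intro: P_intros\<close>)
  have nz: "\<exists>v. l x v = 0 \<and> ?q v \<noteq> 0"
    by (rule hyperplane_avoiding[OF a(1)]) (use Cons.prems in \<open>auto, metis\<close>)
  have step: "\<exists>k\<in>P. \<forall>v. u v = l x v * k v" if u: "u \<in> P" "\<And>v. l x v = 0 \<Longrightarrow> ?q v * u v = 0" for u
    using functional_prime[OF q u(1) a u(2)] nz by blast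
  have "?q v * g v = 0" if "l x v = 0" for v using g(2)[of v] h(2)[of v] that by simp
  then obtain g1 where g1: "g1 \<in> P" "\<And>v. g v = l x v * g1 v" using step[OF g(1)] by blast
  have "(\<lambda>v. ?q v * g1 v) = (\<lambda>v. l x v * h v)"
  proof (rule P_cancel[OF P_functional[OF a(1)] P_mult[OF q g1(1)] P_mult[OF P_functional[OF a(1)] h(1)]])
    fix v
    have "l x v * (?q v * g1 v) = f v" using g(2)[of v] g1(2)[of v] by (simp add: mult_ac)
    also have "\<dots> = l x v * (l x v * h v)" using h(2)[of v] by (simp add: power2_eq_square mult_ac)
    finally show "l x v * (?q v * g1 v) = l x v * (l x v * h v)" .
    show "l x a \<noteq> 0" using a by simp
  qed
  then have "?q v * g1 v = 0" if "l x v = 0" for v using that by (metis mult_zero_left)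
  then obtain g2 where g2: "g2 \<in> P" "\<And>v. g1 v = l x v * g2 v" using step[OF g1(1)] by blast
  show ?case
    by (rule bexI[OF _ g2(1)]) (simp add: g(2) g1(2) g2(2) power2_eq_square mult_ac)
qed

text \<open>In the root direction the derivative satisfies
  \<open>\<zeta> * ?h (\<sigma> v) = ?h v\<close>, and \<open>\<sigma>\<close> fixes the hyperplane,
  so it vanishes there. Its quotient by \<open>l\<close> satisfies the same with
  \<open>\<zeta> * \<zeta>\<close>, again different from 1, and vanishes there too. Order 3 gives
  exactly these two steps.\<close>

lemma reflection_invariant_derivative:
  assumes f: "f \<in> P" and l: "functional l" "l a = 1" and \<zeta>: "\<zeta> ^ 3 = 1" "\<zeta> \<noteq> 1"
    and inv: "\<And>v. f (v + s ((\<zeta> - 1) * l v) a) = f v"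
  shows "\<exists>g\<in>P. \<forall>v. dird a f v = (l v)\<^sup>2 * g v"
proof -
  define \<sigma> where "\<sigma> v = v + s ((\<zeta> - 1) * l v) a" for v
  have lin: "Vector_Spaces.linear s s \<sigma>"
    using vector_space_axioms
    by (simp add: Vector_Spaces.linear_iff functional_simps[OF l(1)] algebra_simps \<sigma>_def)
  have a: "\<sigma> a = s \<zeta> a" by (simp add: \<sigma>_def l(2) algebra_simps)
  have ls: "l (\<sigma> v) = \<zeta> * l v" for v
    by (simp add: \<sigma>_def functional_simps[OF l(1)] l(2) algebra_simps)
  have \<zeta>0: "\<zeta> \<noteq> 0" using \<zeta> by auto
  have \<zeta>2: "\<zeta> * \<zeta> \<noteq> 1" using \<zeta> by (metis power3_eq_cube mult.right_neutral mult.commute)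
  have fix1: "\<sigma> v = v" if "l v = 0" for v using that by (simp add: \<sigma>_def)
  let ?h = "dird a f"
  have hP: "?h \<in> P" by (rule dird_P[OF f])
  have h: "\<zeta> * ?h (\<sigma> v) = ?h v" for v
  proof -
    have "\<zeta> * ?h (\<sigma> v) = dird a (\<lambda>v. f (\<sigma> v)) v"
      by (simp add: dird_linear_comp[OF lin] a dird_scale[OF f])
    also have "(\<lambda>v. f (\<sigma> v)) = f" using inv by (auto simp: \<sigma>_def)
    finally show ?thesis .
  qed
  have "?h v = 0" if "l v = 0" for v using h[of v] fix1[OF that] \<zeta> by auto
  then obtain h1 where h1: "h1 \<in> P" "\<And>v. ?h v = l v * h1 v"
    using zero_on_hyperplane_imp_divisible[OF hP l] by metis
  have "(\<lambda>v. \<zeta> * \<zeta> * h1 (\<sigma> v)) = h1"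
  proof (rule P_cancel[OF P_functional[OF l(1)]])
    show "l v * (\<zeta> * \<zeta> * h1 (\<sigma> v)) = l v * h1 v" for v
      using h[of v] by (simp add: h1(2) ls mult_ac)
    show "l a \<noteq> 0" using l by simp
  qed (intro P_mult P_const P_linear_comp[OF _ lin] h1)+
  then have "\<zeta> * \<zeta> * h1 (\<sigma> v) = h1 v" for v by (rule fun_cong)
  then have "h1 v = 0" if "l v = 0" for v using fix1[OF that] \<zeta>2 by (metis mult_cancel_right1)
  then obtain h2 where "h2 \<in> P" "\<And>v. h1 v = l v * h2 v"
    using zero_on_hyperplane_imp_divisible[OF h1(1) l] by metis
  then show ?thesis using h1(2) by (intro bexI[of _ h2]) (auto simp: power2_eq_square)
qed

end

section \<open>Invariants of finite groups with enough reflections of order 3\<close>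

text \<open>Laplace expansion along the first two rows, over a commutative ring because it is used
  over \<open>eis\<close>, \<open>int\<close> and \<open>complex\<close>. Its pairing of
  complementary minors is the one found for the wedge form in \<open>beta_formula\<close>.\<close>

definition det4 :: "(nat \<Rightarrow> nat \<Rightarrow> 'a::comm_ring_1) \<Rightarrow> 'a" where
  "det4 M =
     (M 0 0 * M 1 1 - M 0 1 * M 1 0) * (M 2 2 * M 3 3 - M 2 3 * M 3 2) -
     (M 0 0 * M 1 2 - M 0 2 * M 1 0) * (M 2 1 * M 3 3 - M 2 3 * M 3 1) +
     (M 0 0 * M 1 3 - M 0 3 * M 1 0) * (M 2 1 * M 3 2 - M 2 2 * M 3 1) +
     (M 0 1 * M 1 2 - M 0 2 * M 1 1) * (M 2 0 * M 3 3 - M 2 3 * M 3 0) -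
     (M 0 1 * M 1 3 - M 0 3 * M 1 1) * (M 2 0 * M 3 2 - M 2 2 * M 3 0) +
     (M 0 2 * M 1 3 - M 0 3 * M 1 2) * (M 2 0 * M 3 1 - M 2 1 * M 3 0)"

lemma less_4_cases: "(i::nat) < 4 \<longleftrightarrow> i = 0 \<or> i = 1 \<or> i = 2 \<or> i = 3"
  by auto

lemma sum_4: "(\<Sum>i<4::nat. f i) = f 0 + f 1 + f 2 + (f 3 :: 'a::comm_monoid_add)"
  by (simp add: eval_nat_numeral)

text \<open>Cramer's rule free of division, so it also holds at points where the Jacobian
  vanishes.\<close>

lemma det4_cramer:
  assumes "k < 4"
  shows "(\<Sum>i<4. det4 (M(i := g)) * M i k) = det4 M * g k"
  using assms unfolding less_4_cases
  by (elim disjE) (simp_all add: det4_def sum_4 algebra_simps)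

lemma det4_row:
  assumes "i < 4"
  shows "det4 (M(i := \<lambda>k. \<Sum>l<4. c l * M l k)) = c i * det4 M"
  using assms unfolding less_4_cases
  by (elim disjE) (simp_all add: det4_def sum_4 algebra_simps)

lemma det4_zero_row: "i < 4 \<Longrightarrow> det4 (M(i := \<lambda>k. 0)) = 0"
  unfolding less_4_cases by (elim disjE) (simp_all add: det4_def)

lemma det4_column:
  assumes "k < 4"
  shows "det4 (\<lambda>i. (M i)(k := \<Sum>l<4. c l * M i l)) = c k * det4 M"
  using assms unfolding less_4_cases
  by (elim disjE) (simp_all add: det4_def sum_4 algebra_simps)

lemma det4_column_scale:
  assumes "k < 4"
  shows "det4 (\<lambda>i. (M i)(k := q * N i)) = q * det4 (\<lambda>i. (M i)(k := N i))"
  using assms unfolding less_4_cases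
  by (elim disjE) (simp_all add: det4_def algebra_simps)

lemma det4_cong:
  "(\<And>i k. i < 4 \<Longrightarrow> k < 4 \<Longrightarrow> M i k = N i k) \<Longrightarrow> det4 M = det4 N"
  unfolding det4_def by simp

section \<open>Dual bases and the Jacobian determinant\<close>

locale frame4 = complex_space s for s :: "complex \<Rightarrow> 'v::ab_group_add \<Rightarrow> 'v" +
  fixes e :: "nat \<Rightarrow> 'v" and X :: "nat \<Rightarrow> 'v \<Rightarrow> complex"
  assumes X_functional: "i < 4 \<Longrightarrow> functional (X i)"
    and X_e: "i < 4 \<Longrightarrow> k < 4 \<Longrightarrow> X i (e k) = (if i = k then 1 else 0)"
    and expand: "v = (\<Sum>i<4. s (X i v) (e i))"
begin

lemma vector_eqI: "(\<And>i. i < 4 \<Longrightarrow> X i u = X i v) \<Longrightarrow> u = v"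
  using expand[of u] expand[of v] by (metis (no_types, lifting) lessThan_iff sum.cong)

lemma dird_expand: "f \<in> P \<Longrightarrow> dird a f v = (\<Sum>k<4. X k a * dird (e k) f v)"
  using dird_direction[of f _ _ _ v] dird_scale[of f _ _ v]
  by (subst expand[of a]) (simp add: sum_4 add.assoc)

definition jac :: "(nat \<Rightarrow> 'v \<Rightarrow> complex) \<Rightarrow> 'v \<Rightarrow> complex" where
  "jac F v = det4 (\<lambda>i k. dird (e k) (F i) v)"

lemma det4_P: "(\<And>i k. i < 4 \<Longrightarrow> k < 4 \<Longrightarrow> M i k \<in> P) \<Longrightarrow> (\<lambda>v. det4 (\<lambda>i k. M i k v)) \<in> P"
  unfolding det4_def by (intro P_add P_diff P_mult) auto

lemma jac_P: "(\<And>i. i < 4 \<Longrightarrow> F i \<in> P) \<Longrightarrow> jac F \<in> P"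
  unfolding jac_def[abs_def] by (intro det4_P dird_P)

lemma jac_homogeneous:
  assumes "\<And>i. i < 4 \<Longrightarrow> homogeneous s (d i) (F i)"
  shows "homogeneous s (\<Sum>i<4. d i - 1) (jac F)"
proof -
  have "homogeneous s (((d 0 - 1) + (d 1 - 1)) + ((d 2 - 1) + (d 3 - 1))) (jac F)"
    unfolding jac_def[abs_def] det4_def
    by (intro homogeneous_add homogeneous_diff homogeneous_mult dird_homogeneous assms) simp_all
  then show ?thesis by (simp add: sum_4 add.assoc)
qed

text \<open>Some coordinate \<open>X k a\<close> is nonzero, so column \<open>k\<close> may be
  replaced, up to this factor, by the derivatives along \<open>a\<close>, all of which are divisible
  by the square of \<open>l\<close>.\<close>

lemma jac_divisible:
  assumes F: "\<And>i. i < 4 \<Longrightarrow> F i \<in> P" and l: "functional l" "l a = 1" and \<zeta>: "\<zeta> ^ 3 = 1" "\<zeta> \<noteq> 1"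
    and inv: "\<And>i v. i < 4 \<Longrightarrow> F i (v + s ((\<zeta> - 1) * l v) a) = F i v"
  shows "\<exists>g\<in>P. \<forall>v. jac F v = (l v)\<^sup>2 * g v"
proof -
  have "\<forall>i\<in>{..<4}. \<exists>g. g \<in> P \<and> (\<forall>v. dird a (F i) v = (l v)\<^sup>2 * g v)"
  proof
    fix i :: nat assume "i \<in> {..<4}"
    then have i: "i < 4" by simp
    show "\<exists>g. g \<in> P \<and> (\<forall>v. dird a (F i) v = (l v)\<^sup>2 * g v)"
      unfolding Bex_def[symmetric]
      by (rule reflection_invariant_derivative[where \<zeta> = \<zeta>, OF F[OF i] l \<zeta>]) (rule inv[OF i])
  qed
  from bchoice[OF this] obtain g
    where "\<forall>i\<in>{..<4}. g i \<in> P \<and> (\<forall>v. dird a (F i) v = (l v)\<^sup>2 * g i v)" ..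
  then have g: "\<And>i. i < 4 \<Longrightarrow> g i \<in> P" "\<And>i v. i < 4 \<Longrightarrow> dird a (F i) v = (l v)\<^sup>2 * g i v"
    by simp_all
  have "\<exists>k<4. X k a \<noteq> 0"
  proof (rule ccontr)
    assume "\<not> ?thesis"
    then have "(\<Sum>i<4. s (X i a) (e i)) = 0" by (intro sum.neutral) simp
    then have "a = 0" using expand[of a] by simp
    with l functional_simps(3)[OF l(1)] show False by simp
  qed
  then obtain k where k: "k < 4" "X k a \<noteq> 0" by blast
  define N where "N i l = (if l = k then g i else dird (e l) (F i))" for i l
  define h where "h v = inverse (X k a) * det4 (\<lambda>i l. N i l v)" for v
  have "N i l \<in> P" if "i < 4" for i l using g(1) F that by (simp add: N_def dird_P)
  then have "h \<in> P" unfolding h_def[abs_def] by (intro P_mult P_const det4_P)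
  moreover have "jac F v = (l v)\<^sup>2 * h v" for v
  proof -
    have "X k a * jac F v = det4 (\<lambda>i. (\<lambda>k. dird (e k) (F i) v)(k := \<Sum>l<4. X l a * dird (e l) (F i) v))"
      unfolding jac_def by (rule det4_column[OF k(1), symmetric])
    also have "\<dots> = det4 (\<lambda>i. (\<lambda>k. dird (e k) (F i) v)(k := (l v)\<^sup>2 * g i v))"
      by (rule det4_cong) (simp add: dird_expand[OF F, symmetric] g)
    also have "\<dots> = (l v)\<^sup>2 * det4 (\<lambda>i. (\<lambda>k. dird (e k) (F i) v)(k := g i v))"
      by (rule det4_column_scale[OF k(1)])
    also have "det4 (\<lambda>i. (\<lambda>k. dird (e k) (F i) v)(k := g i v)) = det4 (\<lambda>i l. N i l v)"
      by (rule det4_cong) (simp add: N_def)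
    finally have "X k a * jac F v = X k a * ((l v)\<^sup>2 * h v)" using k by (simp add: h_def mult_ac)
    with k show ?thesis by simp
  qed
  ultimately show ?thesis by blast
qed

text \<open>Induction on a bound for the total degree of the relation. Differentiating it gives a
  linear relation between the rows of the Jacobian matrix; as the determinant is not the zero
  function, the formal partial derivatives are again relations, of smaller degree, so only a
  constant term could remain.\<close>

lemma jacobian_criterion:
  assumes F: "\<And>i. i < 4 \<Longrightarrow> F i \<in> P" and J: "jac F v0 \<noteq> 0"
    and E: "finite E" "\<And>x. x \<in> E \<Longrightarrow> length x = 4" "\<And>x. x \<in> E \<Longrightarrow> sum_list x \<le> n"
    and rel: "\<And>v. (\<Sum>x\<in>E. c x * (\<Prod>i<4. F i v ^ (x ! i))) = 0"
    and "x \<in> E"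
  shows "c x = 0"
  using E rel \<open>x \<in> E\<close>
proof (induction n arbitrary: E c x)
  case 0
  have "x' = [0,0,0,0]" if "x' \<in> E" for x'
  proof -
    have "length x' = 4" "sum_list x' = 0" using "0.prems"(2,3) that by auto
    then show ?thesis by (auto simp: numeral_eq_Suc length_Suc_conv)
  qed
  then have "E = {[0,0,0,0]}" "x = [0,0,0,0]" using "0.prems"(5) by auto
  then show ?case using "0.prems"(4) by (simp add: eval_nat_numeral)
next
  case (Suc n)
  define mon where "mon x v = (\<Prod>i<4. F i v ^ (x ! i))" for x :: "nat list" and v
  have mon4: "mon x = (\<lambda>v. F 0 v ^ (x ! 0) * F 1 v ^ (x ! 1) * F 2 v ^ (x ! 2) * F 3 v ^ (x ! 3))" for x
    by (simp add: mon_def[abs_def] eval_nat_numeral)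
  have monP: "mon x \<in> P" for x
    unfolding mon4 by (intro P_mult P_power F) auto
  have dmon: "dird a (mon x) v = (\<Sum>i<4. of_nat (x ! i) * mon (x[i := x ! i - 1]) v * dird a (F i) v)"
    if "length x = 4" for a x v
  proof -
    have F': "F 0 \<in> P" "F (Suc 0) \<in> P" "F 2 \<in> P" "F 3 \<in> P" by (simp_all add: F)
    show ?thesis
      unfolding mon4 using that
      by (simp add: dird_mult dird_power P_mult P_power F' sum_4 nth_list_update algebra_simps)
  qed
  \<comment> \<open>\<open>G i\<close> is the partial derivative of the relation in the
    \<open>i\<close>-th indeterminate. Where \<open>x ! i = 0\<close> the truncated exponent is
    harmless, as its coefficient is 0.\<close>
  define G where "G i v = (\<Sum>x\<in>E. c x * of_nat (x ! i) * mon (x[i := x ! i - 1]) v)" for i v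
  have GP: "G i \<in> P" for i
    unfolding G_def[abs_def] by (intro P_sum P_mult P_const monP)
  have "(\<Sum>i<4. G i v * dird a (F i) v) = 0" for a v
  proof -
    have "(\<Sum>i<4. G i v * dird a (F i) v) = (\<Sum>x\<in>E. c x * dird a (mon x) v)"
      unfolding G_def sum_distrib_right
      by (subst sum.swap) (auto intro!: sum.cong simp: dmon Suc.prems(2) sum_distrib_left mult_ac)
    also have "\<dots> = dird a (\<lambda>v. \<Sum>x\<in>E. c x * mon x v) v"
      by (subst dird_sum) (auto intro!: sum.cong P_mult P_const monP simp: dird_mult[OF P_const monP] dird_const)
    also have "(\<lambda>v. \<Sum>x\<in>E. c x * mon x v) = (\<lambda>v. 0)" using Suc.prems(4) by (simp add: mon_def)
    finally show ?thesis by (simp add: dird_const)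
  qed
  then have "jac F v * G i v = 0" if "i < 4" for i v
    using det4_row[OF that, of "\<lambda>i k. dird (e k) (F i) v" "\<lambda>i. G i v"]
    by (simp add: det4_zero_row[OF that] jac_def mult.commute)
  then have G0: "G i v = 0" if "i < 4" for i v
    using P_domain[OF jac_P[OF F] GP _ J] that by blast
  have pos: "c x = 0" if x: "x \<in> E" "i < 4" "x ! i > 0" for x i
  proof -
    \<comment> \<open>To apply the induction hypothesis, \<open>G i\<close> is reindexed by its own
      exponents: only terms with \<open>x ! i > 0\<close> survive, and on them lowering the exponent
      is injective.\<close>
    define E' where "E' = {x \<in> E. x ! i > 0}"
    define dn where "dn x = x[i := x ! i - 1]" for x :: "nat list"
    define c' where "c' y = c (y[i := Suc (y ! i)]) * of_nat (Suc (y ! i))" for y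
    have len: "length x = 4" if "x \<in> E'" for x using that Suc.prems(2) by (simp add: E'_def)
    have up: "(dn x)[i := Suc (dn x ! i)] = x" if "x \<in> E'" for x
      using that x(2) len[OF that] by (simp add: dn_def E'_def)
    have inj: "inj_on dn E'" by (rule inj_on_inverseI) (rule up)
    have "c' (dn x) = 0"
    proof (rule Suc.IH[of "dn ` E'" c' "dn x"])
      show "finite (dn ` E')" using Suc.prems(1) by (simp add: E'_def)
      show "length y = 4" if "y \<in> dn ` E'" for y using that len by (auto simp: dn_def)
      show "sum_list y \<le> n" if "y \<in> dn ` E'" for y
      proof -
        from that obtain z where z: "z \<in> E'" "y = dn z" by blast
        have "sum_list y = sum_list z + (z ! i - 1) - z ! i"
          unfolding z(2) dn_def by (rule sum_list_update) (simp add: len[OF z(1)] x(2))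
        moreover have "sum_list z \<le> Suc n" "z ! i > 0" using z(1) Suc.prems(3) by (auto simp: E'_def)
        ultimately show ?thesis by linarith
      qed
      show "(\<Sum>y\<in>dn ` E'. c' y * (\<Prod>i<4. F i v ^ (y ! i))) = 0" for v
      proof -
        have "(\<Sum>y\<in>dn ` E'. c' y * mon y v) = (\<Sum>x\<in>E'. c' (dn x) * mon (dn x) v)"
          by (simp add: sum.reindex[OF inj])
        also have "\<dots> = (\<Sum>x\<in>E'. c x * of_nat (x ! i) * mon (dn x) v)"
        proof (rule sum.cong[OF refl])
          fix z assume z: "z \<in> E'"
          then have 1: "Suc (dn z ! i) = z ! i" using len[OF z] x(2) by (simp add: dn_def E'_def)
          have 2: "(dn z)[i := z ! i] = z" using up[OF z] unfolding 1 .
          show "c' (dn z) * mon (dn z) v = c z * of_nat (z ! i) * mon (dn z) v"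
            unfolding c'_def 1 2 ..
        qed
        also have "\<dots> = G i v"
          unfolding G_def dn_def by (rule sum.mono_neutral_left) (auto simp: E'_def Suc.prems(1))
        finally show ?thesis using G0[OF x(2)] by (simp add: mon_def)
      qed
      show "dn x \<in> dn ` E'" using x by (simp add: E'_def)
    qed
    moreover have xE': "x \<in> E'" using x by (simp add: E'_def)
    have "c' (dn x) = c x * of_nat (Suc (dn x ! i))" unfolding c'_def up[OF xE'] ..
    ultimately show ?thesis by (simp del: of_nat_Suc)
  qed
  show ?case
  proof (rule ccontr)
    assume nz: "c x \<noteq> 0"
    have zero: "y = [0,0,0,0]" if "y \<in> E" "c y \<noteq> 0" for y
    proof -
      have "y ! i = 0" if "i < 4" for i using pos[OF \<open>y \<in> E\<close> that] \<open>c y \<noteq> 0\<close> by blast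
      from this[of 0] this[of 1] this[of 2] this[of 3] Suc.prems(2)[OF that(1)]
      show ?thesis by (auto simp: numeral_eq_Suc length_Suc_conv)
    qed
    have x0: "x = [0,0,0,0]" by (rule zero[OF Suc.prems(5) nz])
    have "c y = 0" if "y \<in> E - {x}" for y using zero[of y] x0 that by blast
    then have "(\<Sum>y\<in>E. c y * (\<Prod>i<4. F i 0 ^ (y ! i))) = (\<Sum>y\<in>{x}. c y * (\<Prod>i<4. F i 0 ^ (y ! i)))"
      using Suc.prems(5) by (intro sum.mono_neutral_right Suc.prems(1)) simp_all
    with Suc.prems(4)[of 0] have "(\<Sum>y\<in>{x}. c y * (\<Prod>i<4. F i 0 ^ (y ! i))) = 0" by metis
    then show False using nz unfolding x0 by (simp add: eval_nat_numeral)
  qed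
qed

text \<open>The last hypothesis is the classical condition that the numbers \<open>d i - 1\<close>
  add up to the number of reflections, counted as two for each hyperplane of \<open>xs\<close>. It
  forces the Jacobian to have no other factor, and this is what makes the independent invariants
  \<open>F\<close> generate all of them.\<close>

theorem has_degreesI:
  fixes W :: "('v \<Rightarrow> 'v) set" and l :: "'x \<Rightarrow> 'v \<Rightarrow> complex"
  assumes W: "finite W" "id \<in> W" "\<And>g h. g \<in> W \<Longrightarrow> h \<in> W \<Longrightarrow> g \<circ> h \<in> W"
    "\<And>g. g \<in> W \<Longrightarrow> Vector_Spaces.linear s s g" "\<And>g. g \<in> W \<Longrightarrow> surj g"
    and F: "\<And>i. i < 4 \<Longrightarrow> homogeneous s (d i) (F i)"
    and inv: "\<And>i g v. i < 4 \<Longrightarrow> g \<in> W \<Longrightarrow> F i (g v) = F i v"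
    and J: "jac F v0 \<noteq> 0"
    and \<zeta>: "\<zeta> ^ 3 = 1" "\<zeta> \<noteq> 1"
    and rfl: "\<And>x. x \<in> set xs \<Longrightarrow>
      functional (l x) \<and> (\<exists>a. l x a = 1 \<and> (\<lambda>v. v + s ((\<zeta> - 1) * l x v) a) \<in> W)"
    and np: "\<And>x y. x \<in> set xs \<Longrightarrow> y \<in> set xs \<Longrightarrow> x \<noteq> y \<Longrightarrow> \<exists>v. l x v = 0 \<and> l y v \<noteq> 0"
    and xs: "distinct xs" "(\<Sum>i<4. d i - 1) = 2 * length xs"
  shows "has_degrees s W [d 0, d 1, d 2, d 3]"
proof -
  define fs where "fs = [F 0, F 1, F 2, F 3]"
  have fs: "fs ! i = F i" if "i < 4" for i using that by (auto simp: fs_def less_4_cases)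
  have length_fs: "length fs = 4" by (simp add: fs_def)
  have FP: "F i \<in> P" if "i < 4" for i using F[OF that] by (rule homogeneous_P)
  let ?A = "generated_algebra (set fs)"
  let ?q = "\<lambda>v. \<Prod>x\<leftarrow>xs. (l x v)\<^sup>2"

  have dv: "\<exists>g\<in>P. \<forall>v. jac H v = ?q v * g v"
    if H: "\<And>i. i < 4 \<Longrightarrow> H i \<in> P" "\<And>i g v. i < 4 \<Longrightarrow> g \<in> W \<Longrightarrow> H i (g v) = H i v" for H
  proof (rule divisible_by_prod_squares[where f = "jac H" and l = l and xs = xs])
    show "jac H \<in> P" by (rule jac_P) (rule H(1))
    show "distinct xs" by (rule xs(1))
    show "\<exists>v. l x v = 0 \<and> l y v \<noteq> 0" if "x \<in> set xs" "y \<in> set xs" "x \<noteq> y" for x y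
      by (rule np[OF that])
    fix x assume x: "x \<in> set xs"
    from rfl[OF x] obtain a
      where a: "functional (l x)" "l x a = 1" "(\<lambda>v. v + s ((\<zeta> - 1) * l x v) a) \<in> W"
      by (elim conjE exE)
    from a(1,2) show "functional (l x) \<and> (\<exists>a. l x a = 1)" by blast
    show "\<exists>g\<in>P. \<forall>v. jac H v = (l x v)\<^sup>2 * g v"
    proof (rule jac_divisible[where \<zeta> = \<zeta> and a = a])
      show "H i (v + s ((\<zeta> - 1) * l x v) a) = H i v" if "i < 4" for i v
        by (rule H(2)[OF that a(3)])
    qed (rule H(1) a(1,2) \<zeta>; assumption?)+
  qed
  have "\<exists>g\<in>P. \<forall>v. jac F v = ?q v * g v" by (rule dv) (rule FP inv; assumption)+
  then obtain g0 where g0: "g0 \<in> P" "\<And>v. jac F v = ?q v * g0 v" by blast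
  have q: "homogeneous s (length xs * (2 * 1)) ?q"
    by (rule homogeneous_prod_list) 
      (drule rfl, elim conjE, rule homogeneous_power[OF homogeneous_functional])
  have jacF: "homogeneous s (\<Sum>i<4. d i - 1) (jac F)" by (rule jac_homogeneous) (rule F)
  have "?q v0 \<noteq> 0" using J g0(2)[of v0] by auto
  then have "homogeneous s 0 g0 \<or> g0 = (\<lambda>v. 0)"
    using homogeneous_quotient[OF q _ g0(1) jacF g0(2)[symmetric]] xs(2) by auto
  then have "g0 v = g0 v0" for v
    by (auto simp: homogeneous_def) (metis scale_zero_left)
  then obtain c where c: "\<And>v. jac F v = c * ?q v" using g0(2) by (metis mult.commute)
  have c0: "c \<noteq> 0" using c J by force

  \<comment> \<open>The Reynolds operator. The Cramer coefficients need not be invariant; averaging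
    makes them so and leaves the factors \<open>F i\<close> alone.\<close>
  define avg where "avg f v = (\<Sum>g\<in>W. f (g v)) / of_nat (card W)" for f :: "'v \<Rightarrow> complex" and v
  have cW: "of_nat (card W) \<noteq> (0::complex)" using W(1,2) by auto
  have avgP: "avg f \<in> P" if "f \<in> P" for f
  proof -
    have "(\<lambda>v. (\<Sum>g\<in>W. f (g v)) * inverse (of_nat (card W))) \<in> P"
      by (intro P_mult P_sum P_const P_linear_comp[OF that] W(4))
    then show ?thesis by (simp add: avg_def[abs_def] divide_inverse)
  qed
  have avg_inv: "avg f (k v) = avg f v" if k: "k \<in> W" for f k v
  proof -
    have inj: "inj_on (\<lambda>g. g \<circ> k) W"
    proof (rule inj_onI, rule ext)
      fix g h y assume eq: "g \<circ> k = h \<circ> k"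
      obtain x where "y = k x" using W(5)[OF k] by blast
      then show "g y = h y" using fun_cong[OF eq, of x] by simp
    qed
    have "(\<lambda>g. g \<circ> k) ` W = W"
      by (rule endo_inj_surj[OF W(1) _ inj]) (use W(3) k in blast)
    then have "(\<Sum>g\<in>W. f (g v)) = (\<Sum>g\<in>W. f ((g \<circ> k) v))"
      using sum.reindex[OF inj, of "\<lambda>g. f (g v)"] by simp
    then show ?thesis by (simp add: avg_def)
  qed
  have avg_id: "avg f = f" if "\<And>g v. g \<in> W \<Longrightarrow> f (g v) = f v" for f
  proof
    fix v
    have "(\<Sum>g\<in>W. f (g v)) = (\<Sum>g\<in>W. f v)" 
    proof (rule sum.cong[OF refl])
      fix g assume "g \<in> W"
      then show "f (g v) = f v" by (rule that)
    qed
    then show "avg f v = f v" using cW by (simp add: avg_def)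
  qed
  have avg_homog: "homogeneous s k (avg f)" if "homogeneous s k f" for k f
  proof (rule homogeneousI[OF avgP[OF homogeneous_P[OF that]]])
    fix t v
    have "f (g (s t v)) = t ^ k * f (g v)" if "g \<in> W" for g
      using \<open>homogeneous s k f\<close> module_hom.scale[OF module_hom_linearI[OF W(4)[OF that]]]
      by (simp add: homogeneous_def)
    then show "avg f (s t v) = t ^ k * avg f v" by (simp add: avg_def sum_distrib_left)
  qed

  have main: "p \<in> ?A"
    if "homogeneous s n p" "\<And>g v. g \<in> W \<Longrightarrow> p (g v) = p v" for n p
    using that
  proof (induction n arbitrary: p rule: less_induct)
    case (less n)
    note p = less.prems
    have pP: "p \<in> P" using p(1) by (rule homogeneous_P)
    show ?case
    proof (cases "n = 0")
      case True
      have "p = (\<lambda>v. p 0)"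
      proof
        fix v show "p v = p 0" using p(1) True by (simp add: homogeneous_def) (metis scale_zero_left)
      qed
      then show ?thesis using generated_algebra.const by metis
    next
      case False
      have "\<forall>i. \<exists>g. g \<in> P \<and> (\<forall>v. jac (F(i := p)) v = ?q v * g v)"
        unfolding Bex_def[symmetric]
      proof (rule allI, rule dv)
        fix i k :: nat assume "k < 4"
        then show "(F(i := p)) k \<in> P" using FP pP by simp
      next
        fix i k :: nat and g v assume "k < 4" "g \<in> W"
        then show "(F(i := p)) k (g v) = (F(i := p)) k v" using inv[of k g v] p(2)[of g v] by simp
      qed
      from choice[OF this] obtain g
        where g: "\<And>i. g i \<in> P" "\<And>i v. jac (F(i := p)) v = ?q v * g i v" by blast
      define a where "a i v = inverse c * g i v" for i v
      have aP: "a i \<in> P" for i unfolding a_def[abs_def] by (intro P_mult P_const g)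
      have a: "jac F v * a i v = jac (F(i := p)) v" for i v
        using c0 by (simp add: a_def c g(2))
      have D: "dird (e k) p v = (\<Sum>i<4. a i v * dird (e k) (F i) v)" if "k < 4" for k v
      proof -
        have "dird (e k) p = (\<lambda>v. \<Sum>i<4. a i v * dird (e k) (F i) v)"
        proof (rule P_cancel[OF jac_P[OF FP] dird_P[OF pP] _ _ J])
          fix v
          have "jac F v * (\<Sum>i<4. a i v * dird (e k) (F i) v) =
              (\<Sum>i<4. jac (F(i := p)) v * dird (e k) (F i) v)"
            by (simp add: sum_distrib_left a[symmetric] mult.assoc)
          also have "\<dots> = (\<Sum>i<4. det4 ((\<lambda>i k. dird (e k) (F i) v)(i := \<lambda>k. dird (e k) p v)) * dird (e k) (F i) v)"
            by (auto intro!: sum.cong det4_cong simp: jac_def)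
          also have "\<dots> = jac F v * dird (e k) p v"
            unfolding jac_def by (rule det4_cramer[OF that])
          finally show "jac F v * dird (e k) p v = jac F v * (\<Sum>i<4. a i v * dird (e k) (F i) v)" ..
        qed (auto intro!: P_sum P_mult aP dird_P FP)
        then show ?thesis by (rule fun_cong)
      qed
      have rep: "of_nat n * p v = (\<Sum>i<4. of_nat (d i) * (a i v * F i v))" for v
      proof -
        have "of_nat n * p v = dird v p v" by (rule euler[OF p(1), symmetric])
        also have "\<dots> = (\<Sum>i<4. a i v * (\<Sum>k<4. X k v * dird (e k) (F i) v))"
          by (subst dird_expand[OF pP]) (simp add: D sum_4 algebra_simps)
        also have "\<dots> = (\<Sum>i<4. a i v * (of_nat (d i) * F i v))"
        proof (rule sum.cong[OF refl])
          fix i :: nat assume "i \<in> {..<4}"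
          then have i: "i < 4" by simp
          show "a i v * (\<Sum>k<4. X k v * dird (e k) (F i) v) = a i v * (of_nat (d i) * F i v)"
            using euler[OF F[OF i], of v] dird_expand[OF FP[OF i], of v v] by metis
        qed
        finally show ?thesis by (simp add: mult_ac)
      qed
      \<comment> \<open>A candidate of degree 0 would not get a coefficient of smaller degree, but
        Euler's identity weights it with \<open>d i = 0\<close>; hence the second
        alternative.\<close>
      have summand: "(\<lambda>v. avg (a i) v * F i v) \<in> ?A \<or> of_nat (d i) = (0::complex)" if i: "i < 4" for i
      proof (cases "d i = 0")
        case False
        define M N where "M = (\<Sum>k<4. d k - 1)" and "N = (\<Sum>k<4. (d(i := n)) k - 1)"
        have "homogeneous s N (jac (F(i := p)))"
          unfolding N_def by (rule jac_homogeneous) (simp add: F p(1))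
        from homogeneous_quotient[OF jacF[folded M_def] J aP this a]
        have quot: "(M \<le> N \<and> homogeneous s (N - M) (a i)) \<or> a i = (\<lambda>v. 0)" .
        \<comment> \<open>Replacing one row of the Jacobian matrix exchanges \<open>d i - 1\<close>
          for \<open>n - 1\<close>, so a nonzero coefficient \<open>a i\<close> has degree
          \<open>n - d i\<close>, which is smaller than \<open>n\<close>.\<close>
        have "N + (d i - 1) = M + (n - 1)"
          unfolding M_def N_def using i by (auto simp: less_4_cases sum_4)
        then have "M \<le> N \<Longrightarrow> N - M = n - d i \<and> n - d i < n"
          using False \<open>n \<noteq> 0\<close> by linarith
        with quot have "a i = (\<lambda>v. 0) \<or> homogeneous s (n - d i) (avg (a i)) \<and> n - d i < n"
          using avg_homog by auto
        then have "avg (a i) \<in> ?A"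
        proof
          assume "a i = (\<lambda>v. 0)"
          then have "avg (a i) = (\<lambda>v. 0)" by (auto simp: avg_def)
          then show ?thesis using generated_algebra.const by metis
        next
          assume "homogeneous s (n - d i) (avg (a i)) \<and> n - d i < n"
          then show ?thesis using less.IH avg_inv by blast
        qed
        moreover have "F i \<in> ?A"
          by (rule generated_algebra.incl) (use i in \<open>auto simp: fs_def less_4_cases\<close>)
        ultimately show ?thesis by (simp add: generated_algebra.mult)
      qed simp
      have "p v = (\<Sum>i<4. (of_nat (d i) / of_nat n) * (avg (a i) v * F i v))" for v
      proof -
        have "of_nat n * p v = avg (\<lambda>v. of_nat n * p v) v"
          by (subst avg_id) (auto intro: arg_cong[OF p(2)])
        also have "\<dots> = (\<Sum>g\<in>W. \<Sum>i<4. of_nat (d i) * (a i (g v) * F i v)) / of_nat (card W)"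
        proof -
          have "of_nat n * p (g v) = (\<Sum>i<4. of_nat (d i) * (a i (g v) * F i v))" if "g \<in> W" for g
            unfolding rep using inv[OF _ that] by (intro sum.cong refl) simp
          then show ?thesis by (simp add: avg_def)
        qed
        also have "\<dots> = (\<Sum>i<4. of_nat (d i) * (avg (a i) v * F i v))"
          by (subst sum.swap) (simp add: avg_def sum_divide_distrib sum_distrib_left sum_distrib_right)
        finally show ?thesis
          using False by (simp add: sum_4 field_simps)
      qed
      moreover have "(\<lambda>v. (of_nat (d i) / of_nat n) * (avg (a i) v * F i v)) \<in> ?A" if "i < 4" for i
        using summand[OF that]
      proof
        assume "(\<lambda>v. avg (a i) v * F i v) \<in> ?A"
        with generated_algebra.const show ?thesis by (rule generated_algebra.mult)
      qed (simp add: generated_algebra.const)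
      then have "(\<lambda>v. \<Sum>i<4. (of_nat (d i) / of_nat n) * (avg (a i) v * F i v)) \<in> ?A"
        unfolding sum_4 by (intro generated_algebra.add) auto
      ultimately show ?thesis by simp
    qed
  qed
  have "?A \<subseteq> invariant_algebra s W"
  proof
    fix f assume "f \<in> ?A"
    then show "f \<in> invariant_algebra s W"
    proof induction
      case (incl f)
      then have "\<exists>i<4. f = F i" using fs by (metis in_set_conv_nth length_fs)
      then obtain i where "i < 4" "f = F i" by blast
      then show ?case unfolding invariant_algebra_def using FP inv by blast
    qed (auto simp: invariant_algebra_def intro: P_intros)
  qed
  moreover have "f \<in> ?A" if "f \<in> invariant_algebra s W" for f
  proof -
    have "avg h \<in> ?A" if "homogeneous_sums h" for h
      using that
    proof induction
      case (homog k h)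
      then show ?case using main[OF avg_homog] avg_inv by blast
    next
      case (add f g)
      have "avg (\<lambda>v. f v + g v) = (\<lambda>v. avg f v + avg g v)"
        by (auto simp: avg_def sum.distrib add_divide_distrib)
      then show ?case using generated_algebra.add[OF add.IH] by simp
    qed
    moreover have "homogeneous_sums f" "avg f = f"
      using that avg_id[of f] by (simp_all add: invariant_algebra_def P_homogeneous_sums)
    ultimately show ?thesis by metis
  qed
  ultimately have "?A = invariant_algebra s W" by blast
  moreover have "algebraically_independent fs"
    unfolding algebraically_independent_def
  proof (intro allI impI ballI, elim conjE)
    fix E :: "nat list set" and c x
    assume E: "finite E" "\<forall>e\<in>E. length e = length fs"
      "\<forall>v. (\<Sum>e\<in>E. c e * (\<Prod>i<length fs. (fs ! i) v ^ (e ! i))) = 0" and x: "x \<in> E"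
    have len: "length fs = 4" by (simp add: fs_def)
    have "\<exists>n. \<forall>x\<in>E. sum_list x \<le> n" using E(1) finite_nat_set_iff_bounded_le[of "sum_list ` E"] by auto
    then obtain n where n: "\<And>x. x \<in> E \<Longrightarrow> sum_list x \<le> n" by blast
    show "c x = 0"
      by (rule jacobian_criterion[OF FP J E(1) _ n _ x]) (use E in \<open>auto simp: len fs\<close>)
  qed
  moreover have "homogeneous s ([d 0, d 1, d 2, d 3] ! i) (fs ! i)" if "i < 4" for i
    using that F[of 0] F[of 1] F[of 2] F[of 3] by (auto simp: fs_def less_4_cases)
  ultimately show ?thesis
    unfolding has_degrees_def by (intro exI[of _ fs]) (simp add: length_fs)
qed

end

section \<open>Eisenstein integers and the Witting polytope\<close>

text \<open>\<open>Eis a b\<close> stands for \<open>a + b \<omega>\<close> with \<open>\<omega>\<^sup>2 = - \<omega> - 1\<close>.\<close>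

datatype eis = Eis int int

instantiation eis :: comm_ring_1
begin

definition "0 = Eis 0 0"
definition "1 = Eis 1 0"

fun plus_eis where "Eis a b + Eis c d = Eis (a + c) (b + d)"
fun minus_eis where "Eis a b - Eis c d = Eis (a - c) (b - d)"
fun uminus_eis where "- Eis a b = Eis (- a) (- b)"
fun times_eis where "Eis a b * Eis c d = Eis (a * c - b * d) (a * d + b * c - b * d)"

instance
proof
  fix a b c :: eis
  show "a * b * c = a * (b * c)" by (cases a; cases b; cases c; simp add: algebra_simps)
  show "a * b = b * a" by (cases a; cases b; simp add: algebra_simps)
  show "1 * a = a" by (cases a; simp add: one_eis_def)
  show "a + b + c = a + (b + c)" by (cases a; cases b; cases c; simp)
  show "a + b = b + a" by (cases a; cases b; simp)
  show "0 + a = a" by (cases a; simp add: zero_eis_def)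
  show "- a + a = 0" by (cases a; simp add: zero_eis_def)
  show "a - b = a + - b" by (cases a; cases b; simp)
  show "(a + b) * c = a * c + b * c" by (cases a; cases b; cases c; simp add: algebra_simps)
  show "(0::eis) \<noteq> 1" by (simp add: zero_eis_def one_eis_def)
qed

end

fun conj_eis :: "eis \<Rightarrow> eis" where "conj_eis (Eis a b) = Eis (a - b) (- b)"
text \<open>Meaningful on multiples of 3 only; \<open>exact\<close> and \<open>exact6\<close> test
  for this.\<close>

fun third :: "eis \<Rightarrow> eis" where "third (Eis a b) = Eis (a div 3) (b div 3)"

definition om :: eis where "om = Eis 0 1"
text \<open>A square root of -3, so that \<open>th\<close> times a coordinate vector has norm
  3.\<close>

definition th :: eis where "th = Eis 1 2"

text \<open>\<open>zeta = - \<omega>\<^sup>2\<close> generates the six units.\<close>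

definition zeta :: eis where "zeta = Eis 1 1"

datatype vec4 = Vec4 eis eis eis eis

fun coord4 :: "vec4 \<Rightarrow> nat \<Rightarrow> eis" where
  "coord4 (Vec4 a b c d) i = (if i = 0 then a else if i = 1 then b else if i = 2 then c else d)"
fun scale4 :: "eis \<Rightarrow> vec4 \<Rightarrow> vec4" where
  "scale4 k (Vec4 a b c d) = Vec4 (k * a) (k * b) (k * c) (k * d)"
fun add4 :: "vec4 \<Rightarrow> vec4 \<Rightarrow> vec4" where
  "add4 (Vec4 a b c d) (Vec4 a' b' c' d') = Vec4 (a + a') (b + b') (c + c') (d + d')"
text \<open>Bilinear, pairing the coefficients of a form with a vector; the hermitian product is
  \<open>dot4 x (conj4 y)\<close>.\<close>

fun dot4 :: "vec4 \<Rightarrow> vec4 \<Rightarrow> eis" where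
  "dot4 (Vec4 a b c d) (Vec4 a' b' c' d') = a * a' + b * b' + c * c' + d * d'"
fun conj4 :: "vec4 \<Rightarrow> vec4" where
  "conj4 (Vec4 a b c d) = Vec4 (conj_eis a) (conj_eis b) (conj_eis c) (conj_eis d)"

text \<open>
  For a root \<open>a\<close> with \<open>\<langle>a, a\<rangle> = 3\<close> the reflection \<open>s\<^sub>a v = v + (\<omega> - 1)/3 \<langle>v, a\<rangle> a\<close> has order 3, and
  \<open>pullback a x\<close> is the coefficient vector of the linear form \<open>x \<circ> s\<^sub>a\<close>, provided that the division
  by 3 is exact.
\<close>

definition exact :: "vec4 \<Rightarrow> vec4 \<Rightarrow> bool" where
  "exact a x \<longleftrightarrow> 3 * third ((om - 1) * dot4 x a) = (om - 1) * dot4 x a"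
definition pullback :: "vec4 \<Rightarrow> vec4 \<Rightarrow> vec4" where
  "pullback a x = add4 x (scale4 (third ((om - 1) * dot4 x a)) (conj4 a))"

text \<open>One form for each of the 40 reflecting hyperplanes. The parameters run over cube roots
  of unity only; common unit factors enter with \<open>witting\<close>.\<close>

definition lines :: "vec4 list" where
  "lines =
     [Vec4 1 0 0 0, Vec4 0 1 0 0, Vec4 0 0 1 0, Vec4 0 0 0 1] @
     concat (map (\<lambda>u. concat (map (\<lambda>v.
       [Vec4 0 1 u v, Vec4 1 0 (- u) v, Vec4 1 u 0 (- v), Vec4 1 (- u) v 0])
       [1, om, om * om])) [1, om, om * om])"

text \<open>The four coordinate lines carry the roots \<open>th e\<^sub>i\<close>; the other 36 are supported on the tetracode.\<close>

definition half_witting :: "vec4 list" where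
  "half_witting = map (scale4 th) (take 4 lines) @ drop 4 lines"
definition units :: "eis list" where
  "units = [1, om, om * om, - 1, - om, - (om * om)]"
definition witting :: "vec4 list" where
  "witting = concat (map (\<lambda>u. map (scale4 u) half_witting) units)"

text \<open>Consecutive roots are not orthogonal and all other pairs are: this is the linear diagram
  of the Shephard-Todd group G32.\<close>

definition gens :: "vec4 list" where
  "gens = [Vec4 th 0 0 0, Vec4 1 1 0 (- 1), Vec4 0 th 0 0, Vec4 0 1 1 1]"
text \<open>A base for the stabiliser chain, adapted to the diagram: as a form,
  \<open>base ! k\<close> vanishes on the roots \<open>gens ! i\<close> with \<open>i > k\<close>,
  so the generators from position \<open>i\<close> on fix the first \<open>i\<close> elements. The
  four forms are linearly independent, which makes the last stabiliser trivial.\<close>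

definition base :: "vec4 list" where
  "base = [Vec4 1 0 (- 1) 1, Vec4 om 0 (- 1) 1, Vec4 0 (- om) (- 1) (- (om * om)),
     Vec4 0 (- (om * om)) (- 1) (- (om * om))]"

text \<open>
  The evaluation by rewriting also simplifies below binders, hence the lists are traversed by
  recursive functions instead of abstractions.
\<close>

fun multiples :: "eis list \<Rightarrow> vec4 \<Rightarrow> vec4 list" where
  "multiples [] y = []"
| "multiples (u # us) y = scale4 u y # multiples us y"

text \<open>Working up to unit multiples lets closure and transitivity be evaluated on 40
  representatives instead of 240 roots. With \<open>[1]\<close> for \<open>us\<close> this is plain
  membership.\<close>

definition unit_member :: "eis list \<Rightarrow> vec4 list \<Rightarrow> vec4 \<Rightarrow> bool" where
  "unit_member us S y \<longleftrightarrow> list_ex (List.member S) (multiples us y)"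

fun pullbacks1 :: "vec4 \<Rightarrow> vec4 list \<Rightarrow> vec4 list" where
  "pullbacks1 x [] = []"
| "pullbacks1 x (a # gs) = pullback a x # pullbacks1 x gs"

fun pullbacks :: "vec4 list \<Rightarrow> vec4 list \<Rightarrow> vec4 list" where
  "pullbacks gs [] = []"
| "pullbacks gs (x # xs) = pullbacks1 x gs @ pullbacks gs xs"

fun grow :: "eis list \<Rightarrow> vec4 list \<Rightarrow> vec4 list \<Rightarrow> vec4 list" where
  "grow us [] S = S"
| "grow us (y # ys) S =
     (if unit_member us S y then grow us ys S else grow us ys (y # S))"

text \<open>Breadth-first search. New elements are put in front, so the \<open>take\<close> extracts
  exactly the next frontier. Any sufficiently large bound \<open>n\<close> will do, since nothing
  changes once the frontier is empty.\<close>

fun orbit4 :: "nat \<Rightarrow> eis list \<Rightarrow> vec4 list \<Rightarrow> vec4 list \<Rightarrow> vec4 list \<Rightarrow> vec4 list" where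
  "orbit4 0 us gs fr S = S"
| "orbit4 (Suc n) us gs fr S =
     (case grow us (pullbacks gs fr) S of S' \<Rightarrow>
       orbit4 n us gs (take (length S' - length S) S') S')"

fun all_exact :: "vec4 \<Rightarrow> vec4 list \<Rightarrow> bool" where
  "all_exact x [] = True"
| "all_exact x (a # gs) = (exact a x \<and> all_exact x gs)"

definition all_gens_exact :: "vec4 \<Rightarrow> bool" where
  "all_gens_exact x \<longleftrightarrow> all_exact x gens"

section \<open>Evaluated facts about the 240 roots\<close>

lemma exact_half_witting: "list_all all_gens_exact half_witting"
  by code_simp

lemma closed_half_witting:
  "list_all (unit_member units half_witting) (pullbacks gens half_witting)"
  by code_simp

text \<open>Transitivity up to units suffices because the unit scalars lie in the group, by
  \<open>coxeter_word\<close>.\<close>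

lemma transitive_witting:
  "list_all (unit_member units (orbit4 30 units gens [base ! 0] [base ! 0])) half_witting"
  by code_simp

definition same_product :: "vec4 \<Rightarrow> vec4 \<Rightarrow> vec4 \<Rightarrow> bool" where
  "same_product b b' y \<longleftrightarrow> dot4 y (conj4 b) = dot4 b' (conj4 b)"

text \<open>As \<open>base ! i\<close> itself lies in \<open>level i\<close>, these are the roots
  whose hermitian products with the earlier base elements agree with those of
  \<open>base ! i\<close>. They contain its orbit under the stabiliser of these elements, and
  \<open>transitive_levels\<close> gives equality.\<close>

fun level :: "nat \<Rightarrow> vec4 list" where
  "level 0 = witting"
| "level (Suc i) = filter (same_product (base ! i) (base ! Suc i)) (level i)"

lemma transitive_levels:
  "list_all (List.member (orbit4 30 [1] (drop 1 gens) [base ! 1] [base ! 1])) (level 1)"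
  "list_all (List.member (orbit4 30 [1] (drop 2 gens) [base ! 2] [base ! 2])) (level 2)"
  "list_all (List.member (orbit4 30 [1] (drop 3 gens) [base ! 3] [base ! 3])) (level 3)"
  by code_simp+

lemma length_levels:
  "length (level 0) = 240" "length (level 1) = 27" "length (level 2) = 8" "length (level 3) = 3"
  by code_simp+

definition fixed_by :: "vec4 list \<Rightarrow> vec4 \<Rightarrow> bool" where
  "fixed_by gs b \<longleftrightarrow> all_exact b gs \<and> pullbacks1 b gs = replicate (length gs) b"

lemma base_fixed:
  "fixed_by (drop 1 gens) (base ! 0)" "fixed_by (drop 2 gens) (base ! 1)"
  "fixed_by (drop 3 gens) (base ! 2)"
  by code_simp+

lemma distinct_half_witting: "distinct half_witting"
  by code_simp

fun no_unit_member :: "vec4 list \<Rightarrow> bool" where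
  "no_unit_member [] = True"
| "no_unit_member (x # xs) \<longleftrightarrow> \<not> unit_member (tl units) half_witting x \<and> no_unit_member xs"

text \<open>With the distinctness of the 40 representatives this makes all 240 unit multiples
  different without comparing them pairwise.\<close>

lemma half_witting_no_units: "no_unit_member half_witting"
  by code_simp

section \<open>Words in the generators and in products of orthogonal reflections\<close>

definition coord_forms :: "vec4 list" where
  "coord_forms = map (scale4 th) (take 4 lines)"

text \<open>Pair \<open>m\<close> is orthogonal and belongs to \<open>edges ! m\<close>. The product
  of its two reflections has eigenvalues omega, omega, 1, 1 on V, hence on the exterior square omega
  times (omega, omega^2, 1, 1, 1, 1), and the latter is the spectrum of a product of two adjacent
  simple reflections.\<close>

definition edge_roots :: "vec4 list list" where
  "edge_roots =
     [[Vec4 th 0 0 0, Vec4 0 th 0 0],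
      [Vec4 th 0 0 0, Vec4 0 0 th 0],
      [Vec4 1 0 zeta 1, Vec4 1 (om * om) 0 (- 1)],
      [Vec4 1 1 0 zeta, Vec4 1 (- 1) (om * om) 0],
      [Vec4 0 1 om 1, Vec4 1 (om * om) 0 zeta]]"

fun pullback_word :: "vec4 \<Rightarrow> vec4 list \<Rightarrow> vec4" where
  "pullback_word x [] = x"
| "pullback_word x (a # w) = pullback_word (pullback a x) w"

fun exact_word :: "vec4 \<Rightarrow> vec4 list \<Rightarrow> bool" where
  "exact_word x [] = True"
| "exact_word x (a # w) = (exact a x \<and> exact_word (pullback a x) w)"

definition same_on :: "nat \<Rightarrow> vec4 list \<Rightarrow> vec4 list \<Rightarrow> vec4 \<Rightarrow> bool" where
  "same_on k w w' x \<longleftrightarrow> exact_word x w \<and> exact_word x w' \<and>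
     pullback_word x w = scale4 (zeta ^ k) (pullback_word x w')"

text \<open>The tested forms determine a linear map. They carry the factor \<open>th\<close> because
  the plain coordinate forms have pullbacks that are not integral.\<close>

definition same_up_to :: "nat \<Rightarrow> vec4 list \<Rightarrow> vec4 list \<Rightarrow> bool" where
  "same_up_to k w w' \<longleftrightarrow> list_all (same_on k w w') coord_forms"

definition edge_word :: "nat list \<Rightarrow> vec4 list" where
  "edge_word w = concat (map ((!) edge_roots) w)"

text \<open>The product of the four generators is a Coxeter element, of order 30; its fifth power
  generates the centre, the six unit scalars.\<close>

lemma coxeter_word: "same_up_to 1 (gens @ gens @ gens @ gens @ gens) []"
  by code_simp

text \<open>These put the five edge elements into the group of the four generators, for the
  inclusion of the preimage in that group.\<close>

lemma edge_words:
  "same_up_to 0 (edge_roots ! 0) (map ((!) gens) [0,2])"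
  "same_up_to 1 (edge_roots ! 1) (map ((!) gens) [0,3,2,1,0,0,1,2,3])"
  "same_up_to 0 (edge_roots ! 2) (map ((!) gens) [0,0,1,1,0,2,2,1,0,0,3,2,1,0])"
  "same_up_to 0 (edge_roots ! 3) (map ((!) gens) [0,1,2,2,1,3,2,1,1,0,0])"
  "same_up_to 1 (edge_roots ! 4) (map ((!) gens) [0,1,0,0,2,1,0,0,1,2,3,3])"
  by code_simp+

text \<open>For the opposite inclusion: up to a unit, each generator is a product of edge elements,
  which lie in the preimage.\<close>

lemma gens_words:
  "same_up_to 1 [gens ! 0] (edge_word [4,3,0,1,2,1,2,0,4,0,1,2,2])"
  "same_up_to 5 [gens ! 1] (edge_word [1,3,0,1,2,1,2,3,0,1,4,2])"
  "same_up_to 5 [gens ! 2] (edge_word [2,1,3,0,1,2,1,2,3,0,1,4])"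
  "same_up_to 2 [gens ! 3] (edge_word [2,0,1,2,0,1,2,0,1,2,0,1])"
  by code_simp+

section \<open>Reduction of the Jacobian modulo 31\<close>

fun hom31 :: "eis \<Rightarrow> int" where "hom31 (Eis a b) = a + 5 * b"

text \<open>Has to lie off all 40 reflecting hyperplanes, and the Jacobian there has to remain
  nonzero modulo 31.\<close>

definition pt :: vec4 where "pt = Vec4 1 2 3 5"

fun power31 :: "int \<Rightarrow> nat \<Rightarrow> int" where
  "power31 x 0 = 1" | "power31 x (Suc n) = (x * power31 x n) mod 31"

fun entry31 :: "nat \<Rightarrow> nat \<Rightarrow> vec4 list \<Rightarrow> int" where
  "entry31 d k [] = 0"
| "entry31 d k (x # xs) =
     (int d * power31 (hom31 (dot4 x pt)) (d - 1) * hom31 (coord4 x k) + entry31 d k xs) mod 31"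

text \<open>
  One sixth of the Jacobian matrix of the power sums at the point \<open>pt\<close>, reduced by the ring
  homomorphism to \<open>\<int>/31\<close> that sends \<open>\<omega>\<close> to 5.
\<close>

definition jac31 :: "nat \<Rightarrow> nat \<Rightarrow> int" where
  "jac31 i k = [[11,10,10,25],[22,8,3,3],[9,14,28,13],[16,1,23,18]] ! i ! k"

lemma entry31_values:
  "entry31 12 0 half_witting = 11" "entry31 12 1 half_witting = 10" "entry31 12 2 half_witting = 10" "entry31 12 3 half_witting = 25"
  "entry31 18 0 half_witting = 22" "entry31 18 1 half_witting = 8" "entry31 18 2 half_witting = 3" "entry31 18 3 half_witting = 3"
  "entry31 24 0 half_witting = 9" "entry31 24 1 half_witting = 14" "entry31 24 2 half_witting = 28" "entry31 24 3 half_witting = 13"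
  "entry31 30 0 half_witting = 16" "entry31 30 1 half_witting = 1" "entry31 30 2 half_witting = 23" "entry31 30 3 half_witting = 18"
  by code_simp+

definition minor_pairs :: "(nat \<times> nat) list" where
  "minor_pairs = [(0,1), (0,2), (0,3), (1,2), (1,3), (2,3)]"

definition proportional :: "vec4 \<Rightarrow> vec4 \<Rightarrow> nat \<times> nat \<Rightarrow> bool" where
  "proportional x y ik \<longleftrightarrow>
     coord4 x (fst ik) * coord4 y (snd ik) = coord4 x (snd ik) * coord4 y (fst ik)"

fun not_proportional_to :: "vec4 \<Rightarrow> vec4 list \<Rightarrow> bool" where
  "not_proportional_to x [] = True"
| "not_proportional_to x (y # ys) =
     (\<not> list_all (proportional x y) minor_pairs \<and> not_proportional_to x ys)"

fun not_proportional :: "vec4 list \<Rightarrow> bool" where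
  "not_proportional [] = True"
| "not_proportional (x # xs) = (not_proportional_to x xs \<and> not_proportional xs)"

lemma lines_not_proportional: "not_proportional lines"
  by code_simp

lemma distinct_lines: "distinct lines" "length lines = 40"
  by code_simp+

section \<open>The exterior square in integral coordinates\<close>

datatype vec6 = Vec6 eis eis eis eis eis eis

fun scale6 :: "eis \<Rightarrow> vec6 \<Rightarrow> vec6" where
  "scale6 k (Vec6 a b c d e f) = Vec6 (k * a) (k * b) (k * c) (k * d) (k * e) (k * f)"
fun add6 :: "vec6 \<Rightarrow> vec6 \<Rightarrow> vec6" where
  "add6 (Vec6 a b c d e f) (Vec6 a' b' c' d' e' f') =
     Vec6 (a + a') (b + b') (c + c') (d + d') (e + e') (f + f')"
fun third6 :: "vec6 \<Rightarrow> vec6" where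
  "third6 (Vec6 a b c d e f) = Vec6 (third a) (third b) (third c) (third d) (third e) (third f)"

fun wedge6 :: "vec4 \<Rightarrow> vec4 \<Rightarrow> vec6" where
  "wedge6 (Vec4 a b c d) (Vec4 a' b' c' d') =
     Vec6 (a * b' - b * a') (a * c' - c * a') (a * d' - d * a')
       (b * c' - c * b') (b * d' - d * b') (c * d' - d * c')"
text \<open>Interior product of a bivector with a form a, where u wedge v goes to a(u) v - a(v)
  u.\<close>

fun contract6 :: "vec4 \<Rightarrow> vec6 \<Rightarrow> vec4" where
  "contract6 (Vec4 a b c d) (Vec6 y12 y13 y14 y23 y24 y34) =
     Vec4 (- b * y12 - c * y13 - d * y14) (a * y12 - c * y23 - d * y24)
       (a * y13 + b * y23 - d * y34) (a * y14 + b * y24 + c * y34)"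

text \<open>A map v + c l(v) a acts on bivectors by y + c (a wedge contraction of y with l): the
  term quadratic in c contains a wedge a. Here l is the conjugate of the root, and the division by 3
  is deferred to \<open>push6\<close>.\<close>

definition push_increment :: "vec4 \<Rightarrow> vec6 \<Rightarrow> vec6" where
  "push_increment a y = scale6 (om - 1) (wedge6 a (contract6 (conj4 a) y))"
definition exact6 :: "vec4 \<Rightarrow> vec6 \<Rightarrow> bool" where
  "exact6 a y \<longleftrightarrow> scale6 3 (third6 (push_increment a y)) = push_increment a y"
definition push6 :: "vec4 \<Rightarrow> vec6 \<Rightarrow> vec6" where
  "push6 a y = add6 y (third6 (push_increment a y))"

text \<open>
  Simple roots of type \<open>E\<^sub>6\<close> in the coordinates \<open>e\<^sub>1\<^sub>2, e\<^sub>1\<^sub>3, e\<^sub>1\<^sub>4, e\<^sub>2\<^sub>3, e\<^sub>2\<^sub>4, e\<^sub>3\<^sub>4\<close>: the planes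
  \<open>\<langle>e\<^sub>1\<^sub>2, e\<^sub>3\<^sub>4\<rangle>\<close>, \<open>\<langle>e\<^sub>1\<^sub>3, e\<^sub>2\<^sub>4\<rangle>\<close>, \<open>\<langle>e\<^sub>1\<^sub>4, e\<^sub>2\<^sub>3\<rangle>\<close> carry the three orthogonal subsystems \<open>A\<^sub>2\<close>.
\<close>

fun simple_root :: "nat \<Rightarrow> vec6" where
  "simple_root i =
     (if i = 1 then Vec6 th 0 0 0 0 (- th)
      else if i = 2 then Vec6 0 0 (th * om) (- (th * (om * om))) 0 0
      else if i = 3 then Vec6 (th * om) 0 0 0 0 (- (th * (om * om)))
      else if i = 4 then Vec6 1 1 1 1 (- 1) 1
      else if i = 5 then Vec6 0 (th * om) 0 0 (th * (om * om)) 0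
      else Vec6 0 th 0 0 th 0)"

definition reflect6 :: "nat \<Rightarrow> nat \<Rightarrow> vec6" where
  "reflect6 i l = add6 (simple_root l) (scale6 (Eis (- cartan_E6 i l) 0) (simple_root i))"

definition reflect6_twice :: "nat \<Rightarrow> nat \<Rightarrow> nat \<Rightarrow> vec6" where
  "reflect6_twice k i l =
     add6 (reflect6 k l) (scale6 (Eis (- cartan_E6 i l) 0) (reflect6 k i))"

text \<open>Oriented, in the order of \<open>edge_roots\<close>: the pair (k, i) stands for the
  product r_k r_i, and the reversed pair would stand for its inverse.\<close>

definition edges :: "(nat \<times> nat) list" where
  "edges = [(1, 3), (6, 5), (2, 4), (3, 4), (4, 5)]"

definition edge_push6 :: "vec4 list \<Rightarrow> nat \<times> nat \<Rightarrow> nat \<Rightarrow> bool" where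
  "edge_push6 h ki l \<longleftrightarrow>
     exact6 (h ! 1) (simple_root l) \<and> exact6 (h ! 0) (push6 (h ! 1) (simple_root l)) \<and>
     push6 (h ! 0) (push6 (h ! 1) (simple_root l)) = scale6 om (reflect6_twice (fst ki) (snd ki) l)"

lemma edges_push6:
  "list_all (edge_push6 (edge_roots ! 0) (edges ! 0)) [1,2,3,4,5,6]"
  "list_all (edge_push6 (edge_roots ! 1) (edges ! 1)) [1,2,3,4,5,6]"
  "list_all (edge_push6 (edge_roots ! 2) (edges ! 2)) [1,2,3,4,5,6]"
  "list_all (edge_push6 (edge_roots ! 3) (edges ! 3)) [1,2,3,4,5,6]"
  "list_all (edge_push6 (edge_roots ! 4) (edges ! 4)) [1,2,3,4,5,6]"
  by code_simp+

subsection \<open>Groups of linear maps\<close>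

lemma (in complex_space) group_GL: "group (GL s)"
proof (rule groupI)
  show "\<one>\<^bsub>GL s\<^esub> \<in> carrier (GL s)"
    by (simp add: GL_def Vector_Spaces.linear_iff vector_space_axioms)
next
  fix g h assume "g \<in> carrier (GL s)" "h \<in> carrier (GL s)"
  then show "g \<otimes>\<^bsub>GL s\<^esub> h \<in> carrier (GL s)"
    using Vector_Spaces.linear_compose by (auto simp: GL_def bij_comp)
next
  fix g assume g: "g \<in> carrier (GL s)"
  then have b: "bij g" and l: "Vector_Spaces.linear s s g" by (auto simp: GL_def)
  have gi: "g (inv_into UNIV g y) = y" for y using b by (simp add: bij_is_surj surj_f_inv_f)
  have "Vector_Spaces.linear s s (inv_into UNIV g)"
    unfolding Vector_Spaces.linear_iff
  proof (intro conjI allI)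
    show "inv_into UNIV g (x + y) = inv_into UNIV g x + inv_into UNIV g y" for x y
      by (rule injD[OF bij_is_inj[OF b]]) (use l in \<open>simp add: gi Vector_Spaces.linear_iff\<close>)
    show "inv_into UNIV g (s c x) = s c (inv_into UNIV g x)" for c x
      by (rule injD[OF bij_is_inj[OF b]]) (use l in \<open>simp add: gi Vector_Spaces.linear_iff\<close>)
  qed (rule vector_space_axioms)+
  then show "\<exists>h\<in>carrier (GL s). h \<otimes>\<^bsub>GL s\<^esub> g = \<one>\<^bsub>GL s\<^esub>"
    using b by (intro bexI[of _ "inv_into UNIV g"])
      (auto simp: GL_def bij_imp_bij_inv inv_o_cancel bij_is_inj)
qed (auto simp: GL_def comp_assoc)

lemma GL_simps: "g \<otimes>\<^bsub>GL s\<^esub> h = g \<circ> h" "\<one>\<^bsub>GL s\<^esub> = id"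
  "g \<in> carrier (GL s) \<longleftrightarrow> Vector_Spaces.linear s s g \<and> bij g"
  by (auto simp: GL_def)

text \<open>Both sides may be infinite, with the junk value 0; finiteness of \<open>H\<close> is then a consequence.\<close>

lemma card_orbit_stabiliser:
  assumes H: "\<And>g h. g \<in> H \<Longrightarrow> h \<in> H \<Longrightarrow> g \<circ> h \<in> H" "\<And>g. g \<in> H \<Longrightarrow> \<exists>h\<in>H. g \<circ> h = id \<and> h \<circ> g = id"
  shows "card H = card ((\<lambda>g. \<phi> \<circ> g) ` H) * card {g \<in> H. \<phi> \<circ> g = \<phi>}"
proof -
  let ?K = "{g \<in> H. \<phi> \<circ> g = \<phi>}" and ?O = "(\<lambda>g. \<phi> \<circ> g) ` H"
  define t where "t f = (SOME g. g \<in> H \<and> \<phi> \<circ> g = f)" for f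
  have t: "t f \<in> H \<and> \<phi> \<circ> t f = f" if "f \<in> ?O" for f
  proof -
    from that obtain g where "g \<in> H \<and> \<phi> \<circ> g = f" by blast
    then show ?thesis unfolding t_def by (rule someI[where P = "\<lambda>g. g \<in> H \<and> \<phi> \<circ> g = f"])
  qed
  \<comment> \<open>Each element is uniquely \<open>k \<circ> t f\<close>, with \<open>k\<close> in
    the stabiliser and \<open>t f\<close> the chosen element that carries \<open>\<phi>\<close> to
    \<open>f\<close>.\<close>
  have "bij_betw (\<lambda>(f, k). k \<circ> t f) (?O \<times> ?K) H"
    unfolding bij_betw_def
  proof
    have orb: "\<phi> \<circ> (k \<circ> t f) = f" if "f \<in> ?O" "k \<in> ?K" for f k
      using t[OF that(1)] that(2) by (simp add: comp_assoc[symmetric])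
    show "inj_on (\<lambda>(f, k). k \<circ> t f) (?O \<times> ?K)"
    proof (rule inj_onI, clarsimp)
      fix g k h l
      assume A: "g \<in> H" "k \<in> H" "\<phi> \<circ> k = \<phi>" "h \<in> H" "l \<in> H" "\<phi> \<circ> l = \<phi>"
        and eq: "k \<circ> t (\<phi> \<circ> g) = l \<circ> t (\<phi> \<circ> h)"
      have f: "\<phi> \<circ> g = \<phi> \<circ> h"
        using orb[of "\<phi> \<circ> g" k] orb[of "\<phi> \<circ> h" l] A eq by (metis (mono_tags) imageI mem_Collect_eq)
      obtain r where "t (\<phi> \<circ> g) \<circ> r = id" using H(2) t A(1) by blast
      then show "\<phi> \<circ> g = \<phi> \<circ> h \<and> k = l" using eq f by (metis comp_assoc comp_id)
    qed
    show "(\<lambda>(f, k). k \<circ> t f) ` (?O \<times> ?K) = H"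
    proof
      show "(\<lambda>(f, k). k \<circ> t f) ` (?O \<times> ?K) \<subseteq> H" using t H(1) by auto
      show "H \<subseteq> (\<lambda>(f, k). k \<circ> t f) ` (?O \<times> ?K)"
      proof
        fix g assume g: "g \<in> H"
        then have f: "\<phi> \<circ> g \<in> ?O" by blast
        obtain r where r: "r \<in> H" "t (\<phi> \<circ> g) \<circ> r = id" "r \<circ> t (\<phi> \<circ> g) = id" using H(2) t[OF f] by blast
        have "\<phi> \<circ> (g \<circ> r) = (\<phi> \<circ> t (\<phi> \<circ> g)) \<circ> r" using t[OF f] by (simp add: comp_assoc)
        also have "\<dots> = \<phi>" using r(2) by (simp add: comp_assoc)
        finally have "g \<circ> r \<in> ?K" using H(1) g r(1) by simp
        moreover have "g = (g \<circ> r) \<circ> t (\<phi> \<circ> g)" using r(3) by (simp add: comp_assoc)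
        ultimately show "g \<in> (\<lambda>(f, k). k \<circ> t f) ` (?O \<times> ?K)"
          using f by (intro image_eqI[of _ _ "(\<phi> \<circ> g, g \<circ> r)"]) auto
      qed
    qed
  qed
  then have "card (?O \<times> ?K) = card H" by (rule bij_betw_same_card)
  then show ?thesis by (simp add: card_cartesian_product)
qed

subsection \<open>Arithmetic of Eisenstein vectors\<close>

lemma three_eis: "(3::eis) = Eis 3 0"
  using of_nat_numeral[of "num.Bit1 num.One", where 'a = eis]
  by (simp add: eval_nat_numeral one_eis_def zero_eis_def)

lemma eis_triple_eq_0: "(3::eis) * x = 0 \<Longrightarrow> x = 0"
  by (cases x) (simp add: three_eis zero_eis_def)

lemma conj_eis_hom:
  "conj_eis (x + y) = conj_eis x + conj_eis y" "conj_eis (x * y) = conj_eis x * conj_eis y"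
  "conj_eis (x - y) = conj_eis x - conj_eis y" "conj_eis 1 = 1" "conj_eis 3 = 3"
  "conj_eis (conj_eis x) = x"
  by (cases x; cases y; simp add: algebra_simps one_eis_def three_eis)+

lemma dot4_algebra:
  "dot4 (add4 x y) z = dot4 x z + dot4 y z" "dot4 (scale4 c x) z = c * dot4 x z"
  "dot4 z (add4 x y) = dot4 z x + dot4 z y" "dot4 z (scale4 c x) = c * dot4 z x"
  "dot4 (conj4 x) (conj4 y) = conj_eis (dot4 x y)"
  "conj4 (add4 x y) = add4 (conj4 x) (conj4 y)" "conj4 (scale4 c x) = scale4 (conj_eis c) (conj4 x)"
  "conj4 (conj4 x) = x" "dot4 x y = dot4 y x"
  by (cases x; cases y; cases z; simp add: algebra_simps conj_eis_hom)+

text \<open>Since \<open>eis\<close> has no division, the error term is multiplied by 3. It then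
  becomes a multiple of \<open>conj_eis om - 1 + (om - 1) + (om - 1) * (conj_eis om - 1)\<close>,
  which is zero because \<open>om\<close> has norm 1.\<close>

lemma pullback_isometry:
  assumes a: "dot4 a (conj4 a) = 3" and x: "exact a x" and y: "exact a y"
  shows "dot4 (pullback a x) (conj4 (pullback a y)) = dot4 x (conj4 y)"
proof -
  define D D' t t' where "D = dot4 x a" "D' = conj_eis (dot4 y a)" "t = third ((om - 1) * dot4 x a)"
    "t' = conj_eis (third ((om - 1) * dot4 y a))"
  note defs = this
  have t: "3 * t = (om - 1) * D" using x by (simp add: exact_def defs)
  have "conj_eis (3 * third ((om - 1) * dot4 y a)) = conj_eis ((om - 1) * dot4 y a)"
    using y by (simp add: exact_def)
  then have t': "3 * t' = (conj_eis om - 1) * D'" by (simp add: conj_eis_hom defs)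
  have "dot4 (pullback a x) (conj4 (pullback a y)) - dot4 x (conj4 y) = t' * D + t * D' + 3 * (t * t')"
    unfolding pullback_def
    by (simp add: dot4_algebra(1-8) defs[symmetric] algebra_simps)
      (simp add: defs dot4_algebra(5)[symmetric] dot4_algebra(8) dot4_algebra(9)[of _ a] a
        dot4_algebra(9)[of "conj4 a" a] dot4_algebra(9)[of "conj4 a" "conj4 y"] algebra_simps)
  also have "\<dots> = 0"
  proof (rule eis_triple_eq_0)
    have 1: "conj_eis om - 1 + (om - 1) + (om - 1) * (conj_eis om - 1) = 0"
      by (simp add: om_def one_eis_def zero_eis_def)
    have "3 * (t' * D + t * D' + 3 * (t * t')) = (3 * t') * D + (3 * t) * D' + (3 * t) * (3 * t')"
      by (simp add: algebra_simps)
    also have "\<dots> = D * D' * (conj_eis om - 1 + (om - 1) + (om - 1) * (conj_eis om - 1))"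
      unfolding t t' by (simp add: algebra_simps)
    finally show "3 * (t' * D + t * D' + 3 * (t * t')) = 0" unfolding 1 by simp
  qed
  finally show ?thesis by simp
qed

lemma scale4_algebra: "scale4 c (scale4 d x) = scale4 (c * d) x" "scale4 1 x = x"
  "scale4 c (add4 x y) = add4 (scale4 c x) (scale4 c y)"
  by (cases x; cases y; simp add: algebra_simps)+

lemma third_triple: "third (3 * x) = x"
  by (cases x) (simp add: three_eis)

lemma exact_scale:
  assumes "exact a x" shows "exact a (scale4 u x)" "pullback a (scale4 u x) = scale4 u (pullback a x)"
proof -
  have eq: "(om - 1) * dot4 (scale4 u x) a = 3 * (u * third ((om - 1) * dot4 x a))"
    using assms by (simp add: exact_def dot4_algebra(2) mult.left_commute)
  show "exact a (scale4 u x)" unfolding exact_def eq third_triple ..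
  show "pullback a (scale4 u x) = scale4 u (pullback a x)"
    unfolding pullback_def eq third_triple by (simp add: scale4_algebra)
qed

lemma units_zeta: "u \<in> set units \<Longrightarrow> \<exists>k. u = zeta ^ k"
proof -
  have "units = map ((^) zeta) [0, 2, 4, 3, 5, 1]" by code_simp
  then have "set units = (^) zeta ` set [0, 2, 4, 3, 5, 1]" by (metis set_map)
  then show "u \<in> set units \<Longrightarrow> \<exists>k. u = zeta ^ k" by blast
qed

lemma zeta_power_unit: "zeta ^ k \<in> set units"
proof (induction k)
  case (Suc k)
  have "list_all (\<lambda>u. List.member units (zeta * u)) units" by code_simp
  with Suc show ?case by (simp add: list_all_iff)
qed (simp add: units_def)

lemma units_inverse: "u \<in> set units \<Longrightarrow> \<exists>u'\<in>set units. u' * u = 1"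
proof -
  have "list_all (\<lambda>u. list_ex (\<lambda>u'. u' * u = 1) units) units" by code_simp
  then show "u \<in> set units \<Longrightarrow> \<exists>u'\<in>set units. u' * u = 1" by (auto simp: list_all_iff list_ex_iff)
qed

lemma units_mult: "u \<in> set units \<Longrightarrow> u' \<in> set units \<Longrightarrow> u * u' \<in> set units"
  using units_zeta zeta_power_unit by (metis power_add)

lemma set_witting: "set witting = {scale4 u x | u x. u \<in> set units \<and> x \<in> set half_witting}"
  by (auto simp: witting_def)

lemma set_multiples: "set (multiples us y) = {scale4 u y | u. u \<in> set us}"
  by (induction us) auto

lemma unit_member_witting:
  assumes "unit_member units S y" shows "\<exists>u\<in>set units. \<exists>z\<in>set S. y = scale4 u z"
proof -
  obtain u where u: "u \<in> set units" "scale4 u y \<in> set S"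
    using assms by (auto simp: unit_member_def list_ex_iff set_multiples)
  obtain u' where "u' \<in> set units" "u' * u = 1" using units_inverse[OF u(1)] by blast
  then have "y = scale4 u' (scale4 u y)" by (simp add: scale4_algebra)
  then show ?thesis using \<open>u' \<in> set units\<close> u(2) by blast
qed

lemma set_pullbacks: "set (pullbacks gs xs) = {pullback a x | a x. a \<in> set gs \<and> x \<in> set xs}"
proof -
  have 1: "set (pullbacks1 x gs) = {pullback a x | a. a \<in> set gs}" for x by (induction gs) auto
  show ?thesis by (induction xs) (auto simp: 1)
qed

lemma all_exact_iff: "all_exact x gs \<longleftrightarrow> (\<forall>a\<in>set gs. exact a x)"
  by (induction gs) auto

lemma witting_closed:
  assumes "x \<in> set witting" "a \<in> set gens"
  shows "exact a x" "pullback a x \<in> set witting"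
proof -
  obtain u y where x: "x = scale4 u y" "u \<in> set units" "y \<in> set half_witting"
    using assms(1) by (auto simp: set_witting)
  have e: "exact a y"
    using exact_half_witting x(3) assms(2) by (auto simp: list_all_iff all_gens_exact_def all_exact_iff)
  then show "exact a x" unfolding x(1) by (rule exact_scale)
  have "pullback a y \<in> set (pullbacks gens half_witting)" using x(3) assms(2) by (auto simp: set_pullbacks)
  then have "unit_member units half_witting (pullback a y)"
    using closed_half_witting by (auto simp: list_all_iff)
  then obtain u' z where "u' \<in> set units" "z \<in> set half_witting" "pullback a y = scale4 u' z"
    using unit_member_witting by blast
  then show "pullback a x \<in> set witting"
    unfolding x(1) exact_scale(2)[OF e] using units_mult[OF x(2)]
    by (auto simp: scale4_algebra set_witting)
qed

text \<open>Soundness of the search, used with \<open>Q\<close> saying that a root is reached from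
  \<open>base ! i\<close> by the stabiliser.\<close>

lemma orbit4_invariant:
  assumes "\<And>x a. Q x \<Longrightarrow> a \<in> set gs \<Longrightarrow> Q (pullback a x)"
    and "\<forall>x\<in>set fr. Q x" "\<forall>x\<in>set S. Q x" "y \<in> set (orbit4 n us gs fr S)"
  shows "Q y"
  using assms(2-4)
proof (induction n arbitrary: fr S)
  case (Suc n)
  have grow: "set (grow us ys S) \<subseteq> set ys \<union> set S" for ys
    by (induction us ys S rule: grow.induct) auto
  define S' where "S' = grow us (pullbacks gs fr) S"
  have "\<forall>x\<in>set S'. Q x"
    using grow[of "pullbacks gs fr"] Suc.prems(1,2) assms(1) unfolding S'_def set_pullbacks by blast
  moreover have "\<forall>x\<in>set (take (length S' - length S) S'). Q x"
    using calculation set_take_subset by fast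
  ultimately show ?case using Suc.IH Suc.prems(3) by (simp add: S'_def)
qed simp

lemma inj_on_unit_multiples:
  "inj_on (\<lambda>(u, x). scale4 u x) (set units \<times> set half_witting)"
proof (rule inj_onI, clarify)
  fix u x u' x'
  assume A: "u \<in> set units" "x \<in> set half_witting" "u' \<in> set units" "x' \<in> set half_witting"
    and eq: "scale4 u x = scale4 u' x'"
  obtain r where r: "r \<in> set units" "r * u = 1" using units_inverse[OF A(1)] by blast
  have x: "x = scale4 (r * u') x'"
    using arg_cong[OF eq, of "scale4 r"] r(2) by (simp add: scale4_algebra)
  have no: "\<not> unit_member (tl units) half_witting z" if "z \<in> set half_witting" for z
  proof -
    have "\<not> unit_member (tl units) half_witting z" if "no_unit_member zs" "z \<in> set zs" for zs
      using that by (induction zs) auto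
    then show ?thesis using half_witting_no_units that by blast
  qed
  have "r * u' = 1"
  proof (rule ccontr)
    assume "r * u' \<noteq> 1"
    then have "r * u' \<in> set (tl units)" using units_mult[OF r(1) A(3)] by (auto simp: units_def)
    then have "unit_member (tl units) half_witting x'"
      using A(2) x by (auto simp: unit_member_def list_ex_iff set_multiples)
    then show False using no A(4) by blast
  qed
  then have "u' = u" using r(2) by (metis mult.assoc mult.commute mult.right_neutral)
  with x \<open>r * u' = 1\<close> show "u = u' \<and> x = x'" by (simp add: scale4_algebra)
qed

lemma card_witting: "card (set witting) = 240"
proof -
  have "set witting = (\<lambda>(u, x). scale4 u x) ` (set units \<times> set half_witting)"
    by (auto simp: set_witting)
  then have "card (set witting) = card (set units) * card (set half_witting)"
    by (simp add: card_image[OF inj_on_unit_multiples] card_cartesian_product)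
  also have "card (set units) = 6" by (subst distinct_card) (code_simp, simp add: units_def)
  also have "card (set half_witting) = 40"
    by (subst distinct_card[OF distinct_half_witting]) (simp add: half_witting_def distinct_lines)
  finally show ?thesis by simp
qed

text \<open>The list \<open>witting\<close> has no repetitions because its length equals the
  cardinality of its set, and filtering preserves this.\<close>

lemma card_levels: "card (set (level 0)) = 240" "card (set (level 1)) = 27"
  "card (set (level 2)) = 8" "card (set (level 3)) = 3"
proof -
  have "distinct witting"
    by (rule card_distinct) (use card_witting length_levels(1) in simp)
  then have "distinct (level i)" for i by (induction i) auto
  then show "card (set (level 0)) = 240" "card (set (level 1)) = 27"
    "card (set (level 2)) = 8" "card (set (level 3)) = 3"
    using distinct_card length_levels by metis+
qed

section \<open>The reflection group of the Witting polytope\<close>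

locale witting_frame = frame4 s e X for s :: "complex \<Rightarrow> 'v::ab_group_add \<Rightarrow> 'v" and e X +
  fixes w :: complex
  assumes w: "w * w = - w - 1"
begin

subsection \<open>Evaluation of Eisenstein integers\<close>

lemma w_facts: "w ^ 3 = 1" "w \<noteq> 1" "w \<noteq> 0" "cnj w = - w - 1" "Im w \<noteq> 0" "w * w \<noteq> 1" "w * w \<noteq> w"
proof -
  have "w ^ 3 = w * (w * w)" by (simp add: power3_eq_cube)
  also have "\<dots> = w * (- w - 1)" by (simp only: w)
  also have "\<dots> = - (w * w) - w" by (simp add: algebra_simps)
  also have "\<dots> = 1" by (simp add: w)
  finally show "w ^ 3 = 1" .
  show w1: "w \<noteq> 1" using w by auto
  show "w \<noteq> 0" using w by auto
  have re: "Re w * Re w - Im w * Im w = - Re w - 1" and im: "Re w * Im w + Im w * Re w = - Im w"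
    using arg_cong[OF w, of Re] arg_cong[OF w, of Im] by simp_all
  show i: "Im w \<noteq> 0"
  proof
    assume "Im w = 0"
    then have "(Re w + 1 / 2)\<^sup>2 + 3 / 4 = 0" using re by (simp add: power2_eq_square algebra_simps)
    moreover have "(Re w + 1 / 2)\<^sup>2 + 3 / 4 > 0" by (rule add_nonneg_pos) auto
    ultimately show False by linarith
  qed
  have "(2 * Re w + 1) * Im w = 0" using im by (simp add: algebra_simps)
  then have "2 * Re w = - 1" using i by simp
  then show "cnj w = - w - 1" by (simp add: complex_eq_iff)
  show "w * w \<noteq> 1" unfolding w
  proof
    assume "- w - 1 = 1"
    then have "w = - 2" by (simp add: algebra_simps) (metis add.inverse_inverse add_uminus_conv_diff diff_eq_eq one_add_one minus_diff_eq)
    with i show False by simp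
  qed
  show "w * w \<noteq> w" using w1 \<open>w \<noteq> 0\<close> by simp
qed

fun ev :: "eis \<Rightarrow> complex" where "ev (Eis a b) = of_int a + of_int b * w"

lemma ev_hom [simp]:
  "ev (x + y) = ev x + ev y" "ev (x - y) = ev x - ev y" "ev (- x) = - ev x" "ev 0 = 0" "ev 1 = 1"
  "ev (x * y) = ev x * ev y" "ev om = w" "ev 3 = 3" "ev (conj_eis x) = cnj (ev x)"
proof -
  show "ev (x * y) = ev x * ev y"
  proof (cases x; cases y)
    fix a b c d assume "x = Eis a b" "y = Eis c d"
    moreover have "(of_int a + of_int b * w) * (of_int c + of_int d * w) =
        of_int a * of_int c + (of_int a * of_int d + of_int b * of_int c) * w + of_int b * of_int d * (w * w)"
      by (simp add: algebra_simps)
    ultimately show ?thesis unfolding w by (simp add: algebra_simps)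
  qed
  show "ev (conj_eis x) = cnj (ev x)"
    by (cases x) (simp add: w_facts(4) algebra_simps)
qed (cases x; cases y; simp add: algebra_simps zero_eis_def one_eis_def om_def three_eis)+

lemma ev_power [simp]: "ev (x ^ n) = ev x ^ n"
  by (induction n) simp_all

lemma ev_sum_list: "ev (sum_list xs) = (\<Sum>x\<leftarrow>xs. ev x)"
  by (induction xs) simp_all

lemma ev_of_nat [simp]: "ev (of_nat n) = of_nat n"
  by (induction n) simp_all

lemma ev_eq_0: "ev x = 0 \<longleftrightarrow> x = 0"
proof (cases x)
  case (Eis a b)
  have "Im (ev x) = of_int b * Im w" "Re (ev x) = of_int a + of_int b * Re w" using Eis by simp_all
  then show ?thesis using w_facts(5) Eis by (auto simp: complex_eq_iff zero_eis_def)
qed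

lemma ev_inject: "ev x = ev y \<longleftrightarrow> x = y"
  using ev_eq_0[of "x - y"] by simp

lemma ev_zeta: "ev zeta = - (w * w)"
  by (simp add: zeta_def w)

subsection \<open>Forms, vectors and reflections\<close>

fun form :: "vec4 \<Rightarrow> 'v \<Rightarrow> complex" where
  "form (Vec4 a b c d) v = ev a * X 0 v + ev b * X 1 v + ev c * X 2 v + ev d * X 3 v"

fun vec :: "vec4 \<Rightarrow> 'v" where
  "vec (Vec4 a b c d) = s (ev a) (e 0) + s (ev b) (e 1) + s (ev c) (e 2) + s (ev d) (e 3)"

definition refl :: "vec4 \<Rightarrow> 'v \<Rightarrow> 'v" where
  "refl a v = v + s ((w - 1) / 3 * form (conj4 a) v) (vec a)"

lemma X_simps [simp]:
  "X 0 (e 0) = 1" "X 0 (e (Suc 0)) = 0" "X 0 (e 2) = 0" "X 0 (e 3) = 0"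
  "X (Suc 0) (e 0) = 0" "X (Suc 0) (e (Suc 0)) = 1" "X (Suc 0) (e 2) = 0" "X (Suc 0) (e 3) = 0"
  "X 2 (e 0) = 0" "X 2 (e (Suc 0)) = 0" "X 2 (e 2) = 1" "X 2 (e 3) = 0"
  "X 3 (e 0) = 0" "X 3 (e (Suc 0)) = 0" "X 3 (e 2) = 0" "X 3 (e 3) = 1"
  by (subst X_e; simp)+

lemma X_add: "i < 4 \<Longrightarrow> X i (u + v) = X i u + X i v"
  and X_scale: "i < 4 \<Longrightarrow> X i (s c v) = c * X i v"
  using functional_simps[OF X_functional] by auto

lemma functional_form: "functional (form x)"
  by (cases x) (simp add: Vector_Spaces.linear_iff vector_space_axioms vector_space_scalars
      X_add X_scale algebra_simps)

lemma form_add4: "form (add4 x y) v = form x v + form y v"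
  by (cases x; cases y) (simp add: algebra_simps)

lemma form_scale4: "form (scale4 c x) v = ev c * form x v"
  by (cases x) (simp add: algebra_simps)

lemma form_vec: "form x (vec a) = ev (dot4 x a)"
  by (cases x; cases a) (simp add: X_add X_scale)

lemma form_inject:
  assumes "\<And>v. form x v = form y v" shows "x = y"
  using assms[of "e 0"] assms[of "e 1"] assms[of "e 2"] assms[of "e 3"]
  by (cases x; cases y) (simp add: ev_inject)

lemma form_pullback: "exact a x \<Longrightarrow> form (pullback a x) v = form x (refl a v)"
proof -
  assume "exact a x"
  then have "ev (3 * third ((om - 1) * dot4 x a)) = ev ((om - 1) * dot4 x a)" by (simp add: exact_def)
  then have "ev (third ((om - 1) * dot4 x a)) = (w - 1) / 3 * ev (dot4 x a)" by (simp add: mult.commute)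
  then show ?thesis
    by (simp add: pullback_def refl_def form_add4 form_scale4 form_vec functional_simps[OF functional_form])
qed

lemma linear_refl: "Vector_Spaces.linear s s (refl a)"
  by (simp add: Vector_Spaces.linear_iff vector_space_axioms refl_def
      functional_simps[OF functional_form] algebra_simps)

lemma refl_vec: "dot4 a (conj4 a) = 3 \<Longrightarrow> refl a (vec a) = s w (vec a)"
  by (simp add: refl_def form_vec dot4_algebra(9)[of "conj4 a"])
    (simp add: diff_divide_distrib scale_left_diff_distrib)

lemma refl_cube: "dot4 a (conj4 a) = 3 \<Longrightarrow> refl a (refl a (refl a v)) = v"
proof -
  assume a: "dot4 a (conj4 a) = 3"
  let ?c = "(w - 1) / 3 * form (conj4 a) v"
  have step: "refl a (v + s k (vec a)) = v + s (?c + k * w) (vec a)" for k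
  proof -
    have "refl a (v + s k (vec a)) = refl a v + s k (refl a (vec a))"
      using linear_refl[of a] by (simp add: Vector_Spaces.linear_iff)
    then show ?thesis
      by (simp add: refl_vec[OF a]) (simp add: refl_def scale_left_distrib add.assoc)
  qed
  have gen: "c + (c + c * w) * w = c * (1 + w + w * w)" for c by (simp add: algebra_simps)
  have "refl a (refl a (refl a v)) = v + s (?c + (?c + ?c * w) * w) (vec a)"
    using step[of ?c] step[of "?c + ?c * w"] by (simp add: refl_def[of a v])
  also have "?c + (?c + ?c * w) * w = ?c * (1 + w + w * w)" by (rule gen)
  also have "\<dots> = 0" by (simp add: w)
  finally show ?thesis by simp
qed

lemma gens_norm: "a \<in> set gens \<Longrightarrow> dot4 a (conj4 a) = 3"
proof -
  have "list_all (\<lambda>a. dot4 a (conj4 a) = Eis 3 0) gens" by code_simp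
  then show "a \<in> set gens \<Longrightarrow> dot4 a (conj4 a) = 3" by (simp add: list_all_iff three_eis)
qed

lemma refl_GL:
  assumes "dot4 a (conj4 a) = 3"
  shows "refl a \<in> carrier (GL s)" "inv\<^bsub>GL s\<^esub> (refl a) = refl a \<circ> refl a"
proof -
  interpret G: group "GL s" by (rule group_GL)
  have 3: "refl a \<circ> (refl a \<circ> refl a) = id" using refl_cube[OF assms] by auto
  have b: "bij (refl a)" by (rule o_bij[OF _ 3]) (use 3 in \<open>simp add: comp_assoc\<close>)
  then show c: "refl a \<in> carrier (GL s)" using linear_refl by (simp add: GL_simps)
  have "refl a \<circ> refl a \<in> carrier (GL s)" using G.m_closed[OF c c] by (simp add: GL_simps(1))
  then show "inv\<^bsub>GL s\<^esub> (refl a) = refl a \<circ> refl a"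
    by (intro G.inv_equality) (use 3 c in \<open>simp_all add: GL_simps(1,2) comp_assoc\<close>)
qed

fun word :: "vec4 list \<Rightarrow> 'v \<Rightarrow> 'v" where
  "word [] = id"
| "word (a # as) = refl a \<circ> word as"

lemma word_append: "word (as @ bs) = word as \<circ> word bs"
  by (induction as) (auto simp: comp_assoc)

definition G :: "('v \<Rightarrow> 'v) set" where "G = generate (GL s) (refl ` set gens)"

lemma refl_in_G: "a \<in> set gens \<Longrightarrow> refl a \<in> G"
  unfolding G_def by (intro generate.incl imageI)

lemma G_subgroup: "subgroup G (GL s)"
proof -
  interpret G: group "GL s" by (rule group_GL)
  show ?thesis unfolding G_def by (rule G.generate_is_subgroup) (auto simp: refl_GL gens_norm)
qed

lemma G_facts:
  shows "id \<in> G" "g \<in> G \<Longrightarrow> h \<in> G \<Longrightarrow> g \<circ> h \<in> G" "g \<in> G \<Longrightarrow> Vector_Spaces.linear s s g"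
    "g \<in> G \<Longrightarrow> bij g" "g \<in> G \<Longrightarrow> \<exists>h\<in>G. g \<circ> h = id \<and> h \<circ> g = id"
proof -
  interpret G: group "GL s" by (rule group_GL)
  interpret S: subgroup G "GL s" by (rule G_subgroup)
  show "id \<in> G" using S.one_closed by (simp add: GL_simps)
  show "g \<in> G \<Longrightarrow> h \<in> G \<Longrightarrow> g \<circ> h \<in> G" using S.m_closed[of g h] by (simp add: GL_simps)
  show "g \<in> G \<Longrightarrow> Vector_Spaces.linear s s g" "g \<in> G \<Longrightarrow> bij g"
    using S.mem_carrier[of g] by (simp_all add: GL_simps)
  assume g: "g \<in> G"
  show "\<exists>h\<in>G. g \<circ> h = id \<and> h \<circ> g = id"
    by (rule bexI[of _ "inv\<^bsub>GL s\<^esub> g"])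
      (use G.r_inv[OF S.mem_carrier[OF g]] G.l_inv[OF S.mem_carrier[OF g]] S.m_inv_closed[OF g] in
        \<open>simp_all add: GL_simps(1,2)\<close>)
qed

lemma word_in_G: "set as \<subseteq> set gens \<Longrightarrow> word as \<in> G"
  by (induction as) (auto intro: G_facts refl_in_G)

lemma G_word: "g \<in> G \<Longrightarrow> \<exists>as. set as \<subseteq> set gens \<and> g = word as"
  unfolding G_def
proof (induction rule: generate.induct)
  case one
  show ?case by (intro exI[of _ "[]"]) (simp add: GL_simps)
next
  case (incl h)
  then obtain a where "a \<in> set gens" "h = refl a" by blast
  then show ?case by (intro exI[of _ "[a]"]) simp
next
  case (inv h)
  then obtain a where a: "a \<in> set gens" "h = refl a" by blast
  show ?case unfolding a(2) refl_GL(2)[OF gens_norm[OF a(1)]]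
    by (intro exI[of _ "[a, a]"]) (use a(1) in simp)
next
  case (eng g h)
  then obtain as bs where "set as \<subseteq> set gens" "g = word as" "set bs \<subseteq> set gens" "h = word bs" by blast
  then show ?case by (intro exI[of _ "as @ bs"]) (simp add: GL_simps word_append)
qed

lemma form_pullback_word: "exact_word x as \<Longrightarrow> form (pullback_word x as) v = form x (word as v)"
  by (induction as arbitrary: x) (auto simp: form_pullback)

lemma same_up_to_word:
  assumes "same_up_to k as bs" shows "word as v = s (ev zeta ^ k) (word bs v)"
proof (rule vector_eqI)
  fix i :: nat assume i: "i < 4"
  have th: "ev th \<noteq> 0" by (subst ev_eq_0) (simp add: th_def zero_eis_def)
  have coord: "coord_forms = [Vec4 th 0 0 0, Vec4 0 th 0 0, Vec4 0 0 th 0, Vec4 0 0 0 th]"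
    unfolding coord_forms_def by code_simp
  have f: "form (coord_forms ! i) v = ev th * X i v" for v
    using i unfolding less_4_cases by (auto simp: coord)
  have "coord_forms ! i \<in> set coord_forms" using i by (intro nth_mem) (simp add: coord)
  then have "same_on k as bs (coord_forms ! i)" using assms by (simp add: same_up_to_def list_all_iff)
  then have ex: "exact_word (coord_forms ! i) as" "exact_word (coord_forms ! i) bs"
    and eq: "pullback_word (coord_forms ! i) as = scale4 (zeta ^ k) (pullback_word (coord_forms ! i) bs)"
    by (simp_all add: same_on_def)
  have "form (coord_forms ! i) (word as v) = ev zeta ^ k * form (coord_forms ! i) (word bs v)"
    using form_pullback_word[OF ex(1), of v] form_pullback_word[OF ex(2), of v] eq
    by (simp add: form_scale4)
  then show "X i (word as v) = X i (s (ev zeta ^ k) (word bs v))"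
    using th by (simp add: f X_scale[OF i])
qed

lemma scalar_in_G: "s (ev zeta ^ k) \<in> G"
proof (induction k)
  case 0
  have "s (ev zeta ^ 0) = id" by (auto simp: fun_eq_iff)
  then show ?case using G_facts(1) by (simp only:)
next
  case (Suc k)
  have "word (gens @ gens @ gens @ gens @ gens) = s (ev zeta ^ 1)"
    using same_up_to_word[OF coxeter_word] by (intro ext) simp
  moreover have "word (gens @ gens @ gens @ gens @ gens) \<in> G" by (rule word_in_G) auto
  ultimately have "s (ev zeta) \<in> G" by simp
  from G_facts(2)[OF this Suc.IH] have "s (ev zeta) \<circ> s (ev zeta ^ k) \<in> G" .
  moreover have "s (ev zeta) \<circ> s (ev zeta ^ k) = s (ev zeta ^ Suc k)" by (auto simp: fun_eq_iff)
  ultimately show ?case by simp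
qed

lemma unit_in_G: "u \<in> set units \<Longrightarrow> s (ev u) \<in> G"
  using units_zeta scalar_in_G by fastforce

subsection \<open>The action on the roots\<close>

lemma witting_word:
  assumes "set as \<subseteq> set gens" "x \<in> set witting"
  shows "exact_word x as \<and> pullback_word x as \<in> set witting"
  using assms by (induction as arbitrary: x) (auto simp: witting_closed)

lemma isometry_word:
  assumes "set as \<subseteq> set gens" "x \<in> set witting" "y \<in> set witting"
  shows "dot4 (pullback_word x as) (conj4 (pullback_word y as)) = dot4 x (conj4 y)"
  using assms by (induction as arbitrary: x y) (auto simp: witting_closed pullback_isometry gens_norm)

text \<open>Composition of forms with \<open>g\<close> acts on the finite set of roots;
  \<open>T\<close> hides the word that represents \<open>g\<close>. It serves both the stabiliser
  chain and the invariance of the power sums.\<close>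

lemma G_witting:
  assumes "g \<in> G"
  obtains T where "\<And>x. x \<in> set witting \<Longrightarrow> T x \<in> set witting"
    "\<And>x v. x \<in> set witting \<Longrightarrow> form x (g v) = form (T x) v"
    "\<And>x y. x \<in> set witting \<Longrightarrow> y \<in> set witting \<Longrightarrow> dot4 (T x) (conj4 (T y)) = dot4 x (conj4 y)"
proof -
  obtain as where "set as \<subseteq> set gens" "g = word as" using G_word[OF assms] by blast
  then show ?thesis
    using that[of "\<lambda>x. pullback_word x as"] witting_word isometry_word form_pullback_word by auto
qed

lemma base_witting: "i < 4 \<Longrightarrow> base ! i \<in> set (level i)" "i < 4 \<Longrightarrow> base ! i \<in> set witting"
proof -
  have "List.member (level 0) (base ! 0)" "List.member (level 1) (base ! 1)"
    "List.member (level 2) (base ! 2)" "List.member (level 3) (base ! 3)" by code_simp+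
  then show l: "i < 4 \<Longrightarrow> base ! i \<in> set (level i)" unfolding less_4_cases by auto
  have "set (level i) \<subseteq> set witting" by (induction i) auto
  with l show "i < 4 \<Longrightarrow> base ! i \<in> set witting" by blast
qed

definition stab :: "nat \<Rightarrow> ('v \<Rightarrow> 'v) set" where
  "stab i = {g \<in> G. \<forall>k<i. form (base ! k) \<circ> g = form (base ! k)}"

lemma stab_closed:
  shows "g \<in> stab i \<Longrightarrow> h \<in> stab i \<Longrightarrow> g \<circ> h \<in> stab i"
    and "g \<in> stab i \<Longrightarrow> \<exists>h\<in>stab i. g \<circ> h = id \<and> h \<circ> g = id"
proof -
  show "g \<in> stab i \<Longrightarrow> h \<in> stab i \<Longrightarrow> g \<circ> h \<in> stab i"
    by (auto simp: stab_def G_facts comp_assoc[symmetric])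
  assume g: "g \<in> stab i"
  then obtain h where h: "h \<in> G" "g \<circ> h = id" "h \<circ> g = id" using G_facts(5) by (auto simp: stab_def)
  have "form (base ! k) \<circ> h = form (base ! k)" if "k < i" for k
  proof -
    have "form (base ! k) \<circ> h = form (base ! k) \<circ> g \<circ> h" using g that by (simp add: stab_def)
    then show ?thesis using h(2) by (simp add: comp_assoc)
  qed
  then show "\<exists>h\<in>stab i. g \<circ> h = id \<and> h \<circ> g = id" using h by (auto simp: stab_def)
qed

lemma refl_in_stab:
  assumes "i < 4" "a \<in> set (drop i gens)" shows "refl a \<in> stab i"
proof -
  have fb: "fixed_by (drop (Suc k) gens) (base ! k)" if "k < 3" for k
  proof -
    from that have "k = 0 \<or> k = 1 \<or> k = 2" by auto
    then show ?thesis using base_fixed by (auto simp: numeral_2_eq_2 numeral_3_eq_3)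
  qed
  have "form (base ! k) \<circ> refl a = form (base ! k)" if k: "k < i" for k
  proof -
    have "set (drop i gens) \<subseteq> set (drop (Suc k) gens)" using k by (intro set_drop_subset_set_drop) simp
    then have a: "a \<in> set (drop (Suc k) gens)" using assms(2) by blast
    have F: "all_exact (base ! k) (drop (Suc k) gens)"
      "pullbacks1 (base ! k) (drop (Suc k) gens) = replicate (length (drop (Suc k) gens)) (base ! k)"
      using fb[of k] k assms(1) by (auto simp: fixed_by_def)
    have "pullback a b \<in> set (pullbacks1 b gs)" if "a \<in> set gs" for b gs using that by (induction gs) auto
    from this[OF a, of "base ! k"] have "pullback a (base ! k) = base ! k" unfolding F(2) by simp
    moreover have "exact a (base ! k)" using F(1) a by (simp add: all_exact_iff)
    ultimately show ?thesis using form_pullback[of a "base ! k"] by (auto simp: fun_eq_iff)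
  qed
  moreover have "refl a \<in> G" using assms(2) by (intro refl_in_G) (meson in_set_dropD)
  ultimately show ?thesis by (simp add: stab_def)
qed

text \<open>Unit scalars belong to \<open>stab 0\<close>. For \<open>i > 0\<close> the group
  \<open>stab i\<close> fixes a nonzero form and so contains no scalar but 1; hence the search must
  then be exact.\<close>

lemma orbit_reached:
  assumes i: "i < 4" and us: "set us \<subseteq> set units" "i > 0 \<Longrightarrow> us = [1]"
    and y: "unit_member us (orbit4 n units' (drop i gens) [base ! i] [base ! i]) y"
  shows "\<exists>g\<in>stab i. form (base ! i) \<circ> g = form y"
proof -
  define Q where "Q y \<longleftrightarrow> y \<in> set witting \<and> (\<exists>g\<in>stab i. form (base ! i) \<circ> g = form y)" for y
  have "id \<in> stab i" by (simp add: stab_def G_facts)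
  then have Q0: "Q (base ! i)" using base_witting(2)[OF i] by (auto simp: Q_def intro!: bexI[of _ id])
  have step: "Q (pullback a x)" if x: "Q x" and a: "a \<in> set (drop i gens)" for x a
  proof -
    have a': "a \<in> set gens" using a by (meson in_set_dropD)
    obtain g where g: "g \<in> stab i" "form (base ! i) \<circ> g = form x" and xw: "x \<in> set witting"
      using x by (auto simp: Q_def)
    have "form (base ! i) \<circ> (g \<circ> refl a) = form (pullback a x)"
      using g(2) form_pullback[OF witting_closed(1)[OF xw a']] by (auto simp: fun_eq_iff)
    then show ?thesis
      using stab_closed(1)[OF g(1) refl_in_stab[OF i a]] witting_closed(2)[OF xw a'] by (auto simp: Q_def)
  qed
  obtain u where u: "u \<in> set us" "scale4 u y \<in> set (orbit4 n units' (drop i gens) [base ! i] [base ! i])"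
    using y by (auto simp: unit_member_def list_ex_iff set_multiples)
  have "Q (scale4 u y)"
    by (rule orbit4_invariant[where Q = Q, OF step _ _ u(2)]) (use Q0 in auto)
  then obtain g where g: "g \<in> stab i" "form (base ! i) \<circ> g = form (scale4 u y)" by (auto simp: Q_def)
  show ?thesis
  proof (cases "i = 0")
    case True
    obtain u' where u': "u' \<in> set units" "u' * u = 1" using units_inverse us(1) u(1) by blast
    have "form (base ! i) \<circ> (g \<circ> s (ev u')) = form y"
    proof
      fix v
      have "(form (base ! i) \<circ> (g \<circ> s (ev u'))) v = ev (u' * u) * form y v"
        using fun_cong[OF g(2), of "s (ev u') v"]
        by (simp add: form_scale4 functional_simps[OF functional_form] mult_ac)
      then show "(form (base ! i) \<circ> (g \<circ> s (ev u'))) v = form y v" by (simp only: u'(2)) simp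
    qed
    moreover have "g \<circ> s (ev u') \<in> stab i"
      using G_facts(2) g(1) unit_in_G[OF u'(1)] True by (simp add: stab_def)
    ultimately show ?thesis by blast
  next
    case False
    then have "u = 1" using us u(1) by auto
    then show ?thesis using g by (auto simp: scale4_algebra)
  qed
qed

text \<open>Hermitian products with the fixed base elements are preserved, which bounds the orbit
  from above by \<open>level i\<close>; the search bounds it from below.\<close>

lemma level_orbit:
  assumes i: "i < 4" shows "(\<lambda>g. form (base ! i) \<circ> g) ` stab i = form ` set (level i)"
proof
  show "(\<lambda>g. form (base ! i) \<circ> g) ` stab i \<subseteq> form ` set (level i)"
  proof clarify
    fix g assume g: "g \<in> stab i"
    then have "g \<in> G" by (simp add: stab_def)
    then obtain T where T: "\<And>x. x \<in> set witting \<Longrightarrow> T x \<in> set witting"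
      "\<And>x v. x \<in> set witting \<Longrightarrow> form x (g v) = form (T x) v"
      "\<And>x y. x \<in> set witting \<Longrightarrow> y \<in> set witting \<Longrightarrow> dot4 (T x) (conj4 (T y)) = dot4 x (conj4 y)"
      using G_witting by blast
    note b = base_witting(2)
    have fixed: "T (base ! k) = base ! k" if "k < i" for k
    proof (rule form_inject)
      fix v
      have "form (base ! k) (g v) = form (base ! k) v"
        using g that by (simp add: stab_def) (metis comp_apply)
      then show "form (T (base ! k)) v = form (base ! k) v" using T(2)[OF b, of k v] that i by simp
    qed
    have prod: "dot4 (T (base ! i)) (conj4 (base ! k)) = dot4 (base ! i) (conj4 (base ! k))" if "k < i" for k
      using T(3)[OF b[OF i] b, of k] fixed[OF that] that i by simp
    have "T (base ! i) \<in> set (level m)" if "m \<le> i" "base ! i \<in> set (level m)" for m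
      using that
    proof (induction m)
      case 0
      then show ?case using T(1)[OF b[OF i]] by simp
    next
      case (Suc m)
      then show ?case using prod[of m] by (simp add: same_product_def)
    qed
    then have "T (base ! i) \<in> set (level i)" using base_witting(1)[OF i] by blast
    moreover have "form (base ! i) \<circ> g = form (T (base ! i))" using T(2)[OF b[OF i]] by (auto simp: fun_eq_iff)
    ultimately show "form (base ! i) \<circ> g \<in> form ` set (level i)" by blast
  qed
  show "form ` set (level i) \<subseteq> (\<lambda>g. form (base ! i) \<circ> g) ` stab i"
  proof clarify
    fix y assume y: "y \<in> set (level i)"
    have "\<exists>g\<in>stab i. form (base ! i) \<circ> g = form y"
    proof (cases "i = 0")
      case True
      then have "y \<in> set witting" using y by simp
      then obtain u z where u: "u \<in> set units" "z \<in> set half_witting" "y = scale4 u z" by (auto simp: set_witting)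
      obtain u' where u': "u' \<in> set units" "u' * u = 1" using units_inverse[OF u(1)] by blast
      have "unit_member units (orbit4 30 units gens [base ! 0] [base ! 0]) z"
        using transitive_witting u(2) by (simp add: list_all_iff)
      then obtain r where r: "r \<in> set units" "scale4 r z \<in> set (orbit4 30 units gens [base ! 0] [base ! 0])"
        by (auto simp: unit_member_def list_ex_iff set_multiples)
      have "scale4 (r * u') y = scale4 r z"
        using u(3) u'(2) by (simp add: scale4_algebra mult.assoc)
      then have "unit_member units (orbit4 30 units gens [base ! 0] [base ! 0]) y"
        using r units_mult[OF r(1) u'(1)] by (auto simp: unit_member_def list_ex_iff set_multiples)
      then show ?thesis using orbit_reached[OF i, of units 30 units y] True by simp
    next
      case False
      have "y \<in> set (orbit4 30 [1] (drop i gens) [base ! i] [base ! i])"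
        using False i transitive_levels y unfolding less_4_cases by (auto simp: list_all_iff)
      then have "unit_member [1] (orbit4 30 [1] (drop i gens) [base ! i] [base ! i]) y"
        by (simp add: unit_member_def scale4_algebra)
      then show ?thesis using orbit_reached[OF i, of "[1]" 30 "[1]" y] by (simp add: units_def)
    qed
    then obtain g where "g \<in> stab i" "form (base ! i) \<circ> g = form y" by blast
    then show "form y \<in> (\<lambda>g. form (base ! i) \<circ> g) ` stab i" by (intro image_eqI[of _ _ g]) simp_all
  qed
qed

text \<open>The four base forms vanish on \<open>g v - v\<close> and are linearly independent; the
  system is solved by hand.\<close>

lemma stab_4: "stab 4 = {id}"
proof
  show "stab 4 \<subseteq> {id}"
  proof
    fix g assume g: "g \<in> stab 4"
    have "g v = v" for v
    proof -
      let ?u = "g v - v"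
      have z: "form (base ! k) ?u = 0" if "k < 4" for k
      proof -
        have "form (base ! k) (g v) = form (base ! k) v" using g that by (simp add: stab_def) (metis comp_apply)
        then show ?thesis by (simp add: functional_simps[OF functional_form])
      qed
      define a b c d where "a = X 0 ?u" "b = X 1 ?u" "c = X 2 ?u" "d = X 3 ?u"
      note defs = this
      have bs: "base ! 0 = Vec4 1 0 (- 1) 1" "base ! 1 = Vec4 om 0 (- 1) 1"
        "base ! 2 = Vec4 0 (- om) (- 1) (- (om * om))" "base ! 3 = Vec4 0 (- (om * om)) (- 1) (- (om * om))"
        by (simp_all add: base_def)
      have "form (base ! 0) ?u = 0" "form (base ! 1) ?u = 0" "form (base ! 2) ?u = 0" "form (base ! 3) ?u = 0"
        by (simp_all add: z del: form.simps)
      then have "1 * a + 0 * b + - 1 * c + 1 * d = 0" "w * a + 0 * b + - 1 * c + 1 * d = 0"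
        "0 * a + - w * b + - 1 * c + - (w * w) * d = 0" "0 * a + - (w * w) * b + - 1 * c + - (w * w) * d = 0"
        unfolding bs form.simps ev_hom defs by simp_all
      then have eqs: "a - c + d = 0" "w * a - c + d = 0" "- w * b - c - w * w * d = 0" "- (w * w) * b - c - w * w * d = 0"
        by simp_all
      have "(w - 1) * a = (w * a - c + d) - (a - c + d)" by (simp add: algebra_simps)
      then have "(w - 1) * a = 0" unfolding eqs(1,2) by simp
      then have a: "a = 0" using w_facts(2) by simp
      have "(w * w - w) * b = (- w * b - c - w * w * d) - (- (w * w) * b - c - w * w * d)"
        by (simp add: algebra_simps)
      then have "(w * w - w) * b = 0" unfolding eqs(3,4) by simp
      then have b: "b = 0" using w_facts(7) by simp
      have cd: "c = d" using eqs(1) a by (simp add: algebra_simps)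
      have "- d - w * w * d = 0" using eqs(3) b cd by simp
      moreover have "- d - w * w * d = w * d" unfolding w by (simp add: algebra_simps)
      ultimately have "w * d = 0" by simp
      then have "d = 0" using w_facts(3) by simp
      then have "?u = 0"
        using a b cd by (intro vector_eqI) (auto simp: less_4_cases defs functional_simps[OF X_functional])
      then show ?thesis by simp
    qed
    then show "g \<in> {id}" by auto
  qed
  show "{id} \<subseteq> stab 4" by (simp add: stab_def G_facts)
qed

lemma card_G: "card G = 155520"
proof -
  have step: "card (stab i) = card (set (level i)) * card (stab k)" if "i < 4" "k = Suc i" for i k
  proof -
    have "card (stab i) = card (form ` set (level i)) * card {g \<in> stab i. form (base ! i) \<circ> g = form (base ! i)}"
      unfolding level_orbit[OF that(1), symmetric] by (rule card_orbit_stabiliser) (rule stab_closed; assumption)+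
    also have "card (form ` set (level i)) = card (set (level i))"
      by (intro card_image inj_onI form_inject) (rule fun_cong)
    also have "{g \<in> stab i. form (base ! i) \<circ> g = form (base ! i)} = stab k"
      by (auto simp: stab_def less_Suc_eq that(2))
    finally show ?thesis .
  qed
  have "card (stab 0) = card (set (level 0)) * card (stab 1)" "card (stab 1) = card (set (level 1)) * card (stab 2)"
    "card (stab 2) = card (set (level 2)) * card (stab 3)" "card (stab 3) = card (set (level 3)) * card (stab 4)"
    by (rule step; simp)+
  then have "card (stab 0) = 155520" by (simp only: card_levels stab_4) simp
  moreover have "stab 0 = G" by (simp add: stab_def)
  ultimately show ?thesis by (simp only:)
qed

end

context witting_frame
begin

subsection \<open>Reflections, irreducibility and primitivity\<close>

lemma gens_eq: "gens = [Vec4 th 0 0 0, Vec4 1 1 0 (- 1), Vec4 0 th 0 0, Vec4 0 1 1 1]"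
  by (rule gens_def)

lemma ev_th_nz: "ev th \<noteq> 0" "ev (conj_eis th) \<noteq> 0"
  by (subst ev_eq_0; simp add: th_def zero_eis_def)+

lemma root_form:
  assumes "dot4 a (conj4 a) = 3"
  shows "form (conj4 a) (vec a) = 3" "vec a \<noteq> 0"
proof -
  show 1: "form (conj4 a) (vec a) = 3" by (simp add: form_vec dot4_algebra(9)[of "conj4 a"] assms)
  show "vec a \<noteq> 0" using 1 functional_simps(3)[OF functional_form, of "conj4 a"] by auto
qed

lemma is_reflection_refl:
  assumes a: "dot4 a (conj4 a) = 3"
  shows "is_reflection s (refl a)" "group.ord (GL s) (refl a) = 3"
proof -
  interpret G: group "GL s" by (rule group_GL)
  let ?l = "form (conj4 a)"
  note l = functional_simps[OF functional_form[of "conj4 a"]]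
  have cube: "refl a ^^ 3 = id" using refl_cube[OF a] by (auto simp: eval_nat_numeral)
  have fix_eq: "{v. refl a v = v} = {v. ?l v = 0}"
    using w_facts(2) root_form(2)[OF a] by (auto simp: refl_def)
  obtain B where B: "B \<subseteq> {v. ?l v = 0}" "independent B" "{v. ?l v = 0} \<subseteq> span B"
    "card B = dim {v. ?l v = 0}" using basis_exists by blast
  have sub: "subspace {v. ?l v = 0}" by (auto simp: subspace_def l)
  have spanB: "span B = {v. ?l v = 0}" using B(1,3) sub span_minimal by blast
  have nB: "vec a \<notin> span B" using root_form(1)[OF a] by (simp add: spanB)
  have ind: "independent (insert (vec a) B)" using B(2) nB by (simp add: independent_insert)
  have "v \<in> span (insert (vec a) B)" for v
  proof -
    have "v - s (?l v / 3) (vec a) \<in> span B" by (simp add: spanB l root_form(1)[OF a])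
    then have "v - s (?l v / 3) (vec a) \<in> span (insert (vec a) B)"
      using span_mono[of B "insert (vec a) B"] by blast
    then have "(v - s (?l v / 3) (vec a)) + s (?l v / 3) (vec a) \<in> span (insert (vec a) B)"
      by (rule span_add) (intro span_scale span_base, simp)
    then show ?thesis by simp
  qed
  then have sp: "span (insert (vec a) B) = UNIV" by blast
  have "UNIV \<subseteq> span (e ` {..<4})"
  proof
    fix v
    have "(\<Sum>i<4. s (X i v) (e i)) \<in> span (e ` {..<4})"
      by (intro span_sum span_scale span_base) auto
    then show "v \<in> span (e ` {..<4})" using expand[of v] by simp
  qed
  then have "finite (insert (vec a) B)"
    using independent_span_bound[OF _ ind, of "e ` {..<4}"] by auto
  then have "card (insert (vec a) B) = card B + 1"
    using nB span_base by (subst card_insert_disjoint) auto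
  moreover have "dim UNIV = card (insert (vec a) B)"
    by (rule dim_eq_card[OF _ ind]) (simp add: sp)
  ultimately have "dim {v. refl a v = v} + 1 = dim UNIV" using B(4) by (simp add: fix_eq)
  then show "is_reflection s (refl a)"
    unfolding is_reflection_def using refl_GL(1)[OF a] cube by (auto intro!: exI[of _ "3::nat"])
  have c: "refl a \<in> carrier (GL s)" by (rule refl_GL(1)[OF a])
  have "refl a [^]\<^bsub>GL s\<^esub> (3::nat) = \<one>\<^bsub>GL s\<^esub>"
    using cube by (simp add: eval_nat_numeral GL_simps(1,2) comp_assoc)
  then have "G.ord (refl a) dvd 3" using G.pow_eq_id[OF c] by blast
  moreover have "G.ord (refl a) \<noteq> 1"
  proof
    assume "G.ord (refl a) = 1"
    then have "refl a = id" using G.ord_eq_1[OF c] by (simp add: GL_simps)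
    then have "s (w - 1) (vec a) = 0" using refl_vec[OF a] by (simp add: scale_left_diff_distrib)
    then show False using root_form(2)[OF a] w_facts(2) by (simp add: scale_eq_0_iff)
  qed
  moreover have "n = 1 \<or> n = 3" if "n dvd 3" for n :: nat
  proof -
    have "n \<le> 3" using that by (rule dvd_imp_le) simp
    then have "n = 0 \<or> n = 1 \<or> n = 2 \<or> n = 3" by auto
    then show ?thesis using that by auto
  qed
  ultimately show "G.ord (refl a) = 3" by blast
qed

text \<open>As \<open>refl a u - u\<close> is a multiple of the root, either \<open>U\<close> lies
  in all four reflecting hyperplanes, which meet in 0, or it contains a root, and then all four by
  connectedness of the diagram.\<close>

lemma invariant_subspace:
  assumes U: "subspace U" and inv: "\<And>a. a \<in> set gens \<Longrightarrow> refl a ` U \<subseteq> U"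
  shows "U = {0} \<or> U = UNIV"
proof (cases "\<exists>a\<in>set gens. vec a \<in> U")
  case False
  have z: "form (conj4 a) u = 0" if "a \<in> set gens" "u \<in> U" for a u
  proof (rule ccontr)
    assume nz: "form (conj4 a) u \<noteq> 0"
    have "refl a u - u \<in> U" using inv that U by (intro subspace_diff) auto
    then have "s (inverse ((w - 1) / 3 * form (conj4 a) u)) (refl a u - u) \<in> U" by (rule subspace_scale[OF U])
    also have "s (inverse ((w - 1) / 3 * form (conj4 a) u)) (refl a u - u) = vec a"
      using nz w_facts(2) by (simp add: refl_def)
    finally show False using False that(1) by blast
  qed
  have "u = 0" if u: "u \<in> U" for u
  proof -
    have "X 0 u = 0" "X (Suc 0) u = 0"
      using z[of "gens ! 0" u] z[of "gens ! 2" u] ev_th_nz u by (simp_all add: gens_eq conj_eis_hom)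
    moreover have "X 0 u + X (Suc 0) u - X 3 u = 0" "X (Suc 0) u + X 2 u + X 3 u = 0"
      using z[of "gens ! 1" u] z[of "gens ! 3" u] u by (simp_all add: gens_eq)
    ultimately show ?thesis
      by (intro vector_eqI) (auto simp: less_4_cases functional_simps[OF X_functional])
  qed
  then show ?thesis using subspace_0[OF U] by blast
next
  case True
  have next': "vec a \<in> U" if "vec b \<in> U" "a \<in> set gens" "dot4 (conj4 a) b \<noteq> 0" for a b
  proof -
    let ?k = "(w - 1) / 3 * form (conj4 a) (vec b)"
    have "?k \<noteq> 0" using that(3) w_facts(2) by (simp add: form_vec ev_eq_0)
    have "refl a (vec b) - vec b \<in> U" using inv that U by (intro subspace_diff) auto
    then have "s (inverse ?k) (refl a (vec b) - vec b) \<in> U" by (rule subspace_scale[OF U])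
    also have "s (inverse ?k) (refl a (vec b) - vec b) = vec a"
      using \<open>?k \<noteq> 0\<close> by (simp add: refl_def del: mult_eq_0_iff divide_eq_0_iff)
    finally show ?thesis .
  qed
  have nz: "dot4 (conj4 (gens ! 0)) (gens ! 1) \<noteq> 0" "dot4 (conj4 (gens ! 1)) (gens ! 0) \<noteq> 0"
    "dot4 (conj4 (gens ! 1)) (gens ! 2) \<noteq> 0" "dot4 (conj4 (gens ! 2)) (gens ! 1) \<noteq> 0"
    "dot4 (conj4 (gens ! 2)) (gens ! 3) \<noteq> 0" "dot4 (conj4 (gens ! 3)) (gens ! 2) \<noteq> 0"
    by code_simp+
  have mem: "gens ! 0 \<in> set gens" "gens ! 1 \<in> set gens" "gens ! 2 \<in> set gens" "gens ! 3 \<in> set gens"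
    by (simp_all add: gens_eq)
  have "set gens = {gens ! 0, gens ! 1, gens ! 2, gens ! 3}" by (simp add: gens_eq)
  then have "vec (gens ! 0) \<in> U \<or> vec (gens ! 1) \<in> U \<or> vec (gens ! 2) \<in> U \<or> vec (gens ! 3) \<in> U"
    using True by auto
  then have all: "vec (gens ! 0) \<in> U" "vec (gens ! 1) \<in> U" "vec (gens ! 2) \<in> U" "vec (gens ! 3) \<in> U"
    using next' nz mem by blast+
  have "s (inverse (ev th)) (vec (gens ! 0)) \<in> U" "s (inverse (ev th)) (vec (gens ! 2)) \<in> U"
    using all subspace_scale[OF U] by blast+
  then have e01: "e 0 \<in> U" "e 1 \<in> U" using ev_th_nz(1) by (simp_all add: gens_eq)
  have "e 0 + e 1 - vec (gens ! 1) \<in> U" using e01 all by (intro subspace_add subspace_diff U)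
  then have e3: "e 3 \<in> U" by (simp add: gens_eq)
  have "vec (gens ! 3) - e 1 - e 3 \<in> U" using e01 e3 all by (intro subspace_diff U)
  then have e2: "e 2 \<in> U" by (simp add: gens_eq)
  have "v \<in> U" for v
    by (subst expand, intro subspace_sum subspace_scale U)
      (use e01 e2 e3 in \<open>auto simp: less_4_cases\<close>)
  then show ?thesis by blast
qed

lemma irreducible:
  assumes "refl ` set gens \<subseteq> W" shows "is_irreducible s W"
  unfolding is_irreducible_def
proof (intro conjI allI impI)
  have "X 0 0 = 0" by (rule functional_simps(3)[OF X_functional]) simp
  then have "e 0 \<noteq> 0" using X_simps(1) by (metis zero_neq_one)
  then show "(UNIV :: 'v set) \<noteq> {0}" by blast
  fix U assume "subspace U \<and> (\<forall>g\<in>W. g ` U \<subseteq> U)"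
  then show "U = {0} \<or> U = UNIV" using assms by (intro invariant_subspace) auto
qed

lemma primitive:
  assumes W: "refl ` set gens \<subseteq> W" shows "is_primitive s W"
  unfolding is_primitive_def
proof (intro conjI notI)
  show "is_irreducible s W" by (rule irreducible[OF W])
  assume "\<exists>D. direct_decomposition s D \<and> card D \<ge> 2 \<and> (\<forall>g\<in>W. \<forall>U\<in>D. g ` U \<in> D)"
  then obtain D where D: "direct_decomposition s D" "card D \<ge> 2" "\<And>g U. g \<in> W \<Longrightarrow> U \<in> D \<Longrightarrow> g ` U \<in> D"
    by blast
  have fin: "finite D" and sub: "\<And>U. U \<in> D \<Longrightarrow> subspace U" "\<And>U. U \<in> D \<Longrightarrow> U \<noteq> {0}"
    and uniq: "\<And>v. \<exists>!f. f \<in> (\<Pi>\<^sub>E U\<in>D. U) \<and> v = (\<Sum>U\<in>D. f U)"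
    using D(1) by (auto simp: direct_decomposition_def)
  have stable: "refl a ` U = U" if a: "a \<in> set gens" and U: "U \<in> D" for a U
  proof (rule ccontr)
    assume neq: "refl a ` U \<noteq> U"
    note n = gens_norm[OF a]
    define g where "g = refl a"
    have g3: "g (g (g v)) = v" for v unfolding g_def by (rule refl_cube[OF n])
    have inj: "inj g" by (metis g3 injI)
    have gW: "g \<in> W" using W a by (auto simp: g_def)
    define U1 U2 where "U1 = g ` U" and "U2 = g ` U1"
    have mem: "U1 \<in> D" "U2 \<in> D" using D(3)[OF gW] U by (auto simp: U1_def U2_def)
    have n1: "U1 \<noteq> U" using neq by (simp add: U1_def g_def)
    have n2: "U2 \<noteq> U1" using n1 inj by (simp add: U1_def U2_def inj_image_eq_iff)
    have "g ` U2 = U" by (simp add: U1_def U2_def image_image g3)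
    then have n3: "U2 \<noteq> U" using n1 by (auto simp: U1_def)
    obtain u where u: "u \<in> U" "u \<noteq> 0" using sub[OF U] subspace_0 by blast
    have scaled: "g (s k (vec a)) = s w (s k (vec a))" for k
      using linear_refl[of a] refl_vec[OF n] by (simp add: g_def Vector_Spaces.linear_iff mult.commute)
    have "g u - u = s ((w - 1) / 3 * form (conj4 a) u) (vec a)" by (simp add: g_def refl_def)
    then have "g (g u - u) = s w (g u - u)" by (simp only: scaled)
    moreover have "g (g u - u) = g (g u) - g u"
      using module_hom.diff[OF module_hom_linearI[OF linear_refl]] by (simp add: g_def)
    \<comment> \<open>This is \<open>(g - 1) (g - w) u = 0\<close>. The three terms lie in the
      different summands \<open>U\<close>, \<open>U1\<close> and \<open>U2\<close>, so directness
      forces the coefficient of \<open>u\<close> to vanish.\<close>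
    ultimately have rel: "s w u + (- s (1 + w) (g u) + g (g u)) = 0" by (simp add: algebra_simps)
    define f where "f A = (if A = U then s w u else if A = U1 then - s (1 + w) (g u)
      else if A = U2 then g (g u) else 0)" for A
    have "f A \<in> A" if "A \<in> D" for A
      using that u(1) sub(1) subspace_scale subspace_neg subspace_0
      by (auto simp: f_def U1_def U2_def)
    then have f: "restrict f D \<in> (\<Pi>\<^sub>E U\<in>D. U)" by auto
    have z: "restrict (\<lambda>A. 0) D \<in> (\<Pi>\<^sub>E U\<in>D. U)" using sub(1) subspace_0 by auto
    have "(\<Sum>A\<in>D. restrict f D A) = (\<Sum>A\<in>{U, U1, U2}. f A)"
      using fin U mem by (intro sum.mono_neutral_cong_right) (auto simp: f_def)
    also have "\<dots> = s w u + (- s (1 + w) (g u) + g (g u))"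
      using n1 n2 n3 by (simp add: f_def)
    finally have "0 = (\<Sum>A\<in>D. restrict f D A)" using rel by simp
    moreover have "0 = (\<Sum>A\<in>D. restrict (\<lambda>A. 0) D A)" by simp
    ultimately have "restrict f D = restrict (\<lambda>A. 0) D" using uniq[of 0] f z by blast
    then have "f U = 0" using U by (metis restrict_apply')
    then show False using u(2) w_facts(3) by (simp add: f_def)
  qed
  have "U = UNIV" if "U \<in> D" for U
    using invariant_subspace[OF sub(1)[OF that]] sub(2)[OF that] stable[OF _ that] by blast
  then have "D \<subseteq> {UNIV}" by blast
  then have "card D \<le> 1" using card_mono[of "{UNIV}" D] by simp
  with D(2) show False by simp
qed

subsection \<open>Degrees\<close>

lemma form_e: "k < 4 \<Longrightarrow> form x (e k) = ev (coord4 x k)"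
  by (cases x) (auto simp: less_4_cases)

text \<open>Only exponents divisible by 6 are of interest: for others the six unit multiples of a
  root cancel.\<close>

definition power_sum :: "nat \<Rightarrow> 'v \<Rightarrow> complex" where
  "power_sum i v = (\<Sum>x\<in>set witting. form x v ^ (12 + 6 * i))"

lemma power_sum_homogeneous: "homogeneous s (12 + 6 * i) (power_sum i)"
proof -
  have "homogeneous s ((12 + 6 * i) * 1) (\<lambda>v. form x v ^ (12 + 6 * i))" for x
    by (rule homogeneous_power[OF homogeneous_functional[OF functional_form]])
  then show ?thesis unfolding power_sum_def[abs_def] by (intro homogeneous_sum) simp
qed

lemma power_sum_invariant:
  assumes "g \<in> G" shows "power_sum i (g v) = power_sum i v"
proof -
  obtain T where T: "\<And>x. x \<in> set witting \<Longrightarrow> T x \<in> set witting"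
    "\<And>x v. x \<in> set witting \<Longrightarrow> form x (g v) = form (T x) v"
    using G_witting[OF assms] by metis
  have inj: "inj_on T (set witting)"
  proof (rule inj_onI, rule form_inject)
    fix x y v assume xy: "x \<in> set witting" "y \<in> set witting" "T x = T y"
    obtain u where "v = g u" using G_facts(4)[OF assms] by (metis bij_pointE)
    then show "form x v = form y v" using T(2)[OF xy(1)] T(2)[OF xy(2)] xy(3) by simp
  qed
  have "T ` set witting = set witting" by (rule endo_inj_surj[OF _ _ inj]) (use T in auto)
  then have "(\<Sum>x\<in>set witting. form x v ^ (12 + 6 * i)) = (\<Sum>x\<in>set witting. form (T x) v ^ (12 + 6 * i))"
    using sum.reindex[OF inj, of "\<lambda>x. form x v ^ (12 + 6 * i)"] by simp
  also have "\<dots> = (\<Sum>x\<in>set witting. form x (g v) ^ (12 + 6 * i))"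
    by (rule sum.cong[OF HOL.refl]) (simp only: T(2))
  finally show ?thesis by (simp only: power_sum_def)
qed

definition half_entry :: "nat \<Rightarrow> nat \<Rightarrow> eis" where
  "half_entry i k = (\<Sum>x\<leftarrow>half_witting. of_nat (12 + 6 * i) * dot4 x pt ^ (12 + 6 * i - 1) * coord4 x k)"

lemma unit_power_6: "u \<in> set units \<Longrightarrow> ev u ^ 6 = 1"
proof -
  have "list_all (\<lambda>u. u ^ 6 = 1) units" by code_simp
  then have "u \<in> set units \<Longrightarrow> ev (u ^ 6) = ev 1" by (auto simp: list_all_iff)
  then show "u \<in> set units \<Longrightarrow> ev u ^ 6 = 1" by simp
qed

lemma jacobian_entry:
  assumes "k < 4" shows "dird (e k) (power_sum i) (vec pt) = ev (6 * half_entry i k)"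
proof -
  let ?d = "12 + 6 * i"
  let ?t = "\<lambda>x. of_nat ?d * form x (vec pt) ^ (?d - 1) * form x (e k)"
  have "dird (e k) (power_sum i) (vec pt) = (\<Sum>x\<in>set witting. dird (e k) (\<lambda>v. form x v ^ ?d) (vec pt))"
    unfolding power_sum_def[abs_def] by (rule dird_sum) (intro P_power P_functional functional_form)
  also have "\<dots> = (\<Sum>x\<in>set witting. ?t x)"
    by (simp only: dird_power[OF P_functional[OF functional_form]] dird_functional[OF functional_form])
  also have "set witting = (\<lambda>(u, x). scale4 u x) ` (set units \<times> set half_witting)"
    by (auto simp: set_witting)
  also have "(\<Sum>x\<in>(\<lambda>(u, x). scale4 u x) ` (set units \<times> set half_witting). ?t x) =
      (\<Sum>(u, x)\<in>set units \<times> set half_witting. ?t (scale4 u x))"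
    by (subst sum.reindex[OF inj_on_unit_multiples]) (simp add: case_prod_unfold comp_def)
  also have "\<dots> = (\<Sum>(u, x)\<in>set units \<times> set half_witting. ?t x)"
  proof (rule sum.cong[OF HOL.refl], clarify)
    fix u x assume u: "u \<in> set units"
    \<comment> \<open>Differentiation lowers the power by one and the factor
      \<open>form x (e k)\<close> restores it, so the unit enters with an exponent divisible by
      6.\<close>
    have "?t (scale4 u x) = ev u ^ Suc (?d - 1) * ?t x"
      by (simp only: form_scale4 power_mult_distrib power_Suc mult_ac)
    also have "Suc (?d - 1) = 6 * (2 + i)" by simp
    finally show "?t (scale4 u x) = ?t x" by (simp only: power_mult unit_power_6[OF u] power_one mult_1)
  qed
  also have "\<dots> = of_nat (card (set units)) * (\<Sum>x\<in>set half_witting. ?t x)"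
    by (simp add: sum.cartesian_product[symmetric])
  also have "card (set units) = 6" by (subst distinct_card) (code_simp, simp add: units_def)
  also have "(\<Sum>x\<in>set half_witting. ?t x) = (\<Sum>x\<leftarrow>half_witting. ?t x)"
    by (rule sum_list_distinct_conv_sum_set[OF distinct_half_witting, symmetric])
  also have "\<dots> = ev (half_entry i k)"
    unfolding half_entry_def ev_sum_list
    by (simp only: form_vec form_e[OF assms] map_map comp_def ev_hom ev_power ev_of_nat)
  also have "of_nat 6 * ev (half_entry i k) = ev (of_nat 6 * half_entry i k)" by (simp only: ev_hom ev_of_nat)
  finally show ?thesis by simp
qed

end

text \<open>A congruence instead of a function to residues: \<open>hom31\<close> respects products
  only modulo 31, because 5^2 + 5 + 1 = 31.\<close>

definition red31 :: "eis \<Rightarrow> int \<Rightarrow> bool" where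
  "red31 x r \<longleftrightarrow> 31 dvd hom31 x - r"

lemma red31_add: "red31 x r \<Longrightarrow> red31 y q \<Longrightarrow> red31 (x + y) (r + q)"
proof -
  have "hom31 (x + y) - (r + q) = (hom31 x - r) + (hom31 y - q)" by (cases x; cases y) simp
  then show "red31 x r \<Longrightarrow> red31 y q \<Longrightarrow> red31 (x + y) (r + q)"
    unfolding red31_def by (metis dvd_add)
qed

lemma red31_diff: "red31 x r \<Longrightarrow> red31 y q \<Longrightarrow> red31 (x - y) (r - q)"
proof -
  have "hom31 (x - y) - (r - q) = (hom31 x - r) - (hom31 y - q)" by (cases x; cases y) simp
  then show "red31 x r \<Longrightarrow> red31 y q \<Longrightarrow> red31 (x - y) (r - q)"
    unfolding red31_def by (metis dvd_diff)
qed

lemma red31_mult: "red31 x r \<Longrightarrow> red31 y q \<Longrightarrow> red31 (x * y) (r * q)"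
proof -
  assume *: "red31 x r" "red31 y q"
  obtain a b c d where xy: "x = Eis a b" "y = Eis c d" by (cases x; cases y)
  have "hom31 (x * y) - r * q = (hom31 x - r) * hom31 y + r * (hom31 y - q) - 31 * (b * d)"
    by (simp add: xy algebra_simps)
  then show ?thesis using * by (simp add: red31_def)
qed

lemma red31_mod: "red31 x (r mod 31) \<longleftrightarrow> red31 x r"
  unfolding red31_def by (metis mod_diff_right_eq dvd_eq_mod_eq_0)

lemma red31_hom: "red31 x (hom31 x)"
  by (simp add: red31_def)

lemma red31_of_nat: "red31 (of_nat n) (int n)"
proof -
  have "of_nat n = Eis (int n) 0" by (induction n) (simp_all add: zero_eis_def one_eis_def)
  then show ?thesis by (simp add: red31_def)
qed

lemma red31_power: "red31 x r \<Longrightarrow> red31 (x ^ n) (power31 r n)"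
proof (induction n)
  case 0
  then show ?case using red31_of_nat[of 1] by simp
next
  case (Suc n)
  then show ?case using red31_mult[of x r "x ^ n"] by (simp add: red31_mod)
qed

lemma red31_entry:
  "red31 (\<Sum>x\<leftarrow>xs. of_nat d * dot4 x pt ^ (d - 1) * coord4 x k) (entry31 d k xs)"
proof (induction xs)
  case Nil
  then show ?case using red31_of_nat[of 0] by simp
next
  case (Cons x xs)
  then show ?case
    by (simp add: red31_mod) (intro red31_add red31_mult red31_of_nat red31_power red31_hom)
qed

lemma red31_det4:
  "(\<And>i k. i < 4 \<Longrightarrow> k < 4 \<Longrightarrow> red31 (M i k) (N i k)) \<Longrightarrow> red31 (det4 M) (det4 N)"
  unfolding det4_def by (intro red31_add red31_diff red31_mult) auto

context witting_frame
begin

lemma ev_det4: "ev (det4 M) = det4 (\<lambda>i k. ev (M i k))"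
  by (simp add: det4_def)

text \<open>As \<open>ev\<close> is injective, vanishing at \<open>vec pt\<close> would be an
  identity between Eisenstein integers and would persist modulo 31, where the explicit determinant
  is nonzero.\<close>

lemma power_sum_jacobian: "jac power_sum (vec pt) \<noteq> 0"
proof
  have e: "entry31 (12 + 6 * i) k half_witting = jac31 i k" if "i < 4" "k < 4" for i k
    using that unfolding less_4_cases by (elim disjE) (simp_all add: entry31_values[unfolded One_nat_def] jac31_def)
  have r: "red31 (6 * half_entry i k) (6 * jac31 i k)" if "i < 4" "k < 4" for i k
    using red31_mult[OF red31_of_nat[of 6] red31_entry[of "12 + 6 * i" k half_witting]] e[OF that]
    by (simp add: half_entry_def)
  assume "jac power_sum (vec pt) = 0"
  moreover have "jac power_sum (vec pt) = det4 (\<lambda>i k. ev (6 * half_entry i k))"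
    unfolding jac_def by (rule det4_cong) (rule jacobian_entry)
  ultimately have "det4 (\<lambda>i k. 6 * half_entry i k) = 0"
    using ev_det4[of "\<lambda>i k. 6 * half_entry i k"] ev_eq_0 by metis
  moreover have "red31 (det4 (\<lambda>i k. 6 * half_entry i k)) (det4 (\<lambda>i k. 6 * jac31 i k))"
    by (rule red31_det4) (rule r)
  ultimately have "red31 0 (det4 (\<lambda>i k. 6 * jac31 i k))" by (simp only:)
  then show False by (simp add: red31_def det4_def jac31_def zero_eis_def)
qed

section \<open>The 40 reflecting hyperplanes\<close>

definition order3_root :: "('v \<Rightarrow> complex) \<Rightarrow> bool" where
  "order3_root \<phi> \<longleftrightarrow> (\<exists>a. \<phi> a = 1 \<and> (\<lambda>v. v + s ((w - 1) * \<phi> v) a) \<in> G)"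

lemma order3_root_scale:
  assumes "order3_root (\<lambda>v. c * \<phi> v)" "functional \<phi>" shows "order3_root \<phi>"
proof -
  obtain a where a: "c * \<phi> a = 1" "(\<lambda>v. v + s ((w - 1) * (c * \<phi> v)) a) \<in> G"
    using assms(1) by (auto simp: order3_root_def)
  have "\<phi> (s c a) = 1" using a(1) by (simp add: functional_simps[OF assms(2)])
  moreover have "(\<lambda>v. v + s ((w - 1) * (c * \<phi> v)) a) = (\<lambda>v. v + s ((w - 1) * \<phi> v) (s c a))"
    by (simp add: mult_ac)
  ultimately show ?thesis using a(2) unfolding order3_root_def by metis
qed

text \<open>Conjugation by \<open>g\<close> carries the reflection for \<open>\<phi>\<close> to the
  one for the composed form.\<close>

lemma order3_root_comp:
  assumes "order3_root \<phi>" "g \<in> G" shows "order3_root (\<phi> \<circ> g)"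
proof -
  obtain a where a: "\<phi> a = 1" "(\<lambda>v. v + s ((w - 1) * \<phi> v) a) \<in> G"
    using assms(1) by (auto simp: order3_root_def)
  obtain h where h: "h \<in> G" "g \<circ> h = id" "h \<circ> g = id" using G_facts(5)[OF assms(2)] by blast
  have gh: "g (h v) = v" "h (g v) = v" for v using h(2,3) by (auto simp: fun_eq_iff)
  have "h \<circ> ((\<lambda>v. v + s ((w - 1) * \<phi> v) a) \<circ> g) \<in> G" using G_facts(2) h(1) a(2) assms(2) by blast
  also have "h \<circ> ((\<lambda>v. v + s ((w - 1) * \<phi> v) a) \<circ> g) = (\<lambda>v. v + s ((w - 1) * (\<phi> \<circ> g) v) (h a))"
    using G_facts(3)[OF h(1)] by (auto simp: Vector_Spaces.linear_iff gh)
  finally have "(\<lambda>v. v + s ((w - 1) * (\<phi> \<circ> g) v) (h a)) \<in> G" .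
  moreover have "(\<phi> \<circ> g) (h a) = 1" using a(1) by (simp add: gh)
  ultimately show ?thesis unfolding order3_root_def by blast
qed

lemma order3_root_witting:
  assumes "y \<in> set witting" shows "order3_root (form y)"
proof -
  have orbit: "\<exists>g\<in>G. form (base ! 0) \<circ> g = form y" if "y \<in> set witting" for y
  proof -
    have "form y \<in> (\<lambda>g. form (base ! 0) \<circ> g) ` stab 0" using level_orbit[of 0] that by simp
    then obtain g where "g \<in> stab 0" "form y = form (base ! 0) \<circ> g" by blast
    then show ?thesis by (auto simp: stab_def)
  qed
  \<comment> \<open>\<open>refl\<close> pairs with the conjugate root, so this is the form belonging
    to the first generator; the other roots follow by transitivity.\<close>
  let ?x = "Vec4 (conj_eis th) 0 0 0"
  have "List.member witting ?x" by code_simp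
  then obtain g where g: "g \<in> G" "form (base ! 0) \<circ> g = form ?x" using orbit[of ?x] by auto
  obtain h where h: "h \<in> G" "g \<circ> h = id" using G_facts(5)[OF g(1)] by blast
  have b: "form (base ! 0) = form ?x \<circ> h" unfolding g(2)[symmetric] using h(2) by (simp add: comp_assoc)
  have n: "dot4 (gens ! 0) (conj4 (gens ! 0)) = 3" by (rule gens_norm) (simp add: gens_eq)
  have "order3_root (form ?x)"
    unfolding order3_root_def
  proof (intro exI conjI)
    have f: "form ?x = form (conj4 (gens ! 0))" by (simp add: gens_eq conj_eis_hom zero_eis_def)
    show "form ?x (s (1 / 3) (vec (gens ! 0))) = 1"
      unfolding f using root_form(1)[OF n] by (simp add: functional_simps[OF functional_form] del: form.simps)
    have "(\<lambda>v. v + s ((w - 1) * form ?x v) (s (1 / 3) (vec (gens ! 0)))) = refl (gens ! 0)"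
      unfolding f refl_def[abs_def] by (simp del: form.simps vec.simps)
    also have "refl (gens ! 0) \<in> G" by (rule refl_in_G) (simp add: gens_eq)
    finally show "(\<lambda>v. v + s ((w - 1) * form ?x v) (s (1 / 3) (vec (gens ! 0)))) \<in> G" .
  qed
  then have "order3_root (form (base ! 0))" unfolding b by (rule order3_root_comp[OF _ h(1)])
  then show ?thesis using orbit[OF assms] order3_root_comp by metis
qed

lemma order3_root_lines:
  assumes "x \<in> set lines" shows "order3_root (form x)"
proof -
  have "lines = take 4 lines @ drop 4 lines" by simp
  then have "x \<in> set (take 4 lines) \<or> x \<in> set (drop 4 lines)" using assms by (metis Un_iff set_append)
  then have "scale4 th x \<in> set half_witting \<or> x \<in> set half_witting" by (auto simp: half_witting_def)
  moreover have "set half_witting \<subseteq> set witting"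
    by (force simp: set_witting units_def scale4_algebra intro: exI[of _ 1])
  ultimately have "order3_root (form (scale4 th x)) \<or> order3_root (form x)"
    using order3_root_witting by blast
  moreover have "form (scale4 th x) = (\<lambda>v. ev th * form x v)" by (rule ext) (rule form_scale4)
  ultimately show ?thesis using order3_root_scale[OF _ functional_form] by metis
qed

lemma lines_separated:
  assumes "x \<in> set lines" "y \<in> set lines" "x \<noteq> y" shows "\<exists>v. form x v = 0 \<and> form y v \<noteq> 0"
proof -
  have to: "\<exists>ik\<in>set minor_pairs. \<not> proportional x y ik" if "not_proportional_to x ys" "y \<in> set ys" for x y ys
    using that by (induction ys) (auto simp: list_all_iff)
  have sym: "proportional x y ik \<longleftrightarrow> proportional y x ik" for x y ik
    by (auto simp: proportional_def mult.commute)
  have "\<exists>ik\<in>set minor_pairs. \<not> proportional x y ik"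
    if "not_proportional zs" "x \<in> set zs" "y \<in> set zs" for zs
    using that
  proof (induction zs)
    case (Cons z zs)
    then show ?case using assms(3) to[of z zs] sym by (metis not_proportional.simps(2) set_ConsD)
  qed simp
  from this[OF lines_not_proportional assms(1,2)] obtain i k
    where ik: "(i, k) \<in> set minor_pairs" "\<not> proportional x y (i, k)" by auto
  then have lt: "i < 4" "k < 4" by (auto simp: minor_pairs_def)
  \<comment> \<open>A combination of two basis vectors on which \<open>x\<close> vanishes; the value
    of \<open>y\<close> on it is, up to sign, the nonvanishing minor.\<close>
  let ?v = "s (ev (coord4 x k)) (e i) - s (ev (coord4 x i)) (e k)"
  have f: "form z ?v = ev (coord4 x k * coord4 z i - coord4 x i * coord4 z k)" for z
    by (simp add: functional_simps[OF functional_form] form_e lt)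
  have "form x ?v = 0" unfolding f by (simp add: mult.commute)
  moreover have "form y ?v \<noteq> 0" unfolding f ev_eq_0 using ik(2) by (simp add: proportional_def)
  ultimately show ?thesis by blast
qed

lemma degrees: "has_degrees s G [12, 18, 24, 30]"
proof -
  have "has_degrees s G [12 + 6 * 0, 12 + 6 * 1, 12 + 6 * 2, 12 + 6 * 3]"
  proof (rule has_degreesI[where d = "\<lambda>i. 12 + 6 * i" and F = power_sum and l = form and xs = lines and \<zeta> = w])
    show "finite G" using card_G by (metis card.infinite zero_neq_numeral)
    show "id \<in> G" by (rule G_facts)
    show "g \<circ> h \<in> G" if "g \<in> G" "h \<in> G" for g h using that by (rule G_facts)
    show "Vector_Spaces.linear s s g" "surj g" if "g \<in> G" for g
      using G_facts(3,4)[OF that] by (auto simp: bij_def)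
    show "homogeneous s (12 + 6 * i) (power_sum i)" for i by (rule power_sum_homogeneous)
    show "power_sum i (g v) = power_sum i v" if "g \<in> G" for i g v by (rule power_sum_invariant[OF that])
    show "jac power_sum (vec pt) \<noteq> 0" by (rule power_sum_jacobian)
    show "w ^ 3 = 1" "w \<noteq> 1" by (rule w_facts)+
    show "functional (form x) \<and> (\<exists>a. form x a = 1 \<and> (\<lambda>v. v + s ((w - 1) * form x v) a) \<in> G)"
      if "x \<in> set lines" for x
      using order3_root_lines[OF that] functional_form unfolding order3_root_def by blast
    show "\<exists>v. form x v = 0 \<and> form y v \<noteq> 0" if "x \<in> set lines" "y \<in> set lines" "x \<noteq> y" for x y
      by (rule lines_separated[OF that])
    show "distinct lines" by (rule distinct_lines)
    show "(\<Sum>i<4. 12 + 6 * i - 1) = 2 * length lines" by (simp add: distinct_lines sum_4)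
  qed
  then show ?thesis by simp
qed

end

section \<open>The exterior square of a four-dimensional space\<close>

lemma det4_equal_rows:
  assumes "i < 4" "k < 4" "i \<noteq> k" shows "det4 (M(i := M k)) = 0"
proof -
  have "(\<lambda>l. \<Sum>m<4. (if m = k then 1 else 0) * M m l) = M k"
    using assms(2) by (auto simp: sum_4 less_4_cases)
  with det4_row[OF assms(1), of M "\<lambda>m. if m = k then 1 else 0"] assms(3) show ?thesis by simp
qed

lemma (in complex_space) exists_frame:
  assumes "dim UNIV = 4" obtains e X where "frame4 s e X"
proof -
  obtain B where B: "independent B" "UNIV \<subseteq> span B" "card B = dim UNIV"
    using basis_exists[of UNIV] by auto
  then have "finite B" using assms card.infinite by fastforce
  then obtain e where e: "bij_betw e {0..<card B} B" using ex_bij_betw_nat_finite by blast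
  then have eB: "e i \<in> B" if "i < 4" for i
    using that B(3) assms by (auto simp: bij_betw_def)
  have inj: "e i = e k \<longleftrightarrow> i = k" if "i < 4" "k < 4" for i k
    using e that B(3) assms by (auto simp: bij_betw_def inj_on_def)
  have sp: "v \<in> span B" for v using B(2) by blast
  have "frame4 s e (\<lambda>i v. representation B v (e i))"
  proof (intro frame4.intro frame4_axioms.intro complex_space_axioms)
    show "Vector_Spaces.linear s (*) (\<lambda>v. representation B v (e i))" if "i < 4" for i
      using B(1) sp by (simp add: Vector_Spaces.linear_iff vector_space_axioms vector_space_scalars
          representation_add representation_scale)
    show "representation B (e k) (e i) = (if i = k then 1 else 0)" if "i < 4" "k < 4" for i k
      using that B(1) eB inj by (auto simp: representation_basis)
    fix v
    have "v = (\<Sum>b\<in>B. s (representation B v b) b)"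
      using sum_representation_eq[OF B(1) sp \<open>finite B\<close> order_refl] by simp
    also have "\<dots> = (\<Sum>i\<in>{0..<card B}. s (representation B v (e i)) (e i))"
      by (rule sum.reindex_bij_betw[OF e, symmetric])
    also have "{0..<card B} = {..<4}" using B(3) assms by auto
    finally show "v = (\<Sum>i<4. s (representation B v (e i)) (e i))" .
  qed
  then show ?thesis using that by blast
qed

text \<open>The dual basis is given by Cramer's rule.\<close>

lemma (in frame4) frame_from_det:
  assumes "det4 (\<lambda>i k. X k (f i)) \<noteq> 0" obtains Y where "frame4 s f Y"
proof -
  define M where "M = (\<lambda>i k. X k (f i))"
  define Y where "Y i v = det4 (M(i := \<lambda>k. X k v)) / det4 M" for i v
  have d: "det4 M \<noteq> 0" using assms by (simp add: M_def)
  note X = functional_simps[OF X_functional]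
  have "frame4 s f Y"
  proof (intro frame4.intro frame4_axioms.intro complex_space_axioms)
    show "functional (Y i)" if "i < 4" for i
      using that unfolding less_4_cases
      by (elim disjE; simp add: Vector_Spaces.linear_iff vector_space_axioms vector_space_scalars
          Y_def det4_def X add_divide_distrib[symmetric]; simp add: algebra_simps)
    show "Y i (f k) = (if i = k then 1 else 0)" if "i < 4" "k < 4" for i k
    proof -
      have "(\<lambda>l. X l (f k)) = M k" by (simp add: M_def)
      then show ?thesis using d det4_equal_rows[OF that, of M] by (cases "i = k") (simp_all add: Y_def)
    qed
    fix v
    let ?r = "\<Sum>i<4. s (Y i v) (f i)"
    have "X k v = X k ?r" if k: "k < 4" for k
    proof -
      have "X k ?r = (\<Sum>i<4. det4 (M(i := \<lambda>k. X k v)) * M i k) / det4 M"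
        by (simp add: X[OF k] Y_def M_def sum_divide_distrib)
      also have "\<dots> = X k v" using det4_cramer[OF k, of M "\<lambda>k. X k v"] d by simp
      finally show ?thesis ..
    qed
    then have "(\<Sum>i<4. s (X i v) (e i)) = (\<Sum>i<4. s (X i ?r) (e i))" by (intro sum.cong) auto
    then show "v = ?r" using expand[of v] expand[of ?r] by simp
  qed
  then show ?thesis using that by blast
qed

locale ext_space = complex_space s for s :: "complex \<Rightarrow> 'v::ab_group_add \<Rightarrow> 'v" +
  fixes sL :: "complex \<Rightarrow> 'l::ab_group_add \<Rightarrow> 'l" and sM :: "complex \<Rightarrow> 'm::ab_group_add \<Rightarrow> 'm"
    and w2 :: "'v list \<Rightarrow> 'l" and w4 :: "'v list \<Rightarrow> 'm" and \<epsilon> :: 'm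
  assumes ext2: "exterior_power 2 s sL w2" and ext4: "exterior_power 4 s sM w4"
    and gen: "module.span sM {\<epsilon>} = UNIV"
begin

abbreviation "beta \<equiv> wedge_form w2 sL w4 sM \<epsilon>"

lemma vector_space_L: "vector_space sL" and vector_space_M: "vector_space sM"
  using ext2 ext4 by (auto simp: exterior_power_def)

sublocale L: complex_space sL
  by (simp add: complex_space_def vector_space_L)

sublocale M: complex_space sM
  by (simp add: complex_space_def vector_space_M)

lemma w2_simps:
  "w2 [u + u', v] = w2 [u, v] + w2 [u', v]" "w2 [s c u, v] = sL c (w2 [u, v])"
  "w2 [u, v + v'] = w2 [u, v] + w2 [u, v']" "w2 [u, s c v] = sL c (w2 [u, v])"
  "w2 [u, u] = 0" "w2 [v, u] = - w2 [u, v]"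
proof -
  have a: "alternating_multilinear 2 s sL w2" using ext2 by (simp add: exterior_power_def)
  note b = a[unfolded alternating_bilinear_iff Vector_Spaces.linear_iff]
  show *: "w2 [u + u', v] = w2 [u, v] + w2 [u', v]" "w2 [s c u, v] = sL c (w2 [u, v])"
    "w2 [u, v + v'] = w2 [u, v] + w2 [u, v']" "w2 [u, s c v] = sL c (w2 [u, v])" "w2 [u, u] = 0"
    for u u' v v' c using b by blast+
  have "w2 [u, u + v] + w2 [v, u + v] = 0" using *(1)[of u v "u + v"] *(5)[of "u + v"] by simp
  then have "w2 [u, v] + w2 [v, u] = 0" by (simp add: *(3,5))
  then show "w2 [v, u] = - w2 [u, v]" by (simp add: eq_neg_iff_add_eq_0 add.commute)
qed

end

locale ext_frame = ext_space s sL sM w2 w4 \<epsilon> + frame4 s e X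
  for s :: "complex \<Rightarrow> 'v::ab_group_add \<Rightarrow> 'v"
    and sL :: "complex \<Rightarrow> 'l::ab_group_add \<Rightarrow> 'l" and sM :: "complex \<Rightarrow> 'm::ab_group_add \<Rightarrow> 'm"
    and w2 :: "'v list \<Rightarrow> 'l" and w4 :: "'v list \<Rightarrow> 'm" and \<epsilon> :: 'm and e X
begin

text \<open>Pluecker coordinates. Their existence comes from the universal property, hence the
  choice; they are used through the lemma \<open>pl\<close>.\<close>

definition pl :: "nat \<Rightarrow> nat \<Rightarrow> 'l \<Rightarrow> complex" where
  "pl a b = (SOME \<phi>. L.functional \<phi> \<and> (\<forall>u v. \<phi> (w2 [u, v]) = X a u * X b v - X b u * X a v))"

abbreviation "E a b \<equiv> w2 [e a, e b]"

lemma pl: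
  assumes "a < 4" "b < 4"
  shows "L.functional (pl a b)" "pl a b (w2 [u, v]) = X a u * X b v - X b u * X a v"
proof -
  note X = functional_simps[OF X_functional]
  have "alternating_multilinear 2 s (*) (\<lambda>xs. X a (xs ! 0) * X b (xs ! 1) - X b (xs ! 0) * X a (xs ! 1))"
    unfolding alternating_bilinear_iff using assms
    by (auto simp: Vector_Spaces.linear_iff vector_space_axioms vector_space_scalars X algebra_simps)
  from exterior_power_universal[OF ext2 vector_space_scalars this]
  have "\<exists>\<phi>. L.functional \<phi> \<and> (\<forall>u v. \<phi> (w2 [u, v]) = X a u * X b v - X b u * X a v)"
    unfolding all_length_two by auto
  from someI_ex[OF this] show "L.functional (pl a b)" "pl a b (w2 [u, v]) = X a u * X b v - X b u * X a v"
    unfolding pl_def by blast+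
qed

lemmas pl_simps = L.functional_simps[OF pl(1)]

lemma L_expand:
  "y = sL (pl 0 1 y) (E 0 1) + sL (pl 0 2 y) (E 0 2) + sL (pl 0 3 y) (E 0 3) +
     sL (pl 1 2 y) (E 1 2) + sL (pl 1 3 y) (E 1 3) + sL (pl 2 3 y) (E 2 3)" (is "y = ?r y")
proof -
  have "(\<lambda>y. y) = ?r"
  proof (rule linear_eq_on_wedges[OF ext2])
    show "Vector_Spaces.linear sL sL (\<lambda>y. y)"
      by (simp add: Vector_Spaces.linear_iff vector_space_L)
    show "Vector_Spaces.linear sL sL ?r"
      by (simp add: Vector_Spaces.linear_iff vector_space_L pl_simps algebra_simps)
    fix u v
    have "w2 [u, v] = w2 [s (X 0 u) (e 0) + s (X 1 u) (e 1) + s (X 2 u) (e 2) + s (X 3 u) (e 3),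
        s (X 0 v) (e 0) + s (X 1 v) (e 1) + s (X 2 v) (e 2) + s (X 3 v) (e 3)]"
      using expand[of u] expand[of v] by (simp add: sum_4)
    also have "\<dots> = ?r (w2 [u, v])"
      using w2_simps(6)[of "e 0" "e 1"] w2_simps(6)[of "e 0" "e 2"] w2_simps(6)[of "e 0" "e 3"]
        w2_simps(6)[of "e 1" "e 2"] w2_simps(6)[of "e 1" "e 3"] w2_simps(6)[of "e 2" "e 3"]
      by (simp add: w2_simps(1-5) pl algebra_simps)
    finally show "w2 [u, v] = ?r (w2 [u, v])" .
  qed
  then show ?thesis by (rule fun_cong)
qed

lemma L_eqI:
  assumes "pl 0 1 y = pl 0 1 z" "pl 0 2 y = pl 0 2 z" "pl 0 3 y = pl 0 3 z"
    "pl 1 2 y = pl 1 2 z" "pl 1 3 y = pl 1 3 z" "pl 2 3 y = pl 2 3 z"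
  shows "y = z"
  using L_expand[of y] L_expand[of z] assms by metis

lemma pl_antisym: "a < 4 \<Longrightarrow> b < 4 \<Longrightarrow> pl b a y = - pl a b y"
proof -
  assume ab: "a < 4" "b < 4"
  have "pl b a = (\<lambda>y. - pl a b y)"
  proof (rule linear_eq_on_wedges[OF ext2])
    show "L.functional (\<lambda>y. - pl a b y)"
      using ab by (simp add: Vector_Spaces.linear_iff vector_space_L vector_space_scalars pl_simps)
  qed (use ab in \<open>auto simp: pl\<close>)
  then show ?thesis by (rule fun_cong)
qed

lemma pl_diag: "a < 4 \<Longrightarrow> pl a a y = 0"
  using pl_antisym[of a a y] by simp

subsection \<open>The wedge form in coordinates\<close>

lemma w4_alternating: "alternating_multilinear 4 s sM w4"
  using ext4 by (simp add: exterior_power_def)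

lemma w4_nondistinct: "length xs = 4 \<Longrightarrow> \<not> distinct xs \<Longrightarrow> w4 xs = 0"
  using w4_alternating unfolding alternating_multilinear_def distinct_conv_nth
  by (metis linorder_neqE_nat)

text \<open>The determinant of coordinates is alternating and takes the value 1 on the frame. It
  factors through \<open>w4\<close>, so the fourth exterior power is not zero and its generator
  cannot be.\<close>

lemma w4_nonzero: "w4 [e 0, e 1, e 2, e 3] \<noteq> 0" "\<epsilon> \<noteq> 0"
proof -
  note X = functional_simps[OF X_functional]
  let ?F = "\<lambda>xs. det4 (\<lambda>i k. X k (xs ! i))"
  have "alternating_multilinear 4 s (*) ?F"
    unfolding alternating_multilinear_def
  proof (intro conjI allI impI)
    fix xs :: "'v list" and i :: nat assume "length xs = 4 \<and> i < 4"
    then obtain a b c d where xs: "xs = [a, b, c, d]" and i: "i < 4"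
      by (auto simp: numeral_eq_Suc length_Suc_conv)
    show "Vector_Spaces.linear s (*) (\<lambda>v. ?F (xs[i := v]))"
      using i unfolding less_4_cases xs
      by (elim disjE; simp add: Vector_Spaces.linear_iff vector_space_axioms vector_space_scalars
          det4_def X; simp add: algebra_simps)
  next
    fix xs :: "'v list" and i i' :: nat
    assume A: "length xs = 4 \<and> i < i' \<and> i' < 4 \<and> xs ! i = xs ! i'"
    let ?M = "\<lambda>i k. X k (xs ! i)"
    have "?M = ?M(i := ?M i')" using A by auto
    then show "?F xs = 0" using det4_equal_rows[of i i' ?M] A by simp
  qed
  from exterior_power_universal[OF ext4 vector_space_scalars this]
  obtain \<phi> where \<phi>: "Vector_Spaces.linear sM (*) \<phi>" "\<And>xs. length xs = 4 \<Longrightarrow> \<phi> (w4 xs) = ?F xs"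
    by (elim ex1E conjE) blast
  have "\<phi> (w4 [e 0, e 1, e 2, e 3]) = 1"
    by (subst \<phi>(2)) (simp_all add: det4_def X_e)
  then show nz: "w4 [e 0, e 1, e 2, e 3] \<noteq> 0" using M.functional_simps(3)[OF \<phi>(1)] by auto
  show "\<epsilon> \<noteq> 0"
  proof
    assume "\<epsilon> = 0"
    then have "UNIV = {0 :: 'm}" using gen by simp
    then show False using nz by blast
  qed
qed

lemmas beta_bilinear = wedge_form(1)[OF ext2 ext4 gen w4_nonzero(2)]
lemmas beta_w4 = wedge_form(2)[OF ext2 ext4 gen w4_nonzero(2)]

lemma beta_simps:
  "beta (y + y') z = beta y z + beta y' z" "beta (sL c y) z = c * beta y z"
  "beta y (z + z') = beta y z + beta y z'" "beta y (sL c z) = c * beta y z"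
  "beta (- y) z = - beta y z" "beta y (- z) = - beta y z"
  "beta (y - y') z = beta y z - beta y' z" "beta y (z - z') = beta y z - beta y z'"
proof -
  have 1: "L.functional (beta y)" for y using beta_bilinear by (simp add: bilinear_form_def)
  have 2: "L.functional (\<lambda>y. beta y z)" for z using beta_bilinear by (simp add: bilinear_form_def)
  show "beta (y + y') z = beta y z + beta y' z" "beta (sL c y) z = c * beta y z"
    "beta y (z + z') = beta y z + beta y z'" "beta y (sL c z) = c * beta y z"
    "beta (- y) z = - beta y z" "beta y (- z) = - beta y z"
    "beta (y - y') z = beta y z - beta y' z" "beta y (z - z') = beta y z - beta y z'"
    by (rule L.functional_simps[OF 1] L.functional_simps[OF 2])+
qed

text \<open>The volume of the frame in units of \<open>\<epsilon>\<close>. Keeping it as a factor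
  avoids normalising the frames constructed later.\<close>

definition kappa :: complex where "kappa = beta (E 0 1) (E 2 3)"

lemma beta_nondistinct: "\<not> distinct [a, b, c, d] \<Longrightarrow> beta (w2 [a, b]) (w2 [c, d]) = 0"
proof -
  assume "\<not> distinct [a, b, c, d]"
  then have "sM (beta (w2 [a, b]) (w2 [c, d])) \<epsilon> = 0" unfolding beta_w4 by (rule w4_nondistinct[rotated]) simp
  then show ?thesis using w4_nonzero(2) by simp
qed

text \<open>Expanding the vanishing product with \<open>b + c\<close> in both middle places shows
  that exchanging the middle vectors changes the sign.\<close>

lemma beta_swap: "beta (w2 [a, c]) (w2 [b, d]) = - beta (w2 [a, b]) (w2 [c, d])"
proof -
  note lin = alternating_quadrilinear[OF w4_alternating, unfolded Vector_Spaces.linear_iff]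
  have "w4 [a, b + c, b + c, d] = 0" by (rule w4_nondistinct) auto
  moreover have "w4 [a, b, b, d] = 0" "w4 [a, c, c, d] = 0" by (rule w4_nondistinct; simp)+
  ultimately have "w4 [a, b, c, d] + w4 [a, c, b, d] = 0"
    using lin(2)[of a "b + c" d] lin(3) by (metis (no_types, lifting) add.right_neutral add_0)
  then have "sM (beta (w2 [a, b]) (w2 [c, d]) + beta (w2 [a, c]) (w2 [b, d])) \<epsilon> = 0"
    by (simp add: beta_w4 M.scale_left_distrib)
  then have "beta (w2 [a, b]) (w2 [c, d]) + beta (w2 [a, c]) (w2 [b, d]) = 0"
    using w4_nonzero(2) by simp
  then show ?thesis by (simp add: eq_neg_iff_add_eq_0 add.commute)
qed

lemma kappa_nonzero: "kappa \<noteq> 0"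
  using beta_w4[of "e 0" "e 1" "e 2" "e 3"] w4_nonzero(1) by (auto simp: kappa_def)

lemma beta_formula:
  "beta y z = kappa * (pl 0 1 y * pl 2 3 z - pl 0 2 y * pl 1 3 z + pl 0 3 y * pl 1 2 z +
     pl 1 2 y * pl 0 3 z - pl 1 3 y * pl 0 2 z + pl 2 3 y * pl 0 1 z)"
proof -
  have flip1: "beta (w2 [b, a]) z = - beta (w2 [a, b]) z" for a b z
    by (subst w2_simps(6)) (simp add: beta_simps)
  have flip2: "beta z (w2 [b, a]) = - beta z (w2 [a, b])" for a b z
    by (subst w2_simps(6)) (simp add: beta_simps)
  have k: "beta (E 0 1) (E 2 3) = kappa" by (simp add: kappa_def)
  have k2: "beta (E 0 2) (E 1 3) = - kappa" using beta_swap[of "e 0" "e 2" "e 1" "e 3"] k by simp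
  have k3: "beta (E 0 3) (E 1 2) = kappa"
    using beta_swap[of "e 0" "e 3" "e 1" "e 2"] flip2[of "E 0 1" "e 3" "e 2"] k by simp
  have k4: "beta (E 1 2) (E 0 3) = kappa"
    using beta_swap[of "e 1" "e 2" "e 0" "e 3"] flip1[of "e 1" "e 0" "E 2 3"] k by simp
  have k5: "beta (E 1 3) (E 0 2) = - kappa"
    using beta_swap[of "e 1" "e 3" "e 0" "e 2"] flip1[of "e 1" "e 0" "w2 [e 3, e 2]"]
      flip2[of "E 0 1" "e 3" "e 2"] k by simp
  have k6: "beta (E 2 3) (E 0 1) = kappa"
    using beta_swap[of "e 2" "e 3" "e 0" "e 1"] flip1[of "e 2" "e 0" "w2 [e 3, e 1]"]
      flip2[of "E 0 2" "e 3" "e 1"] k2 by simp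
  have zs: "beta (E 0 1) (E 0 1) = 0" "beta (E 0 1) (E 0 2) = 0" "beta (E 0 1) (E 0 3) = 0" "beta (E 0 1) (E 1 2) = 0" "beta (E 0 1) (E 1 3) = 0"
    "beta (E 0 2) (E 0 1) = 0" "beta (E 0 2) (E 0 2) = 0" "beta (E 0 2) (E 0 3) = 0" "beta (E 0 2) (E 1 2) = 0" "beta (E 0 2) (E 2 3) = 0"
    "beta (E 0 3) (E 0 1) = 0" "beta (E 0 3) (E 0 2) = 0" "beta (E 0 3) (E 0 3) = 0" "beta (E 0 3) (E 1 3) = 0" "beta (E 0 3) (E 2 3) = 0"
    "beta (E 1 2) (E 0 1) = 0" "beta (E 1 2) (E 0 2) = 0" "beta (E 1 2) (E 1 2) = 0" "beta (E 1 2) (E 1 3) = 0" "beta (E 1 2) (E 2 3) = 0"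
    "beta (E 1 3) (E 0 1) = 0" "beta (E 1 3) (E 0 3) = 0" "beta (E 1 3) (E 1 2) = 0" "beta (E 1 3) (E 1 3) = 0" "beta (E 1 3) (E 2 3) = 0"
    "beta (E 2 3) (E 0 2) = 0" "beta (E 2 3) (E 0 3) = 0" "beta (E 2 3) (E 1 2) = 0" "beta (E 2 3) (E 1 3) = 0" "beta (E 2 3) (E 2 3) = 0"
    by (rule beta_nondistinct; simp)+
  show ?thesis
    by (subst L_expand[of y], subst L_expand[of z], simp only: beta_simps zs k k2 k3 k4 k5 k6)
      (simp add: algebra_simps)
qed

lemma beta_det: "beta (w2 [a, b]) (w2 [c, d]) = kappa * det4 (\<lambda>i k. X k ([a, b, c, d] ! i))"
  unfolding beta_formula by (simp add: pl det4_def algebra_simps)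

lemma beta_sym: "beta y z = beta z y"
  unfolding beta_formula by (simp add: algebra_simps)

lemma frame_from_beta:
  assumes "beta (w2 [a, b]) (w2 [c, d]) \<noteq> 0" obtains Y where "frame4 s ((!) [a, b, c, d]) Y"
  using frame_from_det[of "(!) [a, b, c, d]"] assms by (auto simp: beta_det)

end

subsection \<open>Hyperbolic triples come from bases\<close>

lemma rank_one:
  assumes "a * d = b * (c :: complex)"
  shows "\<exists>u0 u1 v2 v3. a = u0 * v2 \<and> b = u0 * v3 \<and> c = u1 * v2 \<and> d = u1 * v3"
proof (cases "a = 0")
  case False
  then have "d = c / a * b" using assms by (simp add: field_simps)
  with False show ?thesis by (intro exI[of _ 1] exI[of _ "c / a"] exI[of _ a] exI[of _ b]) simp
next
  case a: True
  show ?thesis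
  proof (cases "b = 0")
    case False
    then have "c = 0" using a assms by simp
    with a False show ?thesis by (intro exI[of _ 1] exI[of _ "d / b"] exI[of _ 0] exI[of _ b]) simp
  next
    case True
    with a show ?thesis by (intro exI[of _ 0] exI[of _ 1] exI[of _ c] exI[of _ d]) simp
  qed
qed

context ext_frame
begin

text \<open>Isotropy is the Pluecker relation. If the coordinate with indices \<open>a\<close>,
  \<open>b\<close> is nonzero, rows \<open>a\<close> and \<open>b\<close> of the antisymmetric
  coordinate matrix span the plane, and their wedge is \<open>y\<close> times that
  coordinate.\<close>

lemma decomposable:
  assumes "beta y y = 0" shows "\<exists>u v. y = w2 [u, v]"
proof (cases "\<exists>a<4. \<exists>b<4. pl a b y \<noteq> 0")
  case False
  then have "y = 0" using L_expand[of y] by simp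
  then show ?thesis using w2_simps(5) by metis
next
  case True
  then obtain a b where ab: "a < 4" "b < 4" "pl a b y \<noteq> 0" by blast
  have "kappa * (2 * (pl 0 1 y * pl 2 3 y - pl 0 2 y * pl 1 3 y + pl 0 3 y * pl 1 2 y)) = 0"
    using assms unfolding beta_formula by (simp add: algebra_simps)
  then have pf: "pl 0 1 y * pl 2 3 y - pl 0 2 y * pl 1 3 y + pl 0 3 y * pl 1 2 y = 0"
    using kappa_nonzero by (metis mult_eq_0_iff zero_neq_numeral)
  have neg: "pl 1 0 y = - pl 0 1 y" "pl 2 0 y = - pl 0 2 y" "pl 3 0 y = - pl 0 3 y"
    "pl 2 1 y = - pl 1 2 y" "pl 3 1 y = - pl 1 3 y" "pl 3 2 y = - pl 2 3 y"
    "pl 0 0 y = 0" "pl 1 1 y = 0" "pl 2 2 y = 0" "pl 3 3 y = 0"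
    by (simp_all add: pl_antisym[of 0 1] pl_antisym[of 0 2] pl_antisym[of 0 3] pl_antisym[of 1 2]
        pl_antisym[of 1 3] pl_antisym[of 2 3] pl_diag del: One_nat_def)
  define p where "p i k = pl i k y" for i k
  note pf' = pf[folded p_def] and neg' = neg[folded p_def]
  have pluecker: "p a i * p b k - p a k * p b i = p a b * p i k"
    if "(i, k) \<in> {(0, 1), (0, 2), (0, 3), (1, 2), (1, 3), (2, 3)}" for i k
  proof -
    have "i = 0 \<and> k = 1 \<or> i = 0 \<and> k = 2 \<or> i = 0 \<and> k = 3 \<or> i = 1 \<and> k = 2 \<or> i = 1 \<and> k = 3 \<or> i = 2 \<and> k = 3"
      using that by auto
    moreover have "p 0 1 * p 2 3 = p 0 2 * p 1 3 - p 0 3 * p 1 2"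
      using pf' by (simp add: algebra_simps del: One_nat_def)
    ultimately show ?thesis
      using ab(1,2) unfolding less_4_cases
      by (elim disjE conjE; simp add: neg' algebra_simps del: One_nat_def)
  qed
  define Y where "Y i = (\<Sum>m<4. s (p i m) (e m))" for i
  have XY: "X k (Y i) = p i k" if "k < 4" for i k
    using that unfolding Y_def by (simp add: functional_simps[OF X_functional[OF that]] X_e sum_4) (auto simp: less_4_cases)
  have "pl i k (w2 [s (1 / p a b) (Y a), Y b]) = pl i k y"
    if ik: "(i, k) \<in> {(0, 1), (0, 2), (0, 3), (1, 2), (1, 3), (2, 3)}" for i k
  proof -
    have lt: "i < 4" "k < 4" using ik by auto
    have "pl i k (w2 [s (1 / p a b) (Y a), Y b]) = (p a i * p b k - p a k * p b i) / p a b"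
      by (simp add: pl lt XY functional_simps[OF X_functional] diff_divide_distrib)
    also have "\<dots> = pl i k y" using pluecker[OF ik] ab(3) by (simp add: p_def)
    finally show ?thesis .
  qed
  then have "w2 [s (1 / p a b) (Y a), Y b] = y" by (intro L_eqI) blast+
  then show ?thesis by metis
qed

lemma hyperbolic_pair:
  assumes "beta y y = 0" "beta z z = 0" "beta y z \<noteq> 0"
  obtains f Y where "frame4 s f Y" "y = w2 [f 0, f 1]" "z = w2 [f 2, f 3]"
proof -
  obtain a b where y: "y = w2 [a, b]" using decomposable[OF assms(1)] by blast
  obtain c d where z: "z = w2 [c, d]" using decomposable[OF assms(2)] by blast
  obtain Y where "frame4 s ((!) [a, b, c, d]) Y" using frame_from_beta assms(3) unfolding y z by blast
  then show ?thesis using that[of "(!) [a, b, c, d]" Y] y z by simp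
qed

lemma E_pl: "beta y (E 0 1) = kappa * pl 2 3 y" "beta y (E 2 3) = kappa * pl 0 1 y"
  "beta y (E 0 2) = - kappa * pl 1 3 y" "beta y (E 1 3) = - kappa * pl 0 2 y"
  "beta y (E 0 3) = kappa * pl 1 2 y" "beta y (E 1 2) = kappa * pl 0 3 y"
  unfolding beta_formula by (simp_all add: pl X_e)

text \<open>Orthogonality to \<open>E 0 1\<close> and \<open>E 2 3\<close> leaves a 2 by 2 matrix of
  coordinates, and isotropy says that its determinant is 0. By \<open>rank_one\<close> the vector is
  a wedge of one vector from each of the two planes, so the new frame changes bases within these
  planes only.\<close>

lemma second_pair:
  assumes y: "beta y y = 0" "beta y (E 0 1) = 0" "beta y (E 2 3) = 0"
    and z: "beta z z = 0" "beta z (E 0 1) = 0" "beta z (E 2 3) = 0" and yz: "beta y z \<noteq> 0"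
  obtains f Y k l where "frame4 s f Y" "E 0 1 = sL k (w2 [f 0, f 1])" "E 2 3 = sL l (w2 [f 2, f 3])"
    "y = w2 [f 0, f 2]" "z = w2 [f 1, f 3]"
proof -
  have dec: "\<exists>u0 u1 v2 v3. y = w2 [s u0 (e 0) + s u1 (e 1), s v2 (e 2) + s v3 (e 3)]"
    if "beta y y = 0" "beta y (E 0 1) = 0" "beta y (E 2 3) = 0" for y
  proof -
    have 0: "pl 0 1 y = 0" "pl 2 3 y = 0" using that(2,3) kappa_nonzero unfolding E_pl by simp_all
    then have "kappa * (2 * (pl 0 2 y * pl 1 3 y - pl 0 3 y * pl 1 2 y)) = 0"
      using that(1) unfolding beta_formula by (simp add: algebra_simps) metis
    then have "pl 0 2 y * pl 1 3 y - pl 0 3 y * pl 1 2 y = 0"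
      using kappa_nonzero by (metis mult_eq_0_iff zero_neq_numeral)
    then have "pl 0 2 y * pl 1 3 y = pl 0 3 y * pl 1 2 y" by simp
    from rank_one[OF this] obtain u0 u1 v2 v3 where
      "pl 0 2 y = u0 * v2 \<and> pl 0 3 y = u0 * v3 \<and> pl 1 2 y = u1 * v2 \<and> pl 1 3 y = u1 * v3" by blast
    then have "y = w2 [s u0 (e 0) + s u1 (e 1), s v2 (e 2) + s v3 (e 3)]"
      using L_expand[of y] 0 by (simp add: w2_simps(1-4) mult.commute algebra_simps)
    then show ?thesis by blast
  qed
  obtain u0 u1 v2 v3 where y': "y = w2 [s u0 (e 0) + s u1 (e 1), s v2 (e 2) + s v3 (e 3)]" using dec[OF y] by blast
  obtain x0 x1 t2 t3 where z': "z = w2 [s x0 (e 0) + s x1 (e 1), s t2 (e 2) + s t3 (e 3)]" using dec[OF z] by blast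
  let ?u = "s u0 (e 0) + s u1 (e 1)" and ?v = "s v2 (e 2) + s v3 (e 3)"
  let ?x = "s x0 (e 0) + s x1 (e 1)" and ?t = "s t2 (e 2) + s t3 (e 3)"
  have ux: "w2 [?u, ?x] = sL (u0 * x1 - u1 * x0) (E 0 1)"
    using w2_simps(6)[of "e 0" "e 1"] by (simp add: w2_simps(1-5) algebra_simps)
  have vt: "w2 [?v, ?t] = sL (v2 * t3 - v3 * t2) (E 2 3)"
    using w2_simps(6)[of "e 2" "e 3"] by (simp add: w2_simps(1-5) algebra_simps)
  have nz: "beta (w2 [?u, ?x]) (w2 [?v, ?t]) \<noteq> 0"
    using yz beta_swap[of ?u ?v ?x ?t] unfolding y' z' by simp
  then have d: "u0 * x1 - u1 * x0 \<noteq> 0" "v2 * t3 - v3 * t2 \<noteq> 0" unfolding ux vt by (auto simp: beta_simps)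
  obtain Y where "frame4 s ((!) [?u, ?x, ?v, ?t]) Y" using frame_from_beta[OF nz] by blast
  moreover have n: "[?u, ?x, ?v, ?t] ! 0 = ?u" "[?u, ?x, ?v, ?t] ! 1 = ?x" "[?u, ?x, ?v, ?t] ! 2 = ?v"
    "[?u, ?x, ?v, ?t] ! 3 = ?t" by simp_all
  have "E 0 1 = sL (1 / (u0 * x1 - u1 * x0)) (w2 [[?u, ?x, ?v, ?t] ! 0, [?u, ?x, ?v, ?t] ! 1])"
    unfolding n ux using d(1) by (simp only: L.scale_scale) simp
  moreover have "E 2 3 = sL (1 / (v2 * t3 - v3 * t2)) (w2 [[?u, ?x, ?v, ?t] ! 2, [?u, ?x, ?v, ?t] ! 3])"
    unfolding n vt using d(2) by (simp only: L.scale_scale) simp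
  moreover have "y = w2 [[?u, ?x, ?v, ?t] ! 0, [?u, ?x, ?v, ?t] ! 2]" unfolding n by (rule y')
  moreover have "z = w2 [[?u, ?x, ?v, ?t] ! 1, [?u, ?x, ?v, ?t] ! 3]" unfolding n by (rule z')
  ultimately show ?thesis by (rule that)
qed

text \<open>Scaling the frame vectors by t0, t1, t2, t3 must give x1 = t0 t1, y1 = t2 t3 and so on,
  so the three products of opposite coefficients have to agree. Then t0^2 = x1 x2 / y3 determines
  the rest.\<close>

lemma rescaled_frame:
  assumes nz: "x1 \<noteq> 0" "x2 \<noteq> 0" "x3 \<noteq> 0" "y3 \<noteq> 0" and eq: "x1 * y1 = x3 * y3" "x2 * y2 = x3 * y3"
  obtains f Y where "frame4 s f Y" "sL x1 (E 0 1) = w2 [f 0, f 1]" "sL y1 (E 2 3) = w2 [f 2, f 3]"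
    "sL x2 (E 0 2) = w2 [f 0, f 2]" "sL y2 (w2 [e 3, e 1]) = w2 [f 3, f 1]"
    "sL x3 (E 0 3) = w2 [f 0, f 3]" "sL y3 (E 1 2) = w2 [f 1, f 2]"
proof -
  define t0 where "t0 = csqrt (x1 * x2 / y3)"
  have t0: "t0 * t0 = x1 * x2 / y3" unfolding t0_def by (simp flip: power2_eq_square)
  then have n0: "t0 \<noteq> 0" using nz by auto
  let ?f = "(!) [s t0 (e 0), s (x1 / t0) (e 1), s (x2 / t0) (e 2), s (x3 / t0) (e 3)]"
  have "det4 (\<lambda>i k. X k (?f i)) = t0 * (x1 / t0) * ((x2 / t0) * (x3 / t0))"
    by (simp add: det4_def functional_simps[OF X_functional] X_e)
  then have "det4 (\<lambda>i k. X k (?f i)) \<noteq> 0" using nz n0 by simp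
  then obtain Y where Y: "frame4 s ?f Y" using frame_from_det by blast
  have tt: "c / t0 * (d / t0) = c * d * y3 / (x1 * x2)" for c d
  proof -
    have "c / t0 * (d / t0) = c * d / (t0 * t0)" by simp
    then show ?thesis unfolding t0 by simp
  qed
  have "y1 = x3 * y3 / x1" "y2 = x3 * y3 / x2" using eq nz by (simp_all add: field_simps)
  then have "x2 / t0 * (x3 / t0) = y1" "x3 / t0 * (x1 / t0) = y2" "x1 / t0 * (x2 / t0) = y3"
    unfolding tt using nz by (simp_all add: field_simps)
  then show ?thesis using that[OF Y] n0 by (simp add: w2_simps(2,4) mult.commute)
qed

text \<open>\<open>p1\<close>, \<open>p2\<close>, \<open>p3\<close> span a maximal isotropic
  subspace. Either their planes share the vector \<open>f 0\<close>, or they all lie in the span of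
  \<open>f 1\<close>, \<open>f 2\<close>, \<open>f 3\<close>; then the \<open>q\<close> share
  \<open>f 0\<close>.\<close>

lemma hyperbolic_triple:
  assumes pp: "beta p1 p1 = 0" "beta p2 p2 = 0" "beta p3 p3 = 0" "beta p1 p2 = 0" "beta p1 p3 = 0" "beta p2 p3 = 0"
    and qq: "beta q1 q1 = 0" "beta q2 q2 = 0" "beta q3 q3 = 0" "beta q1 q2 = 0" "beta q1 q3 = 0" "beta q2 q3 = 0"
    and pq: "beta p1 q2 = 0" "beta p1 q3 = 0" "beta p2 q1 = 0" "beta p2 q3 = 0" "beta p3 q1 = 0" "beta p3 q2 = 0"
    and c: "beta p1 q1 = c" "beta p2 q2 = c" "beta p3 q3 = c" "c \<noteq> 0"
  shows "\<exists>f Y. frame4 s f Y \<and>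
    ((p1 = w2 [f 0, f 1] \<and> q1 = w2 [f 2, f 3] \<and> p2 = w2 [f 0, f 2] \<and> q2 = w2 [f 3, f 1] \<and>
      p3 = w2 [f 0, f 3] \<and> q3 = w2 [f 1, f 2]) \<or>
     (q1 = w2 [f 0, f 1] \<and> p1 = w2 [f 2, f 3] \<and> q2 = w2 [f 0, f 2] \<and> p2 = w2 [f 3, f 1] \<and>
      q3 = w2 [f 0, f 3] \<and> p3 = w2 [f 1, f 2]))"
proof -
  note sym = beta_sym
  obtain f Y where F: "frame4 s f Y" and p1: "p1 = w2 [f 0, f 1]" and q1: "q1 = w2 [f 2, f 3]"
    using hyperbolic_pair[OF pp(1) qq(1)] c by blast
  interpret F: ext_frame s sL sM w2 w4 \<epsilon> f Y by (intro ext_frame.intro ext_space_axioms F)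
  obtain g Z k l where G: "frame4 s g Z" and p1': "p1 = sL k (w2 [g 0, g 1])" and q1': "q1 = sL l (w2 [g 2, g 3])"
    and p2: "p2 = w2 [g 0, g 2]" and q2: "q2 = w2 [g 1, g 3]"
    by (rule F.second_pair[of p2 q2, folded p1 q1]) (use pp qq pq c sym in metis)+
  interpret G: ext_frame s sL sM w2 w4 \<epsilon> g Z by (intro ext_frame.intro ext_space_axioms G)
  have kl: "k * l * G.kappa = c" using c(1) unfolding p1' q1' by (simp add: beta_simps G.kappa_def mult_ac)
  then have nz: "k \<noteq> 0" "l \<noteq> 0" using c(4) by auto
  have mk: "- 1 * 1 * G.kappa = c"
    using c(2) unfolding p2 q2 by (simp add: G.beta_formula G.pl G.X_e)
  have z: "G.pl 0 1 y = 0 \<and> G.pl 2 3 y = 0 \<and> G.pl 0 2 y = 0 \<and> G.pl 1 3 y = 0"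
    if "beta y p1 = 0" "beta y q1 = 0" "beta y p2 = 0" "beta y q2 = 0" for y
    using that nz G.kappa_nonzero unfolding p1' q1' p2 q2 beta_simps G.E_pl by simp
  have zp: "G.pl 0 1 p3 = 0 \<and> G.pl 2 3 p3 = 0 \<and> G.pl 0 2 p3 = 0 \<and> G.pl 1 3 p3 = 0"
    by (rule z) (use pp pq sym in metis)+
  have zq: "G.pl 0 1 q3 = 0 \<and> G.pl 2 3 q3 = 0 \<and> G.pl 0 2 q3 = 0 \<and> G.pl 1 3 q3 = 0"
    by (rule z) (use qq pq sym in metis)+
  define a b a' b' where "a = G.pl 0 3 p3" "b = G.pl 1 2 p3" "a' = G.pl 0 3 q3" "b' = G.pl 1 2 q3"
  note ab = this
  have p3: "p3 = sL a (w2 [g 0, g 3]) + sL b (w2 [g 1, g 2])" using G.L_expand[of p3] zp by (simp add: ab)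
  have q3: "q3 = sL a' (w2 [g 0, g 3]) + sL b' (w2 [g 1, g 2])" using G.L_expand[of q3] zq by (simp add: ab)
  have "G.kappa * (2 * (a * b)) = 0" "G.kappa * (2 * (a' * b')) = 0"
    using pp(3) qq(3) zp zq unfolding G.beta_formula ab by (simp_all add: algebra_simps)
  then have "a * b = 0" "a' * b' = 0" using G.kappa_nonzero by simp_all
  moreover have cc: "G.kappa * (a * b' + b * a') = c"
    using c(3) zp zq unfolding G.beta_formula ab by simp
  moreover have "a * b' + b * a' \<noteq> 0" using cc c(4) by auto
  \<comment> \<open>\<open>p3\<close> and \<open>q3\<close> lie on the two isotropic lines of the
    hyperbolic plane left over by the first two pairs; which is on which decides the
    alternative.\<close>
  ultimately have "(b = 0 \<and> a' = 0 \<and> a \<noteq> 0 \<and> b' \<noteq> 0) \<or> (a = 0 \<and> b' = 0 \<and> b \<noteq> 0 \<and> a' \<noteq> 0)"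
    by auto
  then consider "b = 0" "a' = 0" "a \<noteq> 0" "b' \<noteq> 0" | "a = 0" "b' = 0" "b \<noteq> 0" "a' \<noteq> 0" by blast
  then show ?thesis
  proof cases
    case 1
    have ck: "c = G.kappa * (a * b')" using cc 1 by simp
    then have "G.kappa * (k * l) = G.kappa * (a * b')" "G.kappa * (1 * (- 1)) = G.kappa * (a * b')"
      using kl mk by (simp_all add: mult_ac)
    then have e1: "k * l = a * b'" "1 * (- 1) = a * b'" using G.kappa_nonzero by (simp_all only: mult_cancel_left) auto
    obtain h H where H: "frame4 s h H" "sL k (w2 [g 0, g 1]) = w2 [h 0, h 1]" "sL l (w2 [g 2, g 3]) = w2 [h 2, h 3]"
      "sL 1 (w2 [g 0, g 2]) = w2 [h 0, h 2]" "sL (- 1) (w2 [g 3, g 1]) = w2 [h 3, h 1]"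
      "sL a (w2 [g 0, g 3]) = w2 [h 0, h 3]" "sL b' (w2 [g 1, g 2]) = w2 [h 1, h 2]"
      by (rule G.rescaled_frame[OF nz(1) one_neq_zero 1(3,4) e1])
    have "w2 [g 1, g 3] = sL (- 1) (w2 [g 3, g 1])" using w2_simps(6)[of "g 1" "g 3"] by simp
    then show ?thesis using H 1 p1' q1' p2 q2 p3 q3 by (intro exI[of _ h] exI[of _ H]) simp
  next
    case 2
    \<comment> \<open>Reversing the frame exchanges the roles of the \<open>p\<close> and the
      \<open>q\<close>, at the cost of signs that the rescaling absorbs.\<close>
    let ?r = "(!) [g 3, g 2, g 1, g 0]"
    have "det4 (\<lambda>i k. Z k (?r i)) \<noteq> 0" by (simp add: det4_def G.X_e)
    then obtain Z' where R: "frame4 s ?r Z'" using G.frame_from_det by blast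
    interpret R: ext_frame s sL sM w2 w4 \<epsilon> ?r Z' by (intro ext_frame.intro ext_space_axioms R)
    have ck: "c = G.kappa * (a' * b)" using cc 2 by (simp add: mult_ac)
    then have "G.kappa * ((- l) * (- k)) = G.kappa * ((- a') * (- b))" "G.kappa * ((- 1) * 1) = G.kappa * ((- a') * (- b))"
      using kl mk by (simp_all add: mult_ac)
    then have e2: "(- l) * (- k) = (- a') * (- b)" "(- 1) * 1 = (- a') * (- b)"
      using G.kappa_nonzero by (simp_all only: mult_cancel_left) auto
    have n: "- l \<noteq> 0" "- 1 \<noteq> (0::complex)" "- a' \<noteq> 0" "- b \<noteq> 0" using nz 2 by auto
    have r: "?r 0 = g 3" "?r 1 = g 2" "?r 2 = g 1" "?r 3 = g 0" by simp_all
    obtain h H where H0: "frame4 s h H" "sL (- l) (w2 [?r 0, ?r 1]) = w2 [h 0, h 1]"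
      "sL (- k) (w2 [?r 2, ?r 3]) = w2 [h 2, h 3]" "sL (- 1) (w2 [?r 0, ?r 2]) = w2 [h 0, h 2]"
      "sL 1 (w2 [?r 3, ?r 1]) = w2 [h 3, h 1]" "sL (- a') (w2 [?r 0, ?r 3]) = w2 [h 0, h 3]"
      "sL (- b) (w2 [?r 1, ?r 2]) = w2 [h 1, h 2]"
      by (rule R.rescaled_frame[OF n e2])
    note H = H0[unfolded r]
    have "q1 = w2 [h 0, h 1]" "p1 = w2 [h 2, h 3]" "q2 = w2 [h 0, h 2]" "p2 = w2 [h 3, h 1]"
      "q3 = w2 [h 0, h 3]" "p3 = w2 [h 1, h 2]"
      unfolding H(2-7)[symmetric] using 2 p1' q1' p2 q2 p3 q3 w2_simps(6)[of "g 2" "g 3"] w2_simps(6)[of "g 0" "g 1"]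
        w2_simps(6)[of "g 1" "g 3"] w2_simps(6)[of "g 0" "g 3"] w2_simps(6)[of "g 1" "g 2"] by simp_all
    then show ?thesis using H(1) by blast
  qed
qed

end

section \<open>Normal form of the simple roots of type E6\<close>

context ext_space
begin

abbreviation "Lam \<equiv> ext_square_map sL w2"

text \<open>\<open>simple_root\<close> over an arbitrary frame and cube root of unity
  \<open>v\<close>, with \<open>t\<close> a square root of -3. The factor 3 clears denominators, and
  the order \<open>f 3\<close>, \<open>f 1\<close> makes the three hyperbolic planes alike.\<close>

definition e6_coordinates :: "complex \<Rightarrow> (nat \<Rightarrow> 'v) \<Rightarrow> (nat \<Rightarrow> 'l) \<Rightarrow> bool" where
  "e6_coordinates v f a \<longleftrightarrow> (let t = 2 * v + 1 in
     sL 3 (a 1) = sL t (w2 [f 0, f 1]) - sL t (w2 [f 2, f 3]) \<and>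
     sL 3 (a 2) = sL (t * v) (w2 [f 0, f 3]) - sL (t * (v * v)) (w2 [f 1, f 2]) \<and>
     sL 3 (a 3) = sL (t * v) (w2 [f 0, f 1]) - sL (t * (v * v)) (w2 [f 2, f 3]) \<and>
     sL 3 (a 4) = w2 [f 0, f 1] + w2 [f 0, f 2] + w2 [f 0, f 3] + w2 [f 1, f 2] + w2 [f 3, f 1] + w2 [f 2, f 3] \<and>
     sL 3 (a 5) = sL (t * v) (w2 [f 0, f 2]) - sL (t * (v * v)) (w2 [f 3, f 1]) \<and>
     sL 3 (a 6) = sL t (w2 [f 0, f 2]) - sL t (w2 [f 3, f 1]))"

end

lemma (in ext_frame) e6_normal_form:
  assumes w: "w * w = - w - 1" and c: "c \<noteq> 0"
    and b: "\<And>i k. i \<in> {1..6} \<Longrightarrow> k \<in> {1..6} \<Longrightarrow> beta (a i) (a k) = c * of_int (cartan_E6 i k)"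
  obtains f Y v where "frame4 s f Y" "v = w \<or> v = w * w" "e6_coordinates v f a"
proof -
  define a1 a2 a3 a4 a5 a6 where "a1 = a 1" "a2 = a 2" "a3 = a 3" "a4 = a 4" "a5 = a 5" "a6 = a 6"
  note as = this
  have bs: "beta a1 a1 = 2 * c" "beta a1 a2 = 0" "beta a1 a3 = - c" "beta a1 a4 = 0" "beta a1 a5 = 0" "beta a1 a6 = 0"
    "beta a2 a1 = 0" "beta a2 a2 = 2 * c" "beta a2 a3 = 0" "beta a2 a4 = - c" "beta a2 a5 = 0" "beta a2 a6 = 0"
    "beta a3 a1 = - c" "beta a3 a2 = 0" "beta a3 a3 = 2 * c" "beta a3 a4 = - c" "beta a3 a5 = 0" "beta a3 a6 = 0"
    "beta a4 a1 = 0" "beta a4 a2 = - c" "beta a4 a3 = - c" "beta a4 a4 = 2 * c" "beta a4 a5 = - c" "beta a4 a6 = 0"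
    "beta a5 a1 = 0" "beta a5 a2 = 0" "beta a5 a3 = 0" "beta a5 a4 = - c" "beta a5 a5 = 2 * c" "beta a5 a6 = - c"
    "beta a6 a1 = 0" "beta a6 a2 = 0" "beta a6 a3 = 0" "beta a6 a4 = 0" "beta a6 a5 = - c" "beta a6 a6 = 2 * c"
    unfolding as by (subst b; simp add: cartan_E6_def doubleton_eq_iff)+
  \<comment> \<open>The highest root minus \<open>sL 2 a2\<close>. Removing node 4 from the extended
    Dynkin diagram leaves three orthogonal systems A2, and the third is spanned by \<open>a2\<close>
    and the highest root.\<close>
  define g where "g = sL 3 a4 + a1 + sL 2 a3 + a6 + sL 2 a5"
  have gs: "beta g a1 = 0" "beta g a3 = 0" "beta g a5 = 0" "beta g a6 = 0" "beta g a2 = - 3 * c"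
    "beta a1 g = 0" "beta a3 g = 0" "beta a5 g = 0" "beta a6 g = 0" "beta a2 g = - 3 * c"
    unfolding g_def beta_simps bs by simp_all
  have gg: "beta g g = 6 * c"
    by (subst (2) g_def) (simp only: beta_simps gs, simp add: g_def beta_simps bs)
  have w': "w * (w * x) = - (w * x) - x" for x
    using arg_cong[OF w, of "\<lambda>z. z * x"] by (simp add: algebra_simps)
  define t where "t = 2 * w + 1"
  have tt: "t * t = - 3"
  proof -
    have "t * t = 4 * (w * w) + 4 * w + 1" by (simp add: t_def algebra_simps)
    then show ?thesis unfolding w by (simp add: algebra_simps)
  qed
  \<comment> \<open>The two isotropic lines in each of the three planes, scaled so that all three
    pairings equal \<open>3 * c\<close>.\<close>
  define P1 Q1 P2 Q2 P3 Q3 where "P1 = sL (w * w) a1 - a3" and "Q1 = sL w a1 - a3"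
    and "P2 = sL (w * w) a6 - a5" and "Q2 = sL w a6 - a5"
    and "P3 = sL t a2 - sL (w * w) g" and "Q3 = - sL t a2 - sL w g"
  note pq = this
  have "\<exists>f Y. frame4 s f Y \<and>
    ((P1 = w2 [f 0, f 1] \<and> Q1 = w2 [f 2, f 3] \<and> P2 = w2 [f 0, f 2] \<and> Q2 = w2 [f 3, f 1] \<and>
      P3 = w2 [f 0, f 3] \<and> Q3 = w2 [f 1, f 2]) \<or>
     (Q1 = w2 [f 0, f 1] \<and> P1 = w2 [f 2, f 3] \<and> Q2 = w2 [f 0, f 2] \<and> P2 = w2 [f 3, f 1] \<and>
      Q3 = w2 [f 0, f 3] \<and> P3 = w2 [f 1, f 2]))"
  proof (rule hyperbolic_triple[where c = "3 * c"])
    show "3 * c \<noteq> 0" using c by simp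
  qed (unfold pq beta_simps bs gs gg, (simp add: t_def algebra_simps w w')+)
  then obtain f Y where F: "frame4 s f Y" and cases: "(P1 = w2 [f 0, f 1] \<and> Q1 = w2 [f 2, f 3] \<and> P2 = w2 [f 0, f 2] \<and> Q2 = w2 [f 3, f 1] \<and>
      P3 = w2 [f 0, f 3] \<and> Q3 = w2 [f 1, f 2]) \<or>
     (Q1 = w2 [f 0, f 1] \<and> P1 = w2 [f 2, f 3] \<and> Q2 = w2 [f 0, f 2] \<and> P2 = w2 [f 3, f 1] \<and>
      Q3 = w2 [f 0, f 3] \<and> P3 = w2 [f 1, f 2])" by blast
  have k: "t * (w * w) - t * w = 3" "t * w * (w * w) - t * (w * w) * w = 0" "t * (w * w) - t * w = 3"
    "t * w * t + t * (w * w) * t = 3" "w * w + w = - 1"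
    by (simp_all add: t_def algebra_simps w w')
  have 1: "sL t (sL (w * w) x - y) - sL t (sL w x - y) = sL 3 x" for x y
  proof -
    have "sL t (sL (w * w) x - y) - sL t (sL w x - y) = sL (t * (w * w) - t * w) x"
      by (simp add: algebra_simps)
    then show ?thesis unfolding k .
  qed
  have 2: "sL (t * w) (sL (w * w) x - y) - sL (t * (w * w)) (sL w x - y) = sL 3 y" for x y
  proof -
    have "sL (t * w) (sL (w * w) x - y) - sL (t * (w * w)) (sL w x - y) =
        sL (t * w * (w * w) - t * (w * w) * w) x + sL (t * (w * w) - t * w) y"
      by (simp add: algebra_simps)
    then show ?thesis unfolding k by simp
  qed
  have 3: "sL (t * w) P3 - sL (t * (w * w)) Q3 = sL 3 a2"
  proof -
    have "sL (t * w) P3 - sL (t * (w * w)) Q3 =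
        sL (t * w * t + t * (w * w) * t) a2 - sL (t * w * (w * w) - t * (w * w) * w) g"
      by (simp add: pq algebra_simps)
    then show ?thesis unfolding k by simp
  qed
  have two: "sL 2 x = x + x" for x using L.scale_left_distrib[of 1 1 x] by simp
  have 4: "P1 + P2 + P3 + Q3 + Q2 + Q1 = sL 3 a4"
  proof -
    have "P1 + P2 + P3 + Q3 + Q2 + Q1 = sL (w * w + w) (a1 + a6 - g) - sL 2 a3 - sL 2 a5"
      by (simp add: pq algebra_simps two)
    then show ?thesis unfolding k by (simp add: g_def algebra_simps two)
  qed
  have n: "sL 3 a1 = sL t P1 - sL t Q1" "sL 3 a3 = sL (t * w) P1 - sL (t * (w * w)) Q1"
    "sL 3 a6 = sL t P2 - sL t Q2" "sL 3 a5 = sL (t * w) P2 - sL (t * (w * w)) Q2"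
    unfolding pq 1 2 by simp_all
  from cases show ?thesis
  proof
    assume A: "P1 = w2 [f 0, f 1] \<and> Q1 = w2 [f 2, f 3] \<and> P2 = w2 [f 0, f 2] \<and> Q2 = w2 [f 3, f 1] \<and>
      P3 = w2 [f 0, f 3] \<and> Q3 = w2 [f 1, f 2]"
    have "e6_coordinates w f a"
      unfolding e6_coordinates_def Let_def t_def[symmetric] as[symmetric]
      unfolding n 3[symmetric] 4[symmetric] using A by simp
    then show ?thesis using that[OF F] by blast
  next
    assume A: "Q1 = w2 [f 0, f 1] \<and> P1 = w2 [f 2, f 3] \<and> Q2 = w2 [f 0, f 2] \<and> P2 = w2 [f 3, f 1] \<and>
      Q3 = w2 [f 0, f 3] \<and> P3 = w2 [f 1, f 2]"
    \<comment> \<open>Exchanging the \<open>P\<close> and the \<open>Q\<close> amounts to replacing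
      \<open>w\<close> by its square, which changes the sign of \<open>t\<close>.\<close>
    have c1: "2 * (w * w) + 1 = - t" "- t * (w * w * (w * w)) = - (t * w)" "- t * (w * w) = - (t * (w * w))"
      by (simp_all add: t_def algebra_simps w w')
    have "e6_coordinates (w * w) f a"
      unfolding e6_coordinates_def Let_def as[symmetric] c1
      unfolding n 3[symmetric] 4[symmetric] using A by (simp add: add_ac)
    then show ?thesis using that[OF F] by blast
  qed
qed

section \<open>Functoriality and kernel of the exterior square\<close>

context ext_space
begin

lemma Lam_linear: "Vector_Spaces.linear s s g \<Longrightarrow> Vector_Spaces.linear sL sL (Lam g)"
  and Lam_w2: "Vector_Spaces.linear s s g \<Longrightarrow> Lam g (w2 [a, b]) = w2 [g a, g b]"
  using ext_square_map[OF ext2] by blast+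

lemma compose_linear:
  "Vector_Spaces.linear s s f \<Longrightarrow> Vector_Spaces.linear s s g \<Longrightarrow> Vector_Spaces.linear s s (f \<circ> g)"
  "Vector_Spaces.linear sL sL h \<Longrightarrow> Vector_Spaces.linear sL sL k \<Longrightarrow> Vector_Spaces.linear sL sL (h \<circ> k)"
  by (rule Vector_Spaces.linear_compose; assumption)+

lemma Lam_eqI:
  assumes "Vector_Spaces.linear s s g" "Vector_Spaces.linear sL sL h"
    "\<And>a b. w2 [g a, g b] = h (w2 [a, b])"
  shows "Lam g = h"
  by (rule linear_eq_on_wedges[OF ext2 Lam_linear[OF assms(1)] assms(2)])
    (simp only: Lam_w2[OF assms(1)] assms(3))

lemma Lam_comp:
  assumes "Vector_Spaces.linear s s g" "Vector_Spaces.linear s s h"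
  shows "Lam (g \<circ> h) = Lam g \<circ> Lam h"
  by (rule Lam_eqI) (auto simp: Lam_w2 assms intro!: Vector_Spaces.linear_compose Lam_linear assms)

lemma linear_scalars: "Vector_Spaces.linear s s (s c)" "Vector_Spaces.linear sL sL (sL c)"
  by (simp_all add: Vector_Spaces.linear_iff vector_space_axioms vector_space_L
      scale_right_distrib scale_left_commute L.scale_right_distrib L.scale_left_commute)

lemma Lam_scalar: "Lam (s c) = sL (c * c)"
  by (rule Lam_eqI) (auto simp: linear_scalars w2_simps(2,4))

lemma Lam_id: "Lam id = id"
  by (rule Lam_eqI) (auto simp: Vector_Spaces.linear_iff vector_space_axioms vector_space_L)

lemma Lam_GL:
  assumes "g \<in> carrier (GL s)" "h \<circ> g = id" "g \<circ> h = id" "Vector_Spaces.linear s s h"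
  shows "Lam g \<in> carrier (GL sL)" "Lam h \<circ> Lam g = id" "Lam g \<circ> Lam h = id"
proof -
  have g: "Vector_Spaces.linear s s g" using assms(1) by (simp add: GL_def)
  show 1: "Lam h \<circ> Lam g = id" "Lam g \<circ> Lam h = id"
    using Lam_comp[OF assms(4) g] Lam_comp[OF g assms(4)] assms(2,3) Lam_id by simp_all
  then show "Lam g \<in> carrier (GL sL)" using Lam_linear[OF g] o_bij[OF 1] by (simp add: GL_def)
qed

end

lemma other_index: "\<exists>m<4. m \<noteq> i \<and> m \<noteq> (l::nat)"
  by (rule exI[of _ "if i \<noteq> 0 \<and> l \<noteq> 0 then 0 else if i \<noteq> 1 \<and> l \<noteq> 1 then 1 else 2"]) auto

text \<open>The 2 by 2 minors of the matrix of \<open>g\<close> are those of the identity. Combining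
  them kills the off-diagonal entries, and then any two diagonal entries have product 1, so they are
  all equal to the same sign.\<close>

lemma (in ext_frame) Lam_kernel:
  assumes g: "Vector_Spaces.linear s s g" and "Lam g = id"
  shows "g = id \<or> g = s (- 1)"
proof -
  have w: "w2 [g a, g b] = w2 [a, b]" for a b using Lam_w2[OF g, of a b] assms(2) by simp
  define M where "M i m = X m (g (e i))" for i m
  have pM: "M i a * M l b - M i b * M l a = X a (e i) * X b (e l) - X b (e i) * X a (e l)"
    if "a < 4" "b < 4" for i l a b
    using arg_cong[OF w[of "e i" "e l"], of "pl a b"] that by (simp add: pl M_def)
  have off: "M i m = 0" if "i < 4" "m < 4" "l < 4" "i \<noteq> m" "l \<noteq> i" "l \<noteq> m" for i m l
  proof -
    have eqs: "M i i * M l l - M i l * M l i = 1" "M i i * M l m - M i m * M l i = 0"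
      "M i l * M l m - M i m * M l l = 0"
      using pM[of i l i l] pM[of i m i l] pM[of l m i l] that by (simp_all add: X_e)
    have "M i m * (M i i * M l l - M i l * M l i) =
        M i l * (M i i * M l m - M i m * M l i) - M i i * (M i l * M l m - M i m * M l l)"
      by (simp add: algebra_simps)
    then show ?thesis unfolding eqs by simp
  qed
  have dg: "M i i * M l l = 1" if "i < 4" "l < 4" "i \<noteq> l" for i l
  proof -
    obtain m where "m < 4" "m \<noteq> i" "m \<noteq> l" using other_index by blast
    then have "M i l = 0" using off[of i l m] that by blast
    then show ?thesis using pM[of i l i l] that by (simp add: X_e)
  qed
  have m: "M i m = 0" if "i < 4" "m < 4" "i \<noteq> m" for i m
  proof -
    obtain l where "l < 4" "l \<noteq> i" "l \<noteq> m" using other_index by blast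
    then show ?thesis using off[of i m l] that by blast
  qed
  define t where "t = M 0 0"
  have d: "t * M 1 1 = 1" "t * M 2 2 = 1" "t * M 3 3 = 1" "M 1 1 * M 2 2 = 1"
    unfolding t_def by (rule dg; simp)+
  have m1: "M 1 1 = t" using d(2,4) by (metis mult.commute mult.left_commute mult.right_neutral)
  then have tt: "t * t = 1" using d(1) by simp
  have m2: "M 2 2 = t" using d(2) tt by (metis mult.assoc mult_1)
  have m3: "M 3 3 = t" using d(3) tt by (metis mult.assoc mult_1)
  note ms = m1 m2 m3
  have di: "M i i = t" if "i < 4" for i using that unfolding less_4_cases using ms by (auto simp: t_def)
  have "g v = s t v" for v
  proof (rule vector_eqI)
    show "\<And>i. i < 4 \<Longrightarrow> X i (g v) = X i (s t v)"
    proof -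
      fix i :: nat assume i: "i < 4"
      have "g v = (\<Sum>k<4. s (X k v) (g (e k)))"
        using expand[of v] module_hom.sum[OF module_hom_linearI[OF g]] module_hom.scale[OF module_hom_linearI[OF g]]
        by (metis (no_types, lifting) sum.cong)
      then have "X i (g v) = (\<Sum>k<4. X k v * M k i)"
        by (simp add: functional_simps[OF X_functional[OF i]] M_def)
      also have "\<dots> = (\<Sum>k<4. if k = i then X k v * t else 0)"
        using m[OF _ i] di[OF i] by (intro sum.cong) auto
      also have "\<dots> = X i (s t v)" using i by (simp add: functional_simps[OF X_functional[OF i]] mult.commute)
      finally show "X i (g v) = X i (s t v)" .
    qed
  qed
  moreover have "t = 1 \<or> t = - 1" using tt by (simp add: square_eq_1_iff)
  ultimately show ?thesis by (auto simp: fun_eq_iff)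
qed

section \<open>The preimage of the rotation subgroup of the Weyl group\<close>

locale witting_ext = ext_frame s sL sM w2 w4 \<epsilon> e X + witting_frame s e X w
  for s :: "complex \<Rightarrow> 'v::ab_group_add \<Rightarrow> 'v"
    and sL :: "complex \<Rightarrow> 'l::ab_group_add \<Rightarrow> 'l" and sM :: "complex \<Rightarrow> 'm::ab_group_add \<Rightarrow> 'm"
    and w2 :: "'v list \<Rightarrow> 'l" and w4 :: "'v list \<Rightarrow> 'm" and \<epsilon> :: 'm and e X w
begin

fun K :: "vec6 \<Rightarrow> 'l" where
  "K (Vec6 a b c d f g) = sL (ev a) (E 0 1) + sL (ev b) (E 0 2) + sL (ev c) (E 0 3) +
     sL (ev d) (E 1 2) + sL (ev f) (E 1 3) + sL (ev g) (E 2 3)"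

lemma K_add: "K (add6 x y) = K x + K y"
  by (cases x; cases y) (simp add: algebra_simps)

lemma K_scale: "K (scale6 c x) = sL (ev c) (K x)"
  by (cases x) (simp add: algebra_simps)

lemma K_wedge: "K (wedge6 a b) = w2 [vec a, vec b]"
  using w2_simps(6)[of "e 0" "e (Suc 0)"] w2_simps(6)[of "e 0" "e 2"] w2_simps(6)[of "e 0" "e 3"]
    w2_simps(6)[of "e (Suc 0)" "e 2"] w2_simps(6)[of "e (Suc 0)" "e 3"] w2_simps(6)[of "e 2" "e 3"]
  by (cases a; cases b) (simp add: w2_simps(1-5) algebra_simps)

lemma push6_K:
  assumes "exact6 a y" shows "Lam (refl a) (K y) = K (push6 a y)"
proof -
  define A where "A = vec a"
  define \<kappa> where "\<kappa> i = (w - 1) / 3 * ev (coord4 (conj4 a) i)" for i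
  have r: "refl a (e i) = e i + s (\<kappa> i) A" if "i < 4" for i
    using form_e[OF that, of "conj4 a"] by (simp add: refl_def A_def \<kappa>_def)
  have L: "Lam (refl a) (x + y) = Lam (refl a) x + Lam (refl a) y" "Lam (refl a) (sL c x) = sL c (Lam (refl a) x)" for x y c
    using Lam_linear[OF linear_refl[of a]] by (simp_all add: Vector_Spaces.linear_iff)
  have LE: "Lam (refl a) (E i k) = E i k + sL (\<kappa> i) (w2 [A, e k]) - sL (\<kappa> k) (w2 [A, e i])"
    if "i < 4" "k < 4" for i k
    using w2_simps(6)[of A "e i"] by (simp add: Lam_w2[OF linear_refl] r that w2_simps(1-5) algebra_simps)
  have "K (scale6 3 (third6 (push_increment a y))) = K (push_increment a y)"
    using assms by (simp add: exact6_def)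
  then have "sL (1 / 3) (sL 3 (K (third6 (push_increment a y)))) = sL (1 / 3) (K (push_increment a y))"
    by (simp add: K_scale)
  then have inc: "K (third6 (push_increment a y)) = sL (1 / 3) (K (push_increment a y))" by simp
  have "K (push6 a y) = K y + sL ((w - 1) / 3) (w2 [A, vec (contract6 (conj4 a) y)])"
  proof -
    have "K (push6 a y) = K y + sL (1 / 3) (K (push_increment a y))" by (simp only: push6_def K_add inc)
    also have "K (push_increment a y) = sL (w - 1) (w2 [A, vec (contract6 (conj4 a) y)])"
      by (simp add: push_increment_def K_scale K_wedge A_def)
    finally show ?thesis by simp
  qed
  also have "\<dots> = Lam (refl a) (K y)"
  proof -
    obtain a0 a1 a2 a3 where a: "conj4 a = Vec4 a0 a1 a2 a3" by (cases "conj4 a")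
    have \<kappa>s: "\<kappa> 0 = (w - 1) / 3 * ev a0" "\<kappa> 1 = (w - 1) / 3 * ev a1" "\<kappa> 2 = (w - 1) / 3 * ev a2"
      "\<kappa> 3 = (w - 1) / 3 * ev a3" by (simp_all add: \<kappa>_def a)
    define q where "q = (w - 1) / 3"
    obtain b c d f g h where y: "y = Vec6 b c d f g h" by (cases y)
    have "Lam (refl a) (K y) = sL (ev b) (Lam (refl a) (E 0 1)) + sL (ev c) (Lam (refl a) (E 0 2)) +
        sL (ev d) (Lam (refl a) (E 0 3)) + sL (ev f) (Lam (refl a) (E 1 2)) +
        sL (ev g) (Lam (refl a) (E 1 3)) + sL (ev h) (Lam (refl a) (E 2 3))"
      unfolding y K.simps L ..
    also have "\<dots> = K y + sL q (w2 [A, vec (contract6 (conj4 a) y)])"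
      unfolding a y contract6.simps vec.simps K.simps w2_simps(3,4) ev_hom
      by (subst LE; (simp; fail)?)+ (simp add: \<kappa>s[folded q_def] \<kappa>s(2)[folded q_def, unfolded One_nat_def] algebra_simps)
    finally show ?thesis by (simp add: q_def)
  qed
  finally show ?thesis by simp
qed

context
  fixes \<alpha> :: "nat \<Rightarrow> 'l" and r :: "nat \<Rightarrow> 'l \<Rightarrow> 'l" and j :: complex
  assumes roots: "\<And>i. i \<in> {1..6} \<Longrightarrow> sL 3 (\<alpha> i) = K (simple_root i)"
    and span: "L.span (\<alpha> ` {1..6}) = UNIV"
    and r_GL: "\<And>i. i \<in> {1..6} \<Longrightarrow> r i \<in> carrier (GL sL)"
    and r_root: "\<And>i k. i \<in> {1..6} \<Longrightarrow> k \<in> {1..6} \<Longrightarrow> r i (\<alpha> k) = \<alpha> k - sL (of_int (cartan_E6 i k)) (\<alpha> i)"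
    and j: "j = w \<or> j = w * w"
begin

section \<open>Simple reflections and the derived subgroup\<close>

abbreviation "weyl \<equiv> generate (GL sL) (r ` {1..6})"
abbreviation "target \<equiv> generate (GL sL) (derived (GL sL) weyl \<union> {sL j})"

lemma r_linear: "i \<in> {1..6} \<Longrightarrow> Vector_Spaces.linear sL sL (r i)"
  using r_GL by (simp add: GL_def)

lemma r_simps:
  assumes "i \<in> {1..6}"
  shows "r i (x - y) = r i x - r i y" "r i (sL c x) = sL c (r i x)"
  using module_hom.diff[OF module_hom_linearI[OF r_linear[OF assms]]]
    module_hom.scale[OF module_hom_linearI[OF r_linear[OF assms]]] by blast+

lemma eq_on_roots:
  assumes "Vector_Spaces.linear sL sL f" "Vector_Spaces.linear sL sL g"
    "\<And>l. l \<in> {1..6} \<Longrightarrow> f (\<alpha> l) = g (\<alpha> l)"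
  shows "f = g"
proof
  fix x
  interpret V: vector_space_pair sL sL using vector_space_L by (simp add: vector_space_pair_def)
  show "f x = g x"
    by (rule V.linear_eq_on[OF assms(1,2), of x "\<alpha> ` {1..6}"]) (use span assms(3) in auto)
qed

lemma r_involution: "i \<in> {1..6} \<Longrightarrow> r i \<circ> r i = id"
proof (rule eq_on_roots)
  assume i: "i \<in> {1..6}"
  show "Vector_Spaces.linear sL sL (r i \<circ> r i)" by (intro compose_linear r_linear i)
  show "Vector_Spaces.linear sL sL id" by (simp add: Vector_Spaces.linear_iff vector_space_L)
  fix l :: nat assume l: "l \<in> {1..6}"
  have "cartan_E6 i i = 2" by (simp add: cartan_E6_def)
  then have "r i (\<alpha> i) = - \<alpha> i" using L.scale_left_distrib[of 1 1 "\<alpha> i"] by (simp add: r_root[OF i i])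
  then show "(r i \<circ> r i) (\<alpha> l) = id (\<alpha> l)" by (simp add: r_root[OF i l] r_simps[OF i])
qed

lemma inv_r: "i \<in> {1..6} \<Longrightarrow> inv\<^bsub>GL sL\<^esub> (r i) = r i"
  by (rule group.inv_equality[OF L.group_GL]) (auto simp: GL_simps(1,2) r_involution r_GL)

lemma edge_cases: "(k, i) \<in> set edges \<Longrightarrow> k \<in> {1..6} \<and> i \<in> {1..6} \<and> cartan_E6 k i = - 1 \<and> cartan_E6 i k = - 1"
  by (auto simp: edges_def cartan_E6_def)

text \<open>For adjacent nodes r_i r_k has order 3, so the commutator of r_i and r_k is r_k r_i.
  This places products along edges in the derived subgroup.\<close>

lemma edge_commutator:
  assumes "(k, i) \<in> set edges" shows "r i \<circ> r k \<circ> r i \<circ> r k = r k \<circ> r i"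
proof (rule eq_on_roots)
  note k = edge_cases[OF assms, THEN conjunct1] and i = edge_cases[OF assms, THEN conjunct2, THEN conjunct1]
  have c: "cartan_E6 k i = - 1" "cartan_E6 i k = - 1" using edge_cases[OF assms] by auto
  show "Vector_Spaces.linear sL sL (r i \<circ> r k \<circ> r i \<circ> r k)" "Vector_Spaces.linear sL sL (r k \<circ> r i)"
    by (intro compose_linear r_linear i k)+
  fix l :: nat assume l: "l \<in> {1..6}"
  have d: "cartan_E6 i i = 2" "cartan_E6 k k = 2" by (simp_all add: cartan_E6_def)
  have two: "sL 2 x = x + x" for x using L.scale_left_distrib[of 1 1 x] by simp
  have v: "r i (\<alpha> i) = - \<alpha> i" "r k (\<alpha> k) = - \<alpha> k" "r i (\<alpha> k) = \<alpha> k + \<alpha> i" "r k (\<alpha> i) = \<alpha> i + \<alpha> k"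
    by (simp_all add: r_root[OF i i] r_root[OF k k] r_root[OF i k] r_root[OF k i] c d two)
  have add: "r m (x + y) = r m x + r m y" "r m (- x) = - r m x" if "m \<in> {1..6}" for m x y
    using module_hom.add[OF module_hom_linearI[OF r_linear[OF that]]]
      module_hom.neg[OF module_hom_linearI[OF r_linear[OF that]]] by blast+
  show "(r i \<circ> r k \<circ> r i \<circ> r k) (\<alpha> l) = (r k \<circ> r i) (\<alpha> l)"
    by (simp add: r_root[OF i l] r_root[OF k l] r_simps[OF i] r_simps[OF k] add[OF i] add[OF k] v algebra_simps)
qed

lemma weyl_GL: "weyl \<subseteq> carrier (GL sL)"
  by (rule group.generate_incl[OF L.group_GL]) (use r_GL in auto)

lemma target_subgroup: "subgroup target (GL sL)"
proof -
  interpret GL: group "GL sL" by (rule L.group_GL)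
  have "j \<noteq> 0" using j w_facts(3) by auto
  then have "sL j \<circ> sL (1 / j) = id" "sL (1 / j) \<circ> sL j = id" by (auto simp: fun_eq_iff)
  then have "sL j \<in> carrier (GL sL)" using o_bij linear_scalars(2) by (auto simp: GL_simps)
  moreover have "derived (GL sL) weyl \<subseteq> carrier (GL sL)" by (rule GL.derived_in_carrier[OF weyl_GL])
  ultimately show ?thesis by (intro GL.generate_is_subgroup) auto
qed

lemma target_comp: "x \<in> target \<Longrightarrow> y \<in> target \<Longrightarrow> x \<circ> y \<in> target"
  using subgroup.m_closed[OF target_subgroup] by (simp add: GL_simps)

lemma edge_in_target:
  assumes "(k, i) \<in> set edges" shows "r k \<circ> r i \<in> target"
proof -
  have ki: "k \<in> {1..6}" "i \<in> {1..6}" using edge_cases[OF assms] by auto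
  then have m: "r i \<in> weyl" "r k \<in> weyl" by (auto intro: generate.incl)
  have "r i \<otimes>\<^bsub>GL sL\<^esub> r k \<otimes>\<^bsub>GL sL\<^esub> inv\<^bsub>GL sL\<^esub> (r i) \<otimes>\<^bsub>GL sL\<^esub> inv\<^bsub>GL sL\<^esub> (r k) \<in> derived_set (GL sL) weyl"
    using m by blast
  then have "r k \<circ> r i \<in> derived_set (GL sL) weyl"
    using edge_commutator[OF assms] by (simp only: inv_r ki GL_simps(1))
  then have "r k \<circ> r i \<in> derived (GL sL) weyl" unfolding derived_def by (rule generate.incl)
  then show ?thesis by (intro generate.incl) simp
qed

lemma w_in_target: "sL w \<in> target"
proof -
  have sj: "sL j \<in> target" by (intro generate.incl) simp
  from j show ?thesis
  proof
    assume "j = w * w"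
    then have "j * j = w ^ 3 * w" by (simp add: power3_eq_cube)
    then have "sL j \<circ> sL j = sL w" using w_facts(1) by (auto simp: fun_eq_iff)
    then show ?thesis using target_comp[OF sj sj] by simp
  qed (use sj in simp)
qed

definition h :: "nat \<Rightarrow> 'v \<Rightarrow> 'v" where "h m = word (edge_roots ! m)"

lemma h_eq:
  assumes "m < 5"
  shows "h m = refl (edge_roots ! m ! 0) \<circ> refl (edge_roots ! m ! 1)"
proof -
  have "m = 0 \<or> m = 1 \<or> m = 2 \<or> m = 3 \<or> m = 4" using assms by auto
  then show ?thesis by (elim disjE) (simp_all add: h_def edge_roots_def)
qed

text \<open>The roots span, so it suffices to compare images of the six roots, which
  \<open>edges_push6\<close> evaluated in integral coordinates.\<close>

lemma Lam_h:
  assumes m: "m < 5" shows "Lam (h m) = sL w \<circ> (r (fst (edges ! m)) \<circ> r (snd (edges ! m)))"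
proof (rule eq_on_roots)
  define k i where "k = fst (edges ! m)" and "i = snd (edges ! m)"
  have "edges ! m \<in> set edges" using m by (intro nth_mem) (simp add: edges_def)
  then have "(k, i) \<in> set edges" by (simp add: k_def i_def)
  then have ki: "k \<in> {1..6}" "i \<in> {1..6}" using edge_cases by blast+
  let ?a = "edge_roots ! m ! 0" and ?b = "edge_roots ! m ! 1"
  have lin: "Vector_Spaces.linear s s (h m)"
    unfolding h_eq[OF m] by (intro compose_linear linear_refl)
  then show "Vector_Spaces.linear sL sL (Lam (h m))" by (rule Lam_linear)
  show "Vector_Spaces.linear sL sL (sL w \<circ> (r (fst (edges ! m)) \<circ> r (snd (edges ! m))))"
    unfolding k_def[symmetric] i_def[symmetric]
    by (intro compose_linear linear_scalars r_linear ki)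
  fix l :: nat assume l: "l \<in> {1..6}"
  have "list_all (edge_push6 (edge_roots ! m) (edges ! m)) [1,2,3,4,5,6]"
  proof -
    have "m = 0 \<or> m = 1 \<or> m = 2 \<or> m = 3 \<or> m = 4" using m by auto
    then show ?thesis using edges_push6 by (elim disjE) (simp_all only:)
  qed
  moreover have "l \<in> set [1,2,3,4,5,6]" using l by auto
  ultimately have "edge_push6 (edge_roots ! m) (edges ! m) l" by (metis list_all_iff)
  then have ex: "exact6 ?b (simple_root l)" "exact6 ?a (push6 ?b (simple_root l))"
    and eq: "push6 ?a (push6 ?b (simple_root l)) = scale6 om (reflect6_twice k i l)"
    unfolding edge_push6_def k_def i_def by blast+
  have int: "ev (Eis z 0) = of_int z" for z by simp
  have R: "K (reflect6 p q) = sL 3 (\<alpha> q - sL (of_int (cartan_E6 p q)) (\<alpha> p))"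
    if "p \<in> {1..6}" "q \<in> {1..6}" for p q
    unfolding reflect6_def K_add K_scale int roots[OF that(1), symmetric] roots[OF that(2), symmetric]
    by (simp add: algebra_simps)
  have "sL 3 (Lam (h m) (\<alpha> l)) = Lam (h m) (sL 3 (\<alpha> l))"
    using Lam_linear[OF lin] by (simp add: Vector_Spaces.linear_iff)
  also have "\<dots> = Lam (refl ?a) (Lam (refl ?b) (K (simple_root l)))"
    unfolding roots[OF l] h_eq[OF m] by (simp add: Lam_comp[OF linear_refl linear_refl])
  also have "\<dots> = sL w (K (reflect6_twice k i l))"
    by (simp only: push6_K[OF ex(1)] push6_K[OF ex(2)] eq K_scale ev_hom)
  also have "K (reflect6_twice k i l) = sL 3 (r k (r i (\<alpha> l)))"
    unfolding reflect6_twice_def K_add K_scale int R[OF ki(1) l] R[OF ki]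
    by (simp add: r_root[OF ki(2) l] r_root[OF ki(1) l] r_root[OF ki] r_simps[OF ki(1)] algebra_simps)
  also have "sL w (sL 3 (r k (r i (\<alpha> l)))) = sL 3 (sL w (r k (r i (\<alpha> l))))" by (rule L.scale_left_commute)
  finally have "Lam (h m) (\<alpha> l) = sL w (r k (r i (\<alpha> l)))" by (metis L.scale_cancel_left zero_neq_numeral)
  then show "Lam (h m) (\<alpha> l) = (sL w \<circ> (r (fst (edges ! m)) \<circ> r (snd (edges ! m)))) (\<alpha> l)"
    by (simp add: k_def i_def)
qed

lemma h_in_G: "m < 5 \<Longrightarrow> h m \<in> G"
proof -
  have *: "word as \<in> G" if "same_up_to k as (map ((!) gens) is)" "set is \<subseteq> {0..<4}" for k as "is"
  proof -
    have "set (map ((!) gens) is) \<subseteq> set gens" 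
    proof
      fix x assume "x \<in> set (map ((!) gens) is)"
      then obtain i where i: "i \<in> set is" "x = gens ! i" by auto
      then have "i < length gens" using that(2) by (auto simp: gens_eq)
      then show "x \<in> set gens" unfolding i(2) by (rule nth_mem)
    qed
    then have "s (ev zeta ^ k) \<circ> word (map ((!) gens) is) \<in> G" by (intro G_facts(2) scalar_in_G word_in_G)
    moreover have "word as = s (ev zeta ^ k) \<circ> word (map ((!) gens) is)"
      using same_up_to_word[OF that(1)] by (auto simp: fun_eq_iff)
    ultimately show ?thesis by simp
  qed
  assume "m < 5"
  then have "m = 0 \<or> m = 1 \<or> m = 2 \<or> m = 3 \<or> m = 4" by auto
  then show ?thesis unfolding h_def
    using *[OF edge_words(1)] *[OF edge_words(2)] *[OF edge_words(3)] *[OF edge_words(4)] *[OF edge_words(5)]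
    by (elim disjE) simp_all
qed

section \<open>The image of the reflection group on the exterior square\<close>

definition S :: "('l \<Rightarrow> 'l) set" where "S = Lam ` G"

lemma S_subgroup: "subgroup S (GL sL)"
proof (rule group.subgroupI[OF L.group_GL])
  have inv: "\<exists>g'\<in>G. Lam g \<in> carrier (GL sL) \<and> Lam g' \<circ> Lam g = id \<and> Lam g' \<in> carrier (GL sL)" if g: "g \<in> G" for g
  proof -
    obtain g' where g': "g' \<in> G" "g \<circ> g' = id" "g' \<circ> g = id" using G_facts(5)[OF g] by blast
    have c: "g \<in> carrier (GL s)" "g' \<in> carrier (GL s)" using G_facts(3,4) g g'(1) by (auto simp: GL_simps)
    show ?thesis
      using Lam_GL[OF c(1) g'(3,2) G_facts(3)[OF g'(1)]] Lam_GL[OF c(2) g'(2,3) G_facts(3)[OF g]] g'(1) by blast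
  qed
  show "S \<subseteq> carrier (GL sL)" using inv by (auto simp: S_def)
  show "S \<noteq> {}" using G_facts(1) by (auto simp: S_def)
  show "inv\<^bsub>GL sL\<^esub> x \<in> S" if "x \<in> S" for x
  proof -
    from that obtain g where g: "g \<in> G" "x = Lam g" by (auto simp: S_def)
    obtain g' where g': "g' \<in> G" "Lam g \<in> carrier (GL sL)" "Lam g' \<circ> Lam g = id" "Lam g' \<in> carrier (GL sL)"
      using inv[OF g(1)] by blast
    have "inv\<^bsub>GL sL\<^esub> x = Lam g'"
      unfolding g(2) by (rule group.inv_equality[OF L.group_GL]) (use g' in \<open>auto simp: GL_simps(1,2)\<close>)
    then show ?thesis using g'(1) by (simp add: S_def)
  qed
  show "x \<otimes>\<^bsub>GL sL\<^esub> y \<in> S" if "x \<in> S" "y \<in> S" for x y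
  proof -
    from that obtain g g' where "g \<in> G" "x = Lam g" "g' \<in> G" "y = Lam g'" by (auto simp: S_def)
    then have "x \<otimes>\<^bsub>GL sL\<^esub> y = Lam (g \<circ> g')" "g \<circ> g' \<in> G"
      using Lam_comp[of g g'] G_facts(2)[of g g'] G_facts(3) by (simp_all add: GL_simps(1))
    then show ?thesis by (simp add: S_def)
  qed
qed

lemma S_comp: "x \<in> S \<Longrightarrow> y \<in> S \<Longrightarrow> x \<circ> y \<in> S"
  using subgroup.m_closed[OF S_subgroup] by (simp add: GL_simps)

text \<open>A scalar acts on the exterior square by its square, and \<open>w\<close> is the square
  of \<open>w * w\<close>.\<close>

lemma scalar_in_S: "sL w \<in> S" "sL (w * w) \<in> S"
proof -
  have u: "s (ev om) \<in> G" "s (ev (om * om)) \<in> G" by (rule unit_in_G; simp add: units_def)+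
  have "Lam (s (ev (om * om))) = sL (w ^ 3 * w)" by (simp add: Lam_scalar power3_eq_cube mult_ac)
  then have "Lam (s (ev (om * om))) = sL w" by (simp only: w_facts(1) mult_1)
  moreover have "Lam (s (ev om)) = sL (w * w)" by (simp add: Lam_scalar)
  ultimately show "sL w \<in> S" "sL (w * w) \<in> S" using u unfolding S_def by (metis imageI)+
qed

lemma edge_in_S:
  assumes "(k, i) \<in> set edges" shows "r k \<circ> r i \<in> S"
proof -
  obtain m where m: "m < length edges" "edges ! m = (k, i)" using assms by (metis in_set_conv_nth)
  have "m < 5" using m(1) by (simp add: edges_def)
  note m = this m(2)
  have "sL (w * w) \<circ> Lam (h m) \<in> S"
    by (rule S_comp[OF scalar_in_S(2)]) (use h_in_G[OF m(1)] in \<open>simp add: S_def\<close>)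
  moreover have "sL (w * w) \<circ> Lam (h m) = r k \<circ> r i"
  proof
    fix x
    have "w * w * w = 1" using w_facts(1) by (simp add: power3_eq_cube)
    then show "(sL (w * w) \<circ> Lam (h m)) x = (r k \<circ> r i) x" by (simp add: Lam_h[OF m(1)] m(2))
  qed
  ultimately show ?thesis by simp
qed

text \<open>The diagram is connected: along the path through node 4 the inner reflections cancel, so
  every product of two simple reflections is a product of edge elements and inverses.\<close>

lemma pair_in_S:
  assumes "i \<in> {1..6}" "k \<in> {1..6}" shows "r i \<circ> r k \<in> S"
proof -
  have sym: "r k \<circ> r i \<in> S" if "r i \<circ> r k \<in> S" "i \<in> {1..6}" "k \<in> {1..6}" for i k
  proof -
    have c: "r i \<circ> r k \<in> carrier (GL sL)" using subgroup.mem_carrier[OF S_subgroup that(1)] .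
    have c': "r k \<circ> r i \<in> carrier (GL sL)"
      using monoid.m_closed[OF group.is_monoid[OF L.group_GL] r_GL[OF that(3)] r_GL[OF that(2)]] by (simp add: GL_simps(1))
    have "r k \<circ> r i \<circ> (r i \<circ> r k) = r k \<circ> (r i \<circ> r i) \<circ> r k" by (simp add: comp_assoc)
    also have "\<dots> = id" unfolding r_involution[OF that(2)] comp_id r_involution[OF that(3)] ..
    finally have "inv\<^bsub>GL sL\<^esub> (r i \<circ> r k) = r k \<circ> r i"
      using c c' by (intro group.inv_equality[OF L.group_GL]) (simp_all add: GL_simps(1,2))
    then show ?thesis using subgroup.m_inv_closed[OF S_subgroup that(1)] by simp
  qed
  have tr: "r i \<circ> r l \<in> S" if "r i \<circ> r k \<in> S" "r k \<circ> r l \<in> S" "k \<in> {1..6}" for i k l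
  proof -
    have "r i \<circ> r k \<circ> (r k \<circ> r l) = r i \<circ> (r k \<circ> r k) \<circ> r l" by (simp add: comp_assoc)
    then show ?thesis using S_comp[OF that(1,2)] unfolding r_involution[OF that(3)] comp_id by simp
  qed
  have e: "r 1 \<circ> r 3 \<in> S" "r 6 \<circ> r 5 \<in> S" "r 2 \<circ> r 4 \<in> S" "r 3 \<circ> r 4 \<in> S" "r 4 \<circ> r 5 \<in> S"
    by (rule edge_in_S; simp add: edges_def)+
  have r4: "r 4 \<circ> r i \<in> S" if "i \<in> {1..6}" for i
  proof -
    have 43: "r 4 \<circ> r 3 \<in> S" and 42: "r 4 \<circ> r 2 \<in> S" by (rule sym; use e in simp)+
    have 41: "r 4 \<circ> r 1 \<in> S" by (rule tr[OF 43 sym[OF e(1)]]) simp_all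
    have 46: "r 4 \<circ> r 6 \<in> S" by (rule tr[OF e(5) sym[OF e(2)]]) simp_all
    have 44: "r 4 \<circ> r 4 \<in> S" by (rule tr[OF 43 e(4)]) simp
    have "i = 1 \<or> i = 2 \<or> i = 3 \<or> i = 4 \<or> i = 5 \<or> i = 6" using that by auto
    then show ?thesis using 41 42 43 44 46 e(5) by blast
  qed
  show ?thesis by (rule tr[OF sym[OF r4[OF assms(1)]] r4[OF assms(2)]]) (use assms in auto)
qed

fun rword :: "nat list \<Rightarrow> 'l \<Rightarrow> 'l" where
  "rword [] = id"
| "rword (i # is) = r i \<circ> rword is"

lemma rword_append: "rword (as @ bs) = rword as \<circ> rword bs"
  by (induction as) (auto simp: comp_assoc)

lemma even_rword: "set is \<subseteq> {1..6} \<Longrightarrow> even (length is) \<Longrightarrow> rword is \<in> S"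
proof (induction "is" rule: induct_list012)
  case 1
  then show ?case using subgroup.one_closed[OF S_subgroup] unfolding rword.simps GL_simps(2) by blast
next
  case (3 i k js)
  then have "r i \<circ> r k \<circ> rword js \<in> S" by (intro S_comp pair_in_S) simp_all
  then show ?case unfolding rword.simps comp_assoc .
qed simp

lemma weyl_rword: "x \<in> weyl \<Longrightarrow> \<exists>is. set is \<subseteq> {1..6} \<and> x = rword is"
proof (induction rule: generate.induct)
  case one
  show ?case by (intro exI[of _ "[]"]) (simp add: GL_simps)
next
  case (incl x)
  then obtain i where "i \<in> {1..6}" "x = r i" by blast
  then show ?case by (intro exI[of _ "[i]"]) simp
next
  case (inv x)
  then obtain i where "i \<in> {1..6}" "x = r i" by blast
  then show ?case by (intro exI[of _ "[i]"]) (simp add: inv_r)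
next
  case (eng x y)
  then obtain as bs where "set as \<subseteq> {1..6}" "x = rword as" "set bs \<subseteq> {1..6}" "y = rword bs" by blast
  then show ?case by (intro exI[of _ "as @ bs"]) (simp add: GL_simps rword_append)
qed

lemma inv_rword:
  assumes "set is \<subseteq> {1..6}" shows "inv\<^bsub>GL sL\<^esub> (rword is) = rword (rev is)"
proof -
  have c: "rword as \<in> carrier (GL sL)" if "set as \<subseteq> {1..6}" for as
    using that
  proof (induction as)
    case Nil
    then show ?case using monoid.one_closed[OF group.is_monoid[OF L.group_GL]] unfolding rword.simps GL_simps(2) by blast
  next
    case (Cons i as)
    then have "r i \<otimes>\<^bsub>GL sL\<^esub> rword as \<in> carrier (GL sL)"
      by (intro monoid.m_closed[OF group.is_monoid[OF L.group_GL]] r_GL) simp_all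
    then show ?case unfolding rword.simps GL_simps(1) .
  qed
  have "rword (rev is) \<circ> rword is = id"
    using assms
  proof (induction "is")
    case (Cons i "is")
    have "rword (rev (i # is)) \<circ> rword (i # is) = rword (rev is) \<circ> (r i \<circ> r i) \<circ> rword is"
      by (simp add: rword_append comp_assoc)
    also have "\<dots> = rword (rev is) \<circ> rword is"
      using r_involution[of i] Cons.prems by simp
    also have "\<dots> = id" using Cons.IH Cons.prems by (simp only: list.set insert_subset)
    finally show ?case .
  qed simp
  then show ?thesis
    by (intro group.inv_equality[OF L.group_GL]) (use assms c in \<open>simp_all add: GL_simps(1,2)\<close>)
qed

text \<open>The inverse of a word is its reversal, so a commutator is a word of even length and
  splits into pairs.\<close>

lemma target_subset_S: "target \<subseteq> S"
proof -
  have "derived_set (GL sL) weyl \<subseteq> S"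
  proof clarify
    fix x y assume "x \<in> weyl" "y \<in> weyl"
    then obtain as bs where ab: "set as \<subseteq> {1..6}" "x = rword as" "set bs \<subseteq> {1..6}" "y = rword bs"
      using weyl_rword by metis
    have "rword (as @ bs @ rev as @ rev bs) \<in> S" by (rule even_rword) (use ab in auto)
    then show "x \<otimes>\<^bsub>GL sL\<^esub> y \<otimes>\<^bsub>GL sL\<^esub> inv\<^bsub>GL sL\<^esub> x \<otimes>\<^bsub>GL sL\<^esub> inv\<^bsub>GL sL\<^esub> y \<in> S"
      by (simp add: ab(2,4) inv_rword[OF ab(1)] inv_rword[OF ab(3)] GL_simps(1) rword_append comp_assoc)
  qed
  then have "derived (GL sL) weyl \<subseteq> S"
    unfolding derived_def by (rule group.generate_subgroup_incl[OF L.group_GL _ S_subgroup])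
  then show ?thesis
    using scalar_in_S j by (intro group.generate_subgroup_incl[OF L.group_GL _ S_subgroup]) auto
qed

text \<open>\<open>G\<close> contains the whole kernel of \<open>Lam\<close>, since
  \<open>s (- 1)\<close> is one of its unit scalars; hence it contains everything that
  \<open>Lam\<close> maps into its image. Conversely its generators are unit scalars times edge
  elements, both of which map into \<open>target\<close>.\<close>

theorem preimage_eq_G: "{g \<in> carrier (GL s). Lam g \<in> target} = G"
proof
  show "{g \<in> carrier (GL s). Lam g \<in> target} \<subseteq> G"
  proof clarify
    fix g assume g: "g \<in> carrier (GL s)" "Lam g \<in> target"
    then obtain k where k: "k \<in> G" "Lam g = Lam k" using target_subset_S by (auto simp: S_def)
    obtain k' where k': "k' \<in> G" "k \<circ> k' = id" "k' \<circ> k = id" using G_facts(5)[OF k(1)] by blast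
    have lg: "Vector_Spaces.linear s s g" using g(1) by (simp add: GL_def)
    have "Lam (k' \<circ> g) = Lam (k' \<circ> k)" by (simp add: Lam_comp lg G_facts(3) k k'(1))
    then have "Lam (k' \<circ> g) = id" by (simp add: k'(3) Lam_id)
    then have "k' \<circ> g = id \<or> k' \<circ> g = s (- 1)"
      by (intro Lam_kernel compose_linear lg G_facts(3)[OF k'(1)])
    moreover have "s (- 1) \<in> G" using unit_in_G[of "- 1"] by (simp add: units_def)
    ultimately have "k' \<circ> g \<in> G" using G_facts(1) by auto
    then have "k \<circ> (k' \<circ> g) \<in> G" using G_facts(2)[OF k(1)] by blast
    then show "g \<in> G" using k'(2) by (simp add: comp_assoc[symmetric])
  qed
  define W where "W = {g \<in> carrier (GL s). Lam g \<in> target}"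
  have comp: "g \<circ> k \<in> W" if "g \<in> W" "k \<in> W" for g k
    using that target_comp[of "Lam g" "Lam k"] Lam_comp[of g k] bij_comp[of k g] compose_linear(1)[of g k]
    by (auto simp: W_def GL_simps)
  have idW: "id \<in> W"
    using subgroup.one_closed[OF target_subgroup] monoid.one_closed[OF group.is_monoid[OF group_GL]]
    by (simp add: W_def Lam_id GL_simps(2))
  have GC: "g \<in> carrier (GL s)" if "g \<in> G" for g using G_facts(3,4)[OF that] by (simp add: GL_simps)
  have hW: "h m \<in> W" if "m < 5" for m
  proof -
    have "edges ! m \<in> set edges" using that by (intro nth_mem) (simp add: edges_def)
    then have "r (fst (edges ! m)) \<circ> r (snd (edges ! m)) \<in> target" by (intro edge_in_target) simp
    then show ?thesis using GC[OF h_in_G[OF that]] target_comp[OF w_in_target] by (simp add: W_def Lam_h[OF that])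
  qed
  have zW: "s (ev zeta ^ k) \<in> W" for k
  proof (induction k)
    case 0
    have "s (ev zeta ^ 0) = id" by (auto simp: fun_eq_iff)
    then show ?case using idW by (simp only:)
  next
    case (Suc k)
    have "ev zeta * ev zeta = w ^ 3 * w" by (simp add: ev_zeta power3_eq_cube mult_ac)
    then have "Lam (s (ev zeta)) = sL w" by (simp only: Lam_scalar w_facts(1) mult_1)
    then have "s (ev zeta) \<in> W" using w_in_target GC[OF scalar_in_G[of 1]] by (simp add: W_def)
    moreover have "s (ev zeta) \<circ> s (ev zeta ^ k) = s (ev zeta ^ Suc k)" by (auto simp: fun_eq_iff)
    ultimately show ?case using comp[OF _ Suc.IH] by metis
  qed
  have edge_word: "word (edge_word is) \<in> W" if "set is \<subseteq> {0..<5}" for "is"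
    using that by (induction "is") (auto simp: edge_word_def word_append idW h_def[symmetric] intro!: comp hW)
  have *: "refl a \<in> W" if "same_up_to k [a] (edge_word is)" "set is \<subseteq> {0..<5}" for a k "is"
  proof -
    have "refl a = s (ev zeta ^ k) \<circ> word (edge_word is)"
      using same_up_to_word[OF that(1)] by (auto simp: fun_eq_iff)
    then show ?thesis using comp[OF zW edge_word[OF that(2)]] by simp
  qed
  have g: "refl (gens ! 0) \<in> W" "refl (gens ! 1) \<in> W" "refl (gens ! 2) \<in> W" "refl (gens ! 3) \<in> W"
    by (rule *[OF gens_words(1)] *[OF gens_words(2)] *[OF gens_words(3)] *[OF gens_words(4)]; simp)+
  have "set gens = {gens ! 0, gens ! 1, gens ! 2, gens ! 3}" by (simp add: gens_eq)
  then have refl: "refl a \<in> W" if "a \<in> set gens" for a using g that by auto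
  have "word as \<in> W" if "set as \<subseteq> set gens" for as
    using that by (induction as) (auto intro: idW comp refl)
  then have "G \<subseteq> W" using G_word by blast
  then show "G \<subseteq> {g \<in> carrier (GL s). Lam g \<in> target}" by (simp add: W_def)
qed

end

end

section \<open>The Gram matrix of an abstract E6\<close>

context ext_frame
begin

text \<open>Invariance of the form under the reflection r_i determines its values against the root i
  by the length of that root, and connectedness of the diagram makes all lengths equal. The common
  factor is nonzero because the roots span and the form is not zero.\<close>

lemma weyl_gram:
  assumes r: "\<And>i. i \<in> {1..6} \<Longrightarrow> r i \<in> orthogonal_group sL beta"
    and root: "\<And>i k. i \<in> {1..6} \<Longrightarrow> k \<in> {1..6} \<Longrightarrow> r i (a k) = a k - sL (of_int (cartan_E6 i k)) (a i)"
    and span: "L.span (a ` {1..6}) = UNIV"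
  shows "\<exists>c. c \<noteq> 0 \<and> (\<forall>i\<in>{1..6}. \<forall>k\<in>{1..6}. beta (a i) (a k) = c * of_int (cartan_E6 i k))"
proof -
  have two: "2 * beta (a i) (a k) = of_int (cartan_E6 i k) * beta (a i) (a i)" if "i \<in> {1..6}" "k \<in> {1..6}" for i k
  proof -
    have d: "cartan_E6 i i = 2" by (simp add: cartan_E6_def)
    have "beta (r i (a i)) (r i (a k)) = beta (a i) (a k)" using r[OF that(1)] by (simp add: orthogonal_group_def)
    then show ?thesis unfolding root[OF that(1) that(1)] root[OF that] beta_simps d by (simp add: algebra_simps)
  qed
  have edge: "beta (a i) (a i) = beta (a k) (a k)" if "(i, k) \<in> {(1, 3), (3, 4), (4, 5), (5, 6), (2, 4)}" for i k
  proof -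
    have ik: "i \<in> {1..6}" "k \<in> {1..6}" "cartan_E6 i k = - 1" "cartan_E6 k i = - 1"
      using that by (auto simp: cartan_E6_def)
    show ?thesis using two[OF ik(1,2)] two[OF ik(2,1)] beta_sym[of "a i" "a k"] by (simp add: ik(3,4))
  qed
  define c where "c = beta (a 1) (a 1) / 2"
  have "beta (a i) (a i) = 2 * c" if "i \<in> {1..6}" for i
  proof -
    have "i = 1 \<or> i = 2 \<or> i = 3 \<or> i = 4 \<or> i = 5 \<or> i = 6" using that by auto
    then show ?thesis using edge[of 1 3] edge[of 3 4] edge[of 4 5] edge[of 5 6] edge[of 2 4]
      by (elim disjE) (simp_all add: c_def)
  qed
  with two have b: "beta (a i) (a k) = c * of_int (cartan_E6 i k)" if "i \<in> {1..6}" "k \<in> {1..6}" for i k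
    using that two[OF that] by simp
  moreover have "c \<noteq> 0"
  proof
    assume "c = 0"
    then have z: "beta x y = 0" if "x \<in> a ` {1..6}" "y \<in> a ` {1..6}" for x y using b that by auto
    interpret Q: vector_space_pair sL "(*) :: complex \<Rightarrow> complex \<Rightarrow> complex"
      using vector_space_L vector_space_scalars by (simp add: vector_space_pair_def)
    have lin: "L.functional (beta x)" "L.functional (\<lambda>x. beta x y)" for x y
      using beta_bilinear by (auto simp: bilinear_form_def)
    have "beta x y = 0" if "x \<in> a ` {1..6}" for x y
      by (rule Q.linear_eq_0_on_span[OF lin(1), of "a ` {1..6}"]) (use z[OF that] span in auto)
    then have "beta x y = 0" for x y
      by (rule Q.linear_eq_0_on_span[OF lin(2), of "a ` {1..6}"]) (use span in auto)
    then show False using kappa_nonzero by (simp add: kappa_def)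
  qed
  ultimately show ?thesis by blast
qed

end

lemma (in witting_ext) e6_coordinates_K:
  assumes "e6_coordinates w e a" "i \<in> {1..6}"
  shows "sL 3 (a i) = K (simple_root i)"
proof -
  have th: "ev th = 2 * w + 1" by (simp add: th_def)
  have swap: "w2 [e 3, e 1] = - E 1 3" by (rule w2_simps(6))
  note c = assms(1)[unfolded e6_coordinates_def Let_def swap th[symmetric]]
  have "i = 1 \<or> i = 2 \<or> i = 3 \<or> i = 4 \<or> i = 5 \<or> i = 6" using assms(2) by auto
  then show ?thesis using c by (elim disjE) simp_all
qed

theorem mainTheorem1:
  fixes sV :: "complex \<Rightarrow> 'v::ab_group_add \<Rightarrow> 'v"
    and sL :: "complex \<Rightarrow> 'l::ab_group_add \<Rightarrow> 'l"
    and sM :: "complex \<Rightarrow> 'm::ab_group_add \<Rightarrow> 'm"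
    and w2 :: "'v list \<Rightarrow> 'l" and w4 :: "'v list \<Rightarrow> 'm" and \<epsilon> :: 'm
    and j :: complex and E6 :: "('l \<Rightarrow> 'l) set" and W :: "('v \<Rightarrow> 'v) set"
  assumes "vector_space sV" and "vector_space.dim sV UNIV = 4"
    and "exterior_power 2 sV sL w2" and "exterior_power 4 sV sM w4"
    and "module.span sM {\<epsilon>} = UNIV"
    and "j ^ 3 = 1" and "j \<noteq> 1"
    and "finite E6" and "E6 \<subseteq> orthogonal_group sL (wedge_form w2 sL w4 sM \<epsilon>)"
    and "is_weyl_group_E6 sL E6"
    and "W = {g \<in> carrier (GL sV).
               ext_square_map sL w2 g \<in> generate (GL sL) (derived (GL sL) E6 \<union> {sL j})}"
  shows "card W = 155520 \<and>
    (\<exists>R. (\<forall>r\<in>R. is_reflection sV r \<and> group.ord (GL sV) r = 3) \<and> W = generate (GL sV) R) \<and>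
    is_irreducible sV W \<and> is_primitive sV W \<and>
    has_degrees sV W [12, 18, 24, 30]"
proof -
  interpret V: ext_space sV sL sM w2 w4 \<epsilon>
    by (intro ext_space.intro ext_space_axioms.intro complex_space.intro assms)
  obtain e X where fr: "frame4 sV e X" using V.exists_frame[OF assms(2)] by blast
  interpret F: ext_frame sV sL sM w2 w4 \<epsilon> e X by (intro ext_frame.intro V.ext_space_axioms fr)
  obtain \<alpha> r where \<alpha>: "V.L.span (\<alpha> ` {1..6}) = UNIV"
    and r: "\<And>i. i \<in> {1..6} \<Longrightarrow> r i \<in> carrier (GL sL)"
    and root: "\<And>i k. i \<in> {1..6} \<Longrightarrow> k \<in> {1..6} \<Longrightarrow> r i (\<alpha> k) = \<alpha> k - sL (of_int (cartan_E6 i k)) (\<alpha> i)"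
    and E6: "E6 = generate (GL sL) (r ` {1..6})"
    using assms(10) unfolding is_weyl_group_def by blast
  have orth: "r i \<in> orthogonal_group sL V.beta" if "i \<in> {1..6}" for i
    using assms(9) that unfolding E6 by (blast intro: generate.incl)
  obtain c where c: "c \<noteq> 0"
    "\<And>i k. i \<in> {1..6} \<Longrightarrow> k \<in> {1..6} \<Longrightarrow> V.beta (\<alpha> i) (\<alpha> k) = c * of_int (cartan_E6 i k)"
    using F.weyl_gram[OF orth root \<alpha>] by blast
  have "(j - 1) * (j * j + j + 1) = j ^ 3 - 1" by (simp add: algebra_simps power3_eq_cube)
  then have "j * j + j + 1 = 0" using assms(6,7) by simp
  then have j: "j * j = - j - 1" by (simp add: add_eq_0_iff algebra_simps) (metis add.commute add_diff_cancel_left' diff_minus_eq_add minus_diff_eq uminus_add_conv_diff)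
  obtain f Y v where f: "frame4 sV f Y" and v: "v = j \<or> v = j * j" and coords: "V.e6_coordinates v f \<alpha>"
    by (rule F.e6_normal_form[OF j c])
  have jjj: "j * j * j = 1" using assms(6) by (simp add: power3_eq_cube)
  have vv: "v * v = - v - 1"
    using v
  proof
    assume "v = j * j"
    then have "v * v = j * j * j * j" by (simp add: mult_ac)
    then have "v * v = j" by (simp only: jjj mult_1)
    moreover have "v = - j - 1" using \<open>v = j * j\<close> j by simp
    ultimately show ?thesis by simp
  qed (simp add: j)
  \<comment> \<open>The normal form may come with the other primitive cube root. Each is the square
    of the other, so the scalar \<open>sL j\<close> fits the coordinates in both cases.\<close>
  have jv: "j = v \<or> j = v * v"
    using v
  proof
    assume "v = j * j"
    then have "v * v = j * j * j * j" by (simp add: mult_ac)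
    then have "v * v = j" by (simp only: jjj mult_1)
    then show ?thesis by simp
  qed simp
  interpret Z: witting_ext sV sL sM w2 w4 \<epsilon> f Y v
    by (intro witting_ext.intro ext_frame.intro witting_frame.intro witting_frame_axioms.intro V.ext_space_axioms f vv)
  have "W = Z.G"
    unfolding assms(11) E6 by (rule Z.preimage_eq_G[OF Z.e6_coordinates_K[OF coords] \<alpha> r root jv])
  then have "card W = 155520" "is_irreducible sV W" "is_primitive sV W" "has_degrees sV W [12, 18, 24, 30]"
    using Z.card_G Z.degrees Z.irreducible[of Z.G] Z.primitive[of Z.G] Z.refl_in_G by auto
  moreover have "W = generate (GL sV) (Z.refl ` set gens)" using \<open>W = Z.G\<close> by (simp add: Z.G_def)
  moreover have "\<forall>r\<in>Z.refl ` set gens. is_reflection sV r \<and> group.ord (GL sV) r = 3"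
    using Z.is_reflection_refl Z.gens_norm by auto
  ultimately show ?thesis by blast
qed

end
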